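(* Let $n\ge 2$ and $k\ge 3$ be integers. If $\varepsilon\in\mathbb{C}$, $\varepsilon\neq 0$, is sufficiently small, then the RS-instanton bundle $E_\varepsilon$ on $\mathbb{P}^{2n+1}$ defined by the matrix $A_\varepsilon$ satisfies $H^0(\mathbb{P}^{2n+1},E_\varepsilon(1))=0$.
   Context: Work over $\mathbb{C}$. Fix homogeneous coordinates $x_0,\dots,x_n,y_0,\dots,y_n$ on $\mathbb{P}:=\mathbb{P}^{2n+1}$. Let $F$ be the $k\times(n+k)$-matrix with entries $F_{ij}=x_{j-i}$ if $0\le j-i\le n$ and $F_{ij}=0$ otherwise. For $\varepsilon\in\mathbb{C}$ let $H_\varepsilon$ be the $k\times(n+k)$-matrix whose $(i,j)$ entry is $y_{i+j-k-1}$ if $0\le i+j-k-1\le n$ and $0$ otherwise, except that the $(1,1)$ entry and the $(k,n+k)$ entry are both equal to $\varepsilon y_1$. Put $A_\varepsilon:=(F|H_\varepsilon)$, a $k\times(2n+2k)$-matrix of linear forms, and let $J=\begin{pmatrix}0&I\\-I&0\end{pmatrix}$ be the standard symplectic form on $\mathbb{C}^{2n+2k}$. One has $A_\varepsilon JA_\varepsilon^t=0$, and for $|\varepsilon|$ small enough $A_\varepsilon$ has rank $k$ at every point of $\mathbb{P}$; then $E_\varepsilon$ denotes the vector bundle which is the cohomology $\ker(A_\varepsilon)/\mathrm{im}(JA_\varepsilon^t)$ of the monad $$\mathcal{O}_{\mathbb{P}}(-1)^{\oplus k}\xrightarrow{JA_\varepsilon^t}\mathcal{O}_{\mathbb{P}}^{2n+2k}\xrightarrow{A_\varepsilon}\mathcal{O}_{\mathbb{P}}(1)^{\oplus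 k}.$$ It is a symplectic instanton bundle of charge $k$ (an RS-instanton bundle, i.e. one given by a matrix $(F|H)$ with $F_{ij}=f_{j-i}$ for linear forms $f_0,\dots,f_n$ and $H$ a matrix of linear forms $h_{ij}$ depending only on $i+j$, such that the $n$-dimensional linear space $\{f_0=\dots=f_n=0\}$ contains no zeros of the maximal minors of $H$). *)

theory Defs
  imports Complex_Main "HOL-Library.FuncSet" "Jordan_Normal_Form.DL_Rank"
begin

section \<open>Forms and the Zariski topology on projective space\<close>

text \<open>
  The projective space with \<open>m\<close> homogeneous coordinates is handled through its punctured affine
  cone: subsets of projective space are identified with their (scale-invariant) preimages in
  \<open>cone m\<close>. Forms are functions on the cone; over the infinite field of complex numbers
  they correspond bijectively to homogeneous polynomials.
\<close>

definition cone :: "nat \<Rightarrow> complex vec set" where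
  "cone m = carrier_vec m - {0\<^sub>v m}"

definition exponents :: "nat \<Rightarrow> nat \<Rightarrow> (nat \<Rightarrow> nat) set" where
  "exponents m d = {a. (\<forall>i\<ge>m. a i = 0) \<and> (\<Sum>i<m. a i) = d}"

lemma finite_exponents: "finite (exponents m d)"
proof (rule finite_subset)
  show "exponents m d \<subseteq> {a. \<forall>i. (i \<in> {..<m} \<longrightarrow> a i \<in> {..d}) \<and> (i \<notin> {..<m} \<longrightarrow> a i = 0)}"
    by (auto simp: exponents_def intro: member_le_sum)
  show "finite {a. \<forall>i. (i \<in> {..<m} \<longrightarrow> a i \<in> {..d}) \<and> (i \<notin> {..<m} \<longrightarrow> a i = (0::nat))}"
    by (rule finite_set_of_finite_funs) auto
qed

definition is_form :: "nat \<Rightarrow> nat \<Rightarrow> (complex vec \<Rightarrow> complex) \<Rightarrow> bool" where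
  "is_form m d f \<longleftrightarrow>
     (\<exists>c. \<forall>p\<in>carrier_vec m. f p = (\<Sum>a\<in>exponents m d. c a * (\<Prod>i<m. (p $ i) ^ a i)))"

definition zariski_open :: "nat \<Rightarrow> complex vec set \<Rightarrow> bool" where
  "zariski_open m U \<longleftrightarrow>
     (\<exists>S. (\<forall>f\<in>S. \<exists>d. is_form m d f) \<and> U = {p \<in> cone m. \<exists>f\<in>S. f p \<noteq> 0})"

section \<open>The sheaves \<open>\<O>(d)\<close> and quotient sheaves\<close>

text \<open>
  Sections of \<open>\<O>(d)\<close> over \<open>U\<close>: functions on the cone over \<open>U\<close> that are locally quotients of
  forms whose degrees differ by \<open>d\<close>. Only the values on \<open>U\<close> matter.
\<close>

definition O_sections :: "nat \<Rightarrow> int \<Rightarrow> complex vec set \<Rightarrow> (complex vec \<Rightarrow> complex) set" where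
  "O_sections m d U = {f. \<forall>p\<in>U. \<exists>W P Q a b. zariski_open m W \<and> p \<in> W \<and> W \<subseteq> U \<and>
     is_form m a P \<and> is_form m b Q \<and> int a = int b + d \<and>
     (\<forall>q\<in>W. Q q \<noteq> 0 \<and> f q = P q / Q q)}"

definition O_vec_sections ::
    "nat \<Rightarrow> nat \<Rightarrow> int \<Rightarrow> complex vec set \<Rightarrow> (complex vec \<Rightarrow> complex vec) set" where
  "O_vec_sections m r d U = {v. (\<forall>p\<in>U. v p \<in> carrier_vec r) \<and>
     (\<forall>i<r. (\<lambda>p. v p $ i) \<in> O_sections m d U)}"

type_synonym vec_presheaf = "complex vec set \<Rightarrow> (complex vec \<Rightarrow> complex vec) set"
type_synonym germ = "(complex vec set \<times> (complex vec \<Rightarrow> complex vec)) set"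

text \<open>
  For presheaves \<open>I \<subseteq> K\<close> of vector-valued functions, \<open>quotient_germ m K I U v p\<close> is the class of
  the local section \<open>v \<in> K U\<close> in the stalk of \<open>K / I\<close> at \<open>p\<close>, realised as the set of all local
  sections \<open>(W, w)\<close> of \<open>K\<close> near \<open>p\<close> that differ from \<open>v\<close> by a section of \<open>I\<close> on some
  neighbourhood of \<open>p\<close>. It depends only on the line through \<open>p\<close>, as open sets are
  scale-invariant. The quotient sheaf is the sheafification of \<open>U \<mapsto> K U / I U\<close>: its sections
  are the families of germs that locally come from sections of \<open>K\<close>.
\<close>

definition quotient_germ ::
    "nat \<Rightarrow> vec_presheaf \<Rightarrow> vec_presheaf \<Rightarrow> complex vec set \<Rightarrow> (complex vec \<Rightarrow> complex vec) \<Rightarrow>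
     complex vec \<Rightarrow> germ" where
  "quotient_germ m K I U v p = {(W, w). zariski_open m W \<and> p \<in> W \<and> w \<in> K W \<and>
     (\<exists>V. zariski_open m V \<and> p \<in> V \<and> V \<subseteq> U \<inter> W \<and> (\<lambda>q. v q - w q) \<in> I V)}"

definition quotient_sheaf ::
    "nat \<Rightarrow> vec_presheaf \<Rightarrow> vec_presheaf \<Rightarrow> complex vec set \<Rightarrow> (complex vec \<Rightarrow> germ) set" where
  "quotient_sheaf m K I U = {s \<in> extensional U. \<forall>p\<in>U. \<exists>W v. zariski_open m W \<and> p \<in> W \<and> W \<subseteq> U \<and>
     v \<in> K W \<and> (\<forall>q\<in>W. s q = quotient_germ m K I W v q)}"

section \<open>Symplectic monads and their cohomology bundle\<close>

text \<open>
  A monad \<open>\<O>(-1)\<^sup>k \<rightarrow> \<O>\<^sup>2\<^sup>N \<rightarrow> \<O>(1)\<^sup>k\<close> is given by a \<open>k \<times> 2N\<close>-matrix of linear forms, that is, by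
  a matrix-valued function \<open>A\<close> on the cone.
\<close>

definition sympl_J :: "nat \<Rightarrow> complex mat" where
  "sympl_J N = four_block_mat (0\<^sub>m N N) (1\<^sub>m N) (- 1\<^sub>m N) (0\<^sub>m N N)"

definition is_symplectic_monad ::
    "nat \<Rightarrow> nat \<Rightarrow> nat \<Rightarrow> (complex vec \<Rightarrow> complex mat) \<Rightarrow> bool" where
  "is_symplectic_monad m k N A \<longleftrightarrow>
     (\<forall>p\<in>carrier_vec m. A p \<in> carrier_mat k (2*N)) \<and>
     (\<forall>i<k. \<forall>j<2*N. is_form m 1 (\<lambda>p. A p $$ (i,j))) \<and>
     (\<forall>p\<in>carrier_vec m. A p * sympl_J N * transpose_mat (A p) = 0\<^sub>m k k) \<and>
     (\<forall>p\<in>cone m. vec_space.rank k (A p) = k)"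

text \<open>
  Kernel and image in the \<open>d\<close>-th twist \<open>\<O>(d-1)\<^sup>k \<rightarrow> \<O>(d)\<^sup>2\<^sup>N \<rightarrow> \<O>(d+1)\<^sup>k\<close> of the monad; their
  quotient is \<open>E(d)\<close>, where \<open>E = ker A / im (J A\<^sup>t)\<close>.
\<close>

definition monad_ker ::
    "nat \<Rightarrow> nat \<Rightarrow> nat \<Rightarrow> (complex vec \<Rightarrow> complex mat) \<Rightarrow> int \<Rightarrow> vec_presheaf" where
  "monad_ker m k N A d U = {v \<in> O_vec_sections m (2*N) d U. \<forall>p\<in>U. A p *\<^sub>v v p = 0\<^sub>v k}"

definition monad_im ::
    "nat \<Rightarrow> nat \<Rightarrow> nat \<Rightarrow> (complex vec \<Rightarrow> complex mat) \<Rightarrow> int \<Rightarrow> vec_presheaf" where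
  "monad_im m k N A d U = {v \<in> O_vec_sections m (2*N) d U.
     \<exists>c\<in>O_vec_sections m k (d - 1) U. \<forall>p\<in>U. v p = (sympl_J N * transpose_mat (A p)) *\<^sub>v c p}"

definition monad_cohomology ::
    "nat \<Rightarrow> nat \<Rightarrow> nat \<Rightarrow> (complex vec \<Rightarrow> complex mat) \<Rightarrow> int \<Rightarrow> complex vec set \<Rightarrow>
     (complex vec \<Rightarrow> germ) set" where
  "monad_cohomology m k N A d = quotient_sheaf m (monad_ker m k N A d) (monad_im m k N A d)"

definition H0_twist ::
    "nat \<Rightarrow> nat \<Rightarrow> nat \<Rightarrow> (complex vec \<Rightarrow> complex mat) \<Rightarrow> int \<Rightarrow> (complex vec \<Rightarrow> germ) set" where
  "H0_twist m k N A d = monad_cohomology m k N A d (cone m)"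

definition zero_section ::
    "nat \<Rightarrow> nat \<Rightarrow> nat \<Rightarrow> (complex vec \<Rightarrow> complex mat) \<Rightarrow> int \<Rightarrow> complex vec \<Rightarrow> germ" where
  "zero_section m k N A d =
     (\<lambda>p\<in>cone m.
       quotient_germ m (monad_ker m k N A d) (monad_im m k N A d) (cone m) (\<lambda>_. 0\<^sub>v (2*N)) p)"

section \<open>The matrices \<open>F\<close>, \<open>H\<^sub>\<epsilon>\<close> and \<open>A\<^sub>\<epsilon>\<close>\<close>

text \<open>
  The coordinates of \<open>p \<in> carrier_vec (2*n+2)\<close> are \<open>x\<^sub>0, \<dots>, x\<^sub>n, y\<^sub>0, \<dots>, y\<^sub>n\<close>. Matrix indices start
  at 0 here, so the usual condition \<open>0 \<le> i + j - k - 1 \<le> n\<close> for one-based \<open>i, j\<close> becomes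
  \<open>0 \<le> i + j + 1 - k \<le> n\<close>, and the two corners carrying \<open>\<epsilon> y\<^sub>1\<close> are \<open>(0, 0)\<close> and
  \<open>(k - 1, n + k - 1)\<close>.
\<close>

definition coord_x :: "complex vec \<Rightarrow> nat \<Rightarrow> complex" where
  "coord_x p i = p $ i"

definition coord_y :: "nat \<Rightarrow> complex vec \<Rightarrow> nat \<Rightarrow> complex" where
  "coord_y n p i = p $ (n + 1 + i)"

definition F_mat :: "nat \<Rightarrow> nat \<Rightarrow> complex vec \<Rightarrow> complex mat" where
  "F_mat n k p = mat k (n + k) (\<lambda>(i, j).
     if i \<le> j \<and> j - i \<le> n then coord_x p (j - i) else 0)"

definition H_mat :: "nat \<Rightarrow> nat \<Rightarrow> complex \<Rightarrow> complex vec \<Rightarrow> complex mat" where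
  "H_mat n k \<epsilon> p = mat k (n + k) (\<lambda>(i, j).
     if (i, j) = (0, 0) \<or> (i, j) = (k - 1, n + k - 1) then \<epsilon> * coord_y n p 1
     else if k \<le> i + j + 1 \<and> i + j + 1 - k \<le> n then coord_y n p (i + j + 1 - k)
     else 0)"

definition A_mat :: "nat \<Rightarrow> nat \<Rightarrow> complex \<Rightarrow> complex vec \<Rightarrow> complex mat" where
  "A_mat n k \<epsilon> p =
     four_block_mat (F_mat n k p) (H_mat n k \<epsilon> p) (0\<^sub>m 0 (n + k)) (0\<^sub>m 0 (n + k))"

end

theory Submission
  imports Defs "HOL-Computational_Algebra.Fundamental_Theorem_Algebra"
begin

text \<open>
  Since \<open>H\<^sup>1(\<O>) = 0\<close>, every global section of \<open>E(1) = ker A(1) / im (J A\<^sup>t)\<close> lifts to a vector \<open>v\<close> of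
  linear forms with \<open>A v = 0\<close>. The lift is constructed on the three charts where the first \<open>k\<close>
  columns of \<open>F\<close> (determinant \<open>x\<^sub>0\<^sup>k\<close>), its last \<open>k\<close> columns (determinant \<open>x\<^sub>n\<^sup>k\<close>) or the first \<open>k\<close>
  columns of \<open>H\<close> (determinant a polynomial in the \<open>y\<^sub>i\<close>) are independent: there a section has a
  unique representative with \<open>k\<close> prescribed zero entries, the transition coefficient between the
  first two charts has no monomials with negative exponents in both \<open>x\<^sub>0\<close> and \<open>x\<^sub>n\<close> because of
  the third chart, and after splitting it the two representatives glue outside
  \<open>x\<^sub>0 = x\<^sub>n = 0\<close>, which has codimension two.

  Comparing coefficients in \<open>A v = 0\<close>, the coefficients of \<open>v\<close> satisfy skew-symmetry relations
  along antidiagonals. These kill the coefficients of type \<open>xx\<close> and, for small \<open>\<epsilon>\<close>, those of type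
  \<open>yy\<close>; for \<open>\<epsilon> \<noteq> 0\<close> they force the mixed ones to be those of a constant combination of the columns of
  \<open>J A\<^sup>t\<close>. Hence the section is zero.
\<close>

section \<open>Polynomial functions\<close>

text \<open>Removing the locus x_0 = x_n = 0 does not change sections of line bundles, but it
  creates H^1: on the two charts that remain, the Laurent tails x_0^(-a) x_n^(-b) with a, b > 0 are
  nontrivial cocycles. The determinant of the third chart involves only the y_i, so for generic
  values of the y_i this chart contains the whole (x_0, x_n)-plane, origin included. There the
  cocycle is a difference of two functions, each with poles along one axis only, and such tails
  cannot occur.

  Sections are given only locally as quotients of forms. They are made global without factorization
  theory: everything is restricted to lines, where one-variable polynomials, Euclidean continuity
  and interpolation suffice.

  Smallness of \<epsilon> enters twice: n |\<epsilon>| < 1 gives rank k at every point, and 4 (n +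
  1) |\<epsilon>| < 1 turns the perturbed skew relations of type yy into a contraction. The corner
  terms, an obstacle in both places, are what determines the mixed coefficients: two rows that agree
  up to a corner term are subtracted.\<close>

inductive_set polyfun :: "nat \<Rightarrow> ((nat \<Rightarrow> complex) \<Rightarrow> complex) set" for m where
  polyfun_const: "(\<lambda>_. c) \<in> polyfun m"
| polyfun_coord: "i < m \<Longrightarrow> (\<lambda>z. z i) \<in> polyfun m"
| polyfun_add: "f \<in> polyfun m \<Longrightarrow> g \<in> polyfun m \<Longrightarrow> (\<lambda>z. f z + g z) \<in> polyfun m"
| polyfun_mult: "f \<in> polyfun m \<Longrightarrow> g \<in> polyfun m \<Longrightarrow> (\<lambda>z. f z * g z) \<in> polyfun m"

lemma polyfun_minus: "f \<in> polyfun m \<Longrightarrow> (\<lambda>z. - f z) \<in> polyfun m"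
  using polyfun_mult[OF polyfun_const[of "-1"]] by simp

lemma polyfun_diff: "f \<in> polyfun m \<Longrightarrow> g \<in> polyfun m \<Longrightarrow> (\<lambda>z. f z - g z) \<in> polyfun m"
  using polyfun_add[OF _ polyfun_minus] by simp

lemma polyfun_sum: "(\<And>x. x \<in> A \<Longrightarrow> f x \<in> polyfun m) \<Longrightarrow> (\<lambda>z. \<Sum>x\<in>A. f x z) \<in> polyfun m"
  by (induction A rule: infinite_finite_induct) (auto intro: polyfun_const polyfun_add)

lemma polyfun_prod: "(\<And>x. x \<in> A \<Longrightarrow> f x \<in> polyfun m) \<Longrightarrow> (\<lambda>z. \<Prod>x\<in>A. f x z) \<in> polyfun m"
  by (induction A rule: infinite_finite_induct) (auto intro: polyfun_const polyfun_mult)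

lemma polyfun_power: "f \<in> polyfun m \<Longrightarrow> (\<lambda>z. f z ^ K) \<in> polyfun m"
  by (induction K) (auto intro: polyfun_const polyfun_mult)

lemma polyfun_compose:
  assumes "f \<in> polyfun m" "\<And>i. i < m \<Longrightarrow> (\<lambda>z. s z i) \<in> polyfun m'"
  shows "(\<lambda>z. f (s z)) \<in> polyfun m'"
  using assms(1) by induction (auto intro: polyfun.intros assms(2))

lemma polyfun_poly: "f \<in> polyfun m \<Longrightarrow> (\<lambda>z. poly q (f z)) \<in> polyfun m"
  by (induction q) (auto intro: polyfun.intros)

lemma polyfun_cong_coords:
  assumes "f \<in> polyfun m" "\<And>i. i < m \<Longrightarrow> z i = w i"
  shows "f z = f w"
  using assms(1) by induction (auto simp: assms(2))

lemmas polyfun_intros = polyfun_const polyfun_coord polyfun_add polyfun_mult polyfun_minus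
  polyfun_diff polyfun_sum polyfun_prod polyfun_power polyfun_poly

lemma polyfun_along_curve:
  assumes "f \<in> polyfun m" "\<And>i. i < m \<Longrightarrow> \<exists>q. \<forall>t. \<gamma> t i = poly q t"
  shows "\<exists>q. \<forall>t. f (\<gamma> t) = poly q t"
  using assms(1)
proof induction
  case (polyfun_const c)
  show ?case by (rule exI[of _ "[:c:]"]) simp
next
  case (polyfun_coord i)
  then show ?case using assms(2) by blast
next
  case (polyfun_add f g)
  then show ?case by (metis poly_add)
next
  case (polyfun_mult f g)
  then show ?case by (metis poly_mult)
qed

section \<open>Restriction to lines and expansion in one coordinate\<close>

lemma poly_eqI_cofinite:
  fixes p q :: "complex poly"
  assumes "finite F" "\<And>t. t \<notin> F \<Longrightarrow> poly p t = poly q t"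
  shows "p = q"
proof (rule ccontr)
  assume "p \<noteq> q"
  then have "finite {t. poly (p - q) t = 0}" by (intro poly_roots_finite) auto
  moreover have "UNIV - F \<subseteq> {t. poly (p - q) t = 0}" using assms(2) by auto
  ultimately have "finite (UNIV - F :: complex set)" by (rule rev_finite_subset)
  then show False using assms(1) infinite_UNIV_char_0[where 'a=complex] by auto
qed

text \<open>Restricted to the line from \<open>z\<close> to \<open>w\<close>, both factors become
  one-variable polynomials, which form an integral domain. This is the density principle behind all
  later extensions from a set \<open>g z \<noteq> 0\<close>.\<close>

lemma polyfun_no_zero_divisors:
  assumes f: "f \<in> polyfun m" and g: "g \<in> polyfun m" and fg: "\<And>z. f z * g z = 0" and "g w \<noteq> 0"
  shows "f z = 0"
proof -
  define \<gamma> where "\<gamma> t i = z i + t * (w i - z i)" for t :: complex and i :: nat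
  have "\<exists>q. \<forall>t. \<gamma> t i = poly q t" for i
    by (rule exI[of _ "[:z i, w i - z i:]"]) (simp add: \<gamma>_def)
  then obtain p q where p: "\<And>t. f (\<gamma> t) = poly p t" and q: "\<And>t. g (\<gamma> t) = poly q t"
    using polyfun_along_curve[OF f] polyfun_along_curve[OF g] by metis
  have "poly (p * q) t = poly 0 t" for t using fg[of "\<gamma> t"] p q by simp
  then have "p * q = 0" using poly_eqI_cofinite[of "{}"] by blast
  moreover have "\<gamma> 1 = w" "\<gamma> 0 = z" by (auto simp: \<gamma>_def)
  ultimately have "p = 0" using q[of 1] \<open>g w \<noteq> 0\<close> by auto
  then show ?thesis using p[of 0] \<open>\<gamma> 0 = z\<close> by simp
qed

lemma polyfun_eq_on_nonzero:
  assumes "f \<in> polyfun m" "f' \<in> polyfun m" "g \<in> polyfun m" "g w \<noteq> 0"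
    and "\<And>z. g z \<noteq> 0 \<Longrightarrow> f z = f' z"
  shows "f z = f' z"
  using polyfun_no_zero_divisors[OF polyfun_diff[OF assms(1,2)] assms(3) _ assms(4), of z] assms(5)
  by (metis (no_types, lifting) eq_iff_diff_eq_0 mult_eq_0_iff)

text \<open>This is \<open>f\<close> as a polynomial in the single variable \<open>z i\<close>. The
  last clause says that the coefficients do not involve \<open>z i\<close>; the degree bound is
  uniform in the other variables.\<close>

lemma polyfun_coord_expansion:
  assumes "f \<in> polyfun m"
  shows "\<exists>q D. (\<forall>z. f z = poly (q z) (z i)) \<and> (\<forall>z. degree (q z) \<le> D) \<and>
    (\<forall>j. (\<lambda>z. coeff (q z) j) \<in> polyfun m) \<and> (\<forall>z t. q (z(i := t)) = q z)"
  using assms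
proof induction
  case (polyfun_const c)
  show ?case
    by (rule exI[of _ "\<lambda>_. [:c:]"], rule exI[of _ 0])
      (auto simp: coeff_pCons split: nat.split intro: polyfun.intros)
next
  case (polyfun_coord j)
  show ?case
  proof (cases "i = j")
    case True
    show ?thesis
      by (rule exI[of _ "\<lambda>_. [:0, 1:]"], rule exI[of _ 1])
        (auto simp: True intro: polyfun.intros)
  next
    case False
    have "(\<lambda>z. coeff [:z j:] l) \<in> polyfun m" for l
      using polyfun_coord by (cases l) (auto intro: polyfun.intros)
    then show ?thesis
      using False by (intro exI[of _ "\<lambda>z. [:z j:]"] exI[of _ 0]) auto
  qed
next
  case (polyfun_add f g)
  obtain q D where q: "\<And>z. f z = poly (q z) (z i)" "\<And>z. degree (q z) \<le> D"
      "\<And>j. (\<lambda>z. coeff (q z) j) \<in> polyfun m" "\<And>z t. q (z(i := t)) = q z"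
    using polyfun_add.IH(1) by blast
  obtain q' D' where q': "\<And>z. g z = poly (q' z) (z i)" "\<And>z. degree (q' z) \<le> D'"
      "\<And>j. (\<lambda>z. coeff (q' z) j) \<in> polyfun m" "\<And>z t. q' (z(i := t)) = q' z"
    using polyfun_add.IH(2) by blast
  have "degree (q z + q' z) \<le> max D D'" for z
    using q(2)[of z] q'(2)[of z] by (intro degree_add_le) auto
  moreover have "(\<lambda>z. coeff (q z + q' z) j) \<in> polyfun m" for j
    unfolding coeff_add by (intro polyfun_intros q q')
  ultimately show ?case
    unfolding q(1) q'(1)
    by (intro exI[of _ "\<lambda>z. q z + q' z"] exI[of _ "max D D'"] conjI allI)
      (simp_all only: q(4) q'(4) poly_add)
next
  case (polyfun_mult f g)
  obtain q D where q: "\<And>z. f z = poly (q z) (z i)" "\<And>z. degree (q z) \<le> D"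
      "\<And>j. (\<lambda>z. coeff (q z) j) \<in> polyfun m" "\<And>z t. q (z(i := t)) = q z"
    using polyfun_mult.IH(1) by blast
  obtain q' D' where q': "\<And>z. g z = poly (q' z) (z i)" "\<And>z. degree (q' z) \<le> D'"
      "\<And>j. (\<lambda>z. coeff (q' z) j) \<in> polyfun m" "\<And>z t. q' (z(i := t)) = q' z"
    using polyfun_mult.IH(2) by blast
  have "degree (q z * q' z) \<le> D + D'" for z
    using degree_mult_le[of "q z" "q' z"] q(2)[of z] q'(2)[of z] by linarith
  moreover have "(\<lambda>z. coeff (q z * q' z) j) \<in> polyfun m" for j
    unfolding coeff_mult by (intro polyfun_intros q q')
  ultimately show ?case
    unfolding q(1) q'(1)
    by (intro exI[of _ "\<lambda>z. q z * q' z"] exI[of _ "D + D'"] conjI allI)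
      (simp_all only: q(4) q'(4) poly_mult)
qed

lemma polyfun_divide_coord_power:
  assumes f: "f \<in> polyfun m" and i: "i < m"
    and q: "\<And>z. f z = poly (q z) (z i)" "\<And>z. degree (q z) \<le> D"
      "\<And>j. (\<lambda>z. coeff (q z) j) \<in> polyfun m"
    and zero: "\<And>z j. j < K \<Longrightarrow> coeff (q z) j = 0"
  shows "\<exists>e\<in>polyfun m. \<forall>z. f z = z i ^ K * e z"
proof
  let ?e = "\<lambda>z. \<Sum>j\<in>{K..max K D}. coeff (q z) j * z i ^ (j - K)"
  show "?e \<in> polyfun m" by (intro polyfun_intros q i)
  show "\<forall>z. f z = z i ^ K * ?e z"
  proof
    fix z
    have "f z = (\<Sum>j\<le>max K D. coeff (q z) j * z i ^ j)"
      unfolding q(1) poly_altdef using q(2)[of z]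
      by (intro sum.mono_neutral_left) (auto simp: coeff_eq_0)
    also have "\<dots> = (\<Sum>j\<in>{K..max K D}. coeff (q z) j * z i ^ j)"
      by (rule sum.mono_neutral_right) (auto simp: zero)
    also have "\<dots> = z i ^ K * ?e z"
      unfolding sum_distrib_left
      by (intro sum.cong) (auto simp flip: power_add simp: ac_simps)
    finally show "f z = z i ^ K * ?e z" .
  qed
qed

lemma coeff_zero_if_eq_power_mult:
  fixes q r :: "complex poly"
  assumes "finite F" "\<And>t. t \<notin> F \<Longrightarrow> poly q t = t ^ K * poly r t" "j < K"
  shows "coeff q j = 0"
proof -
  have "q = monom 1 K * r"
    by (rule poly_eqI_cofinite[OF assms(1)]) (simp add: assms(2) poly_monom)
  then show ?thesis using assms(3) by (simp add: coeff_monom_mult)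
qed

text \<open>The coefficient of \<open>t ^ j\<close> in \<open>f (t z)\<close> is the homogeneous
  component of degree \<open>j\<close>, so graded pieces are obtained without choosing
  monomials.\<close>

lemma polyfun_homogeneous_expansion:
  assumes "f \<in> polyfun m"
  shows "\<exists>q. (\<forall>z t. f (\<lambda>i. t * z i) = poly (q z) t) \<and> (\<forall>j. (\<lambda>z. coeff (q z) j) \<in> polyfun m) \<and>
    (\<forall>z t j. coeff (q (\<lambda>i. t * z i)) j = t ^ j * coeff (q z) j)"
  using assms
proof induction
  case (polyfun_const c)
  have "(\<lambda>z. coeff [:c:] j) \<in> polyfun m" for j by (rule polyfun.intros)
  then show ?case
    by (intro exI[of _ "\<lambda>_. [:c:]"]) (auto simp: coeff_pCons split: nat.split)
next
  case (polyfun_coord i)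
  have "(\<lambda>z. coeff [:0, z i:] l) \<in> polyfun m" for l
  proof (cases l)
    case (Suc l')
    then show ?thesis
      using polyfun_coord by (cases l') (auto intro: polyfun.intros)
  qed (auto intro: polyfun.intros)
  then show ?case
    by (intro exI[of _ "\<lambda>z. [:0, z i:]"]) (auto simp: coeff_pCons split: nat.split)
next
  case (polyfun_add f g)
  obtain q where q: "\<And>z t. f (\<lambda>i. t * z i) = poly (q z) t" "\<And>j. (\<lambda>z. coeff (q z) j) \<in> polyfun m"
      "\<And>z t j. coeff (q (\<lambda>i. t * z i)) j = t ^ j * coeff (q z) j"
    using polyfun_add.IH(1) by blast
  obtain q' where q': "\<And>z t. g (\<lambda>i. t * z i) = poly (q' z) t" "\<And>j. (\<lambda>z. coeff (q' z) j) \<in> polyfun m"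
      "\<And>z t j. coeff (q' (\<lambda>i. t * z i)) j = t ^ j * coeff (q' z) j"
    using polyfun_add.IH(2) by blast
  show ?case
    by (rule exI[of _ "\<lambda>z. q z + q' z"])
      (auto simp: q(1,3) q'(1,3) algebra_simps intro!: polyfun_intros q q')
next
  case (polyfun_mult f g)
  obtain q where q: "\<And>z t. f (\<lambda>i. t * z i) = poly (q z) t" "\<And>j. (\<lambda>z. coeff (q z) j) \<in> polyfun m"
      "\<And>z t j. coeff (q (\<lambda>i. t * z i)) j = t ^ j * coeff (q z) j"
    using polyfun_mult.IH(1) by blast
  obtain q' where q': "\<And>z t. g (\<lambda>i. t * z i) = poly (q' z) t" "\<And>j. (\<lambda>z. coeff (q' z) j) \<in> polyfun m"
      "\<And>z t j. coeff (q' (\<lambda>i. t * z i)) j = t ^ j * coeff (q' z) j"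
    using polyfun_mult.IH(2) by blast
  have "t ^ l * a * (t ^ (j - l) * b) = t ^ j * (a * b)" if "l \<le> j" for t a b :: complex and l j
  proof -
    have "t ^ l * a * (t ^ (j - l) * b) = t ^ (l + (j - l)) * (a * b)"
      unfolding power_add by (simp add: ac_simps)
    then show ?thesis using that by simp
  qed
  then show ?case
    by (intro exI[of _ "\<lambda>z. q z * q' z"])
      (auto simp: q(1,3) q'(1,3) coeff_mult sum_distrib_left intro!: polyfun_intros q q' sum.cong)
qed

section \<open>Forms as homogeneous polynomial functions\<close>

lemma polyfun_monomial_expansion:
  assumes "f \<in> polyfun m"
  shows "\<exists>T c. finite T \<and> (\<forall>a\<in>T. \<forall>i\<ge>m. a i = 0) \<and>
    (\<forall>z. f z = (\<Sum>a\<in>T. c a * (\<Prod>i<m. z i ^ a i)))"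
  using assms
proof induction
  case (polyfun_const c)
  show ?case by (rule exI[of _ "{\<lambda>_. 0}"], rule exI[of _ "\<lambda>_. c"]) simp
next
  case (polyfun_coord j)
  have "(\<Prod>i<m. z i ^ (if i = j then 1 else 0)) = z j" for z :: "nat \<Rightarrow> complex"
    using polyfun_coord by (simp add: if_distrib[of "\<lambda>e. _ ^ e"] cong: if_cong)
  then show ?case
    using polyfun_coord
    by (intro exI[of _ "{\<lambda>i. if i = j then 1 else 0}"] exI[of _ "\<lambda>_. 1"]) auto
next
  case (polyfun_add f g)
  obtain T c where T: "finite T" "\<And>a i. a \<in> T \<Longrightarrow> i \<ge> m \<Longrightarrow> a i = 0"
      "\<And>z. f z = (\<Sum>a\<in>T. c a * (\<Prod>i<m. z i ^ a i))"
    using polyfun_add.IH(1) by blast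
  obtain T' c' where T': "finite T'" "\<And>a i. a \<in> T' \<Longrightarrow> i \<ge> m \<Longrightarrow> a i = 0"
      "\<And>z. g z = (\<Sum>a\<in>T'. c' a * (\<Prod>i<m. z i ^ a i))"
    using polyfun_add.IH(2) by blast
  let ?c = "\<lambda>a. (if a \<in> T then c a else 0) + (if a \<in> T' then c' a else 0)"
  have "f z + g z = (\<Sum>a\<in>T \<union> T'. ?c a * (\<Prod>i<m. z i ^ a i))" for z
    unfolding distrib_right sum.distrib T(3) T'(3)
    by (intro arg_cong2[where f = "(+)"] sum.mono_neutral_cong_left) (auto simp: T(1) T'(1))
  then show ?case
    using T T' by (intro exI[of _ "T \<union> T'"] exI[of _ ?c]) auto
next
  case (polyfun_mult f g)
  obtain T c where T: "finite T" "\<And>a i. a \<in> T \<Longrightarrow> i \<ge> m \<Longrightarrow> a i = 0"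
      "\<And>z. f z = (\<Sum>a\<in>T. c a * (\<Prod>i<m. z i ^ a i))"
    using polyfun_mult.IH(1) by blast
  obtain T' c' where T': "finite T'" "\<And>a i. a \<in> T' \<Longrightarrow> i \<ge> m \<Longrightarrow> a i = 0"
      "\<And>z. g z = (\<Sum>a\<in>T'. c' a * (\<Prod>i<m. z i ^ a i))"
    using polyfun_mult.IH(2) by blast
  define e where "e x i = fst x i + snd x i" for x :: "(nat \<Rightarrow> nat) \<times> (nat \<Rightarrow> nat)" and i
  define d where "d a = (\<Sum>x | x \<in> T \<times> T' \<and> e x = a. c (fst x) * c' (snd x))" for a
  have "f z * g z = (\<Sum>a\<in>e ` (T \<times> T'). d a * (\<Prod>i<m. z i ^ a i))" for z
  proof -
    have "f z * g z = (\<Sum>x\<in>T \<times> T'. c (fst x) * c' (snd x) * (\<Prod>i<m. z i ^ e x i))"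
      unfolding T(3) T'(3) sum_product sum.cartesian_product
      by (intro sum.cong) (auto simp: e_def power_add prod.distrib)
    also have "\<dots> = (\<Sum>a\<in>e ` (T \<times> T'). \<Sum>x | x \<in> T \<times> T' \<and> e x = a.
        c (fst x) * c' (snd x) * (\<Prod>i<m. z i ^ e x i))"
      by (rule sum.image_gen) (simp add: T(1) T'(1))
    finally show ?thesis
      by (simp add: d_def sum_distrib_right)
  qed
  then show ?case
    using T(1,2) T'(1,2)
    by (intro exI[of _ "e ` (T \<times> T')"] exI[of _ d]) (auto simp: e_def)
qed

text \<open>The intrinsic description of forms, through which all later degree arguments go instead
  of through exponent sums.\<close>

lemma is_form_iff_polyfun:
  "is_form m d f \<longleftrightarrow> (\<lambda>z. f (vec m z)) \<in> polyfun m \<and>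
     (\<forall>z t. f (vec m (\<lambda>i. t * z i)) = t ^ d * f (vec m z))"
proof (intro iffI conjI allI)
  assume "is_form m d f"
  then obtain c where c: "\<And>p. p \<in> carrier_vec m \<Longrightarrow>
      f p = (\<Sum>a\<in>exponents m d. c a * (\<Prod>i<m. (p $ i) ^ a i))"
    unfolding is_form_def by blast
  have *: "f (vec m z) = (\<Sum>a\<in>exponents m d. c a * (\<Prod>i<m. z i ^ a i))" for z
    by (subst c) auto
  show "(\<lambda>z. f (vec m z)) \<in> polyfun m"
    unfolding * by (intro polyfun_intros) auto
  have "(\<Prod>i<m. (t * z i) ^ a i) = t ^ d * (\<Prod>i<m. z i ^ a i)" if "a \<in> exponents m d"
    for z :: "nat \<Rightarrow> complex" and t a
    using that by (simp add: power_mult_distrib prod.distrib exponents_def flip: power_sum)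
  then show "f (vec m (\<lambda>i. t * z i)) = t ^ d * f (vec m z)" for z t
    unfolding * sum_distrib_left by (intro sum.cong refl) (simp only: mult.left_commute)
next
  assume *: "(\<lambda>z. f (vec m z)) \<in> polyfun m \<and>
     (\<forall>z t. f (vec m (\<lambda>i. t * z i)) = t ^ d * f (vec m z))"
  then obtain T c where T: "finite T" "\<And>a i. a \<in> T \<Longrightarrow> i \<ge> m \<Longrightarrow> a i = 0"
      "\<And>z. f (vec m z) = (\<Sum>a\<in>T. c a * (\<Prod>i<m. z i ^ a i))"
    using polyfun_monomial_expansion[of "\<lambda>z. f (vec m z)" m] * by blast
  define S where "S a = (\<Sum>i<m. a i)" for a :: "nat \<Rightarrow> nat"
  have "f (vec m z) = (\<Sum>a\<in>exponents m d. (if a \<in> T then c a else 0) * (\<Prod>i<m. z i ^ a i))" for z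
  proof -
    \<comment> \<open>\<open>?p\<close> is \<open>f (t z)\<close> as a polynomial in
      \<open>t\<close>. Homogeneity makes it a single monomial, so reading off the coefficient of
      \<open>t ^ d\<close> discards all monomials of the wrong degree.\<close>
    let ?p = "\<Sum>a\<in>T. monom (c a * (\<Prod>i<m. z i ^ a i)) (S a)"
    have "poly ?p t = f (vec m (\<lambda>i. t * z i))" for t
      unfolding T(3) poly_sum
      by (intro sum.cong refl)
        (simp add: poly_monom S_def power_mult_distrib prod.distrib power_sum ac_simps)
    then have "?p = monom (f (vec m z)) d"
      using * by (intro poly_eqI_cofinite[of "{}"]) (auto simp: poly_monom ac_simps)
    then have "coeff ?p d = f (vec m z)" by simp
    then have "f (vec m z) = (\<Sum>a\<in>T. if S a = d then c a * (\<Prod>i<m. z i ^ a i) else 0)"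
      by (simp add: coeff_sum)
    also have "\<dots> = (\<Sum>a\<in>{a\<in>T. S a = d}. c a * (\<Prod>i<m. z i ^ a i))"
      using T(1) by (simp add: sum.inter_filter)
    also have "\<dots> = (\<Sum>a\<in>exponents m d. (if a \<in> T then c a else 0) * (\<Prod>i<m. z i ^ a i))"
      using T(2) by (intro sum.mono_neutral_cong_left finite_exponents)
        (auto simp: exponents_def S_def)
    finally show ?thesis .
  qed
  note expansion = this
  show "is_form m d f"
    unfolding is_form_def
  proof (rule exI, intro ballI)
    fix p :: "complex vec" assume "p \<in> carrier_vec m"
    then have "vec m (($) p) = p" by auto
    then show "f p = (\<Sum>a\<in>exponents m d. (if a \<in> T then c a else 0) * (\<Prod>i<m. (p $ i) ^ a i))"
      using expansion[of "($) p"] by simp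
  qed
qed

section \<open>Locally rational functions\<close>

text \<open>The basic open set \<open>Q \<noteq> 0\<close> is required to lie inside
  \<open>U\<close>, so regularity on \<open>U\<close> includes that \<open>U\<close> is Zariski
  open. Points are sequences of which only the first \<open>m\<close> entries matter; coordinates
  can then be updated freely.\<close>

definition reg :: "nat \<Rightarrow> (nat \<Rightarrow> complex) set \<Rightarrow> ((nat \<Rightarrow> complex) \<Rightarrow> complex) \<Rightarrow> bool" where
  "reg m U f \<longleftrightarrow> (\<forall>z\<in>U. \<exists>P\<in>polyfun m. \<exists>Q\<in>polyfun m. Q z \<noteq> 0 \<and>
     (\<forall>w. Q w \<noteq> 0 \<longrightarrow> w \<in> U \<and> f w = P w / Q w))"

lemma regE:
  assumes "reg m U f" "z \<in> U"
  obtains P Q where "P \<in> polyfun m" "Q \<in> polyfun m" "Q z \<noteq> 0"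
    "\<And>w. Q w \<noteq> 0 \<Longrightarrow> w \<in> U" "\<And>w. Q w \<noteq> 0 \<Longrightarrow> f w = P w / Q w"
  using assms unfolding reg_def by blast

lemma reg_cong: "reg m U f \<Longrightarrow> (\<And>z. z \<in> U \<Longrightarrow> f z = g z) \<Longrightarrow> reg m U g"
  unfolding reg_def by metis

lemma reg_locally:
  assumes "\<And>z. z \<in> U \<Longrightarrow> \<exists>V. z \<in> V \<and> V \<subseteq> U \<and> reg m V f"
  shows "reg m U f"
  unfolding reg_def
proof
  fix z assume "z \<in> U"
  then obtain V where "z \<in> V" "V \<subseteq> U" "reg m V f" using assms by blast
  then show "\<exists>P\<in>polyfun m. \<exists>Q\<in>polyfun m. Q z \<noteq> 0 \<and> (\<forall>w. Q w \<noteq> 0 \<longrightarrow> w \<in> U \<and> f w = P w / Q w)"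
    unfolding reg_def by blast
qed

text \<open>Any regular function certifies the openness of its domain, which is all that a constant
  needs.\<close>

lemma reg_open: "reg m U f \<Longrightarrow> reg m U (\<lambda>_. c)"
  unfolding reg_def
proof
  fix z
  assume *: "\<forall>z\<in>U. \<exists>P\<in>polyfun m. \<exists>Q\<in>polyfun m. Q z \<noteq> 0 \<and> (\<forall>w. Q w \<noteq> 0 \<longrightarrow> w \<in> U \<and> f w = P w / Q w)"
    and "z \<in> U"
  then obtain Q where Q: "Q \<in> polyfun m" "Q z \<noteq> 0" "\<forall>w. Q w \<noteq> 0 \<longrightarrow> w \<in> U" by blast
  then show "\<exists>P\<in>polyfun m. \<exists>Q\<in>polyfun m. Q z \<noteq> 0 \<and> (\<forall>w. Q w \<noteq> 0 \<longrightarrow> w \<in> U \<and> c = P w / Q w)"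
    by (intro bexI[of _ "\<lambda>w. c * Q w"] bexI[of _ Q]) (auto intro: polyfun_intros)
qed

lemma reg_mult:
  assumes "reg m U f" "reg m V g"
  shows "reg m (U \<inter> V) (\<lambda>z. f z * g z)"
  unfolding reg_def
proof
  fix z assume "z \<in> U \<inter> V"
  then have "z \<in> U" "z \<in> V" by auto
  obtain P Q where *: "P \<in> polyfun m" "Q \<in> polyfun m" "Q z \<noteq> 0"
    "\<And>w. Q w \<noteq> 0 \<Longrightarrow> w \<in> U" "\<And>w. Q w \<noteq> 0 \<Longrightarrow> f w = P w / Q w"
    by (rule regE[OF assms(1) \<open>z \<in> U\<close>]) blast
  obtain P' Q' where **: "P' \<in> polyfun m" "Q' \<in> polyfun m" "Q' z \<noteq> 0"
    "\<And>w. Q' w \<noteq> 0 \<Longrightarrow> w \<in> V" "\<And>w. Q' w \<noteq> 0 \<Longrightarrow> g w = P' w / Q' w"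
    by (rule regE[OF assms(2) \<open>z \<in> V\<close>]) blast
  note * = * **
  show "\<exists>P\<in>polyfun m. \<exists>Q\<in>polyfun m. Q z \<noteq> 0 \<and>
      (\<forall>w. Q w \<noteq> 0 \<longrightarrow> w \<in> U \<inter> V \<and> f w * g w = P w / Q w)"
    by (rule bexI[of _ "\<lambda>w. P w * P' w"], rule bexI[of _ "\<lambda>w. Q w * Q' w"])
      (auto simp: * intro: polyfun_intros *)
qed

lemma reg_add:
  assumes "reg m U f" "reg m V g"
  shows "reg m (U \<inter> V) (\<lambda>z. f z + g z)"
  unfolding reg_def
proof
  fix z assume "z \<in> U \<inter> V"
  then have "z \<in> U" "z \<in> V" by auto
  obtain P Q where *: "P \<in> polyfun m" "Q \<in> polyfun m" "Q z \<noteq> 0"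
    "\<And>w. Q w \<noteq> 0 \<Longrightarrow> w \<in> U" "\<And>w. Q w \<noteq> 0 \<Longrightarrow> f w = P w / Q w"
    by (rule regE[OF assms(1) \<open>z \<in> U\<close>]) blast
  obtain P' Q' where **: "P' \<in> polyfun m" "Q' \<in> polyfun m" "Q' z \<noteq> 0"
    "\<And>w. Q' w \<noteq> 0 \<Longrightarrow> w \<in> V" "\<And>w. Q' w \<noteq> 0 \<Longrightarrow> g w = P' w / Q' w"
    by (rule regE[OF assms(2) \<open>z \<in> V\<close>]) blast
  note * = * **
  show "\<exists>P\<in>polyfun m. \<exists>Q\<in>polyfun m. Q z \<noteq> 0 \<and>
      (\<forall>w. Q w \<noteq> 0 \<longrightarrow> w \<in> U \<inter> V \<and> f w + g w = P w / Q w)"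
    by (rule bexI[of _ "\<lambda>w. P w * Q' w + P' w * Q w"], rule bexI[of _ "\<lambda>w. Q w * Q' w"])
      (auto simp: * field_simps intro!: polyfun_intros *)
qed

lemma reg_polyfun: "f \<in> polyfun m \<Longrightarrow> reg m UNIV f"
  unfolding reg_def
  by (intro ballI bexI[of _ f] bexI[of _ "\<lambda>_. 1"]) (auto intro: polyfun_const)

lemma reg_inverse_polyfun:
  assumes "g \<in> polyfun m"
  shows "reg m {z. g z \<noteq> 0} (\<lambda>z. 1 / g z)"
  unfolding reg_def
  using assms by (intro ballI bexI[of _ "\<lambda>_. 1"] bexI[of _ g]) (auto intro: polyfun_const)

lemma reg_mult_polyfun: "reg m U f \<Longrightarrow> g \<in> polyfun m \<Longrightarrow> reg m U (\<lambda>z. g z * f z)"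
  using reg_mult[OF reg_polyfun, of g m U f] by simp

lemma reg_divide_polyfun:
  "reg m U f \<Longrightarrow> g \<in> polyfun m \<Longrightarrow> reg m (U \<inter> {z. g z \<noteq> 0}) (\<lambda>z. f z / g z)"
  using reg_mult[OF _ reg_inverse_polyfun, of m U f g] by simp

lemma reg_diff: "reg m U f \<Longrightarrow> reg m V g \<Longrightarrow> reg m (U \<inter> V) (\<lambda>z. f z - g z)"
  using reg_add[OF _ reg_mult_polyfun[OF _ polyfun_const[of "-1"]]] by simp

lemma reg_sum:
  assumes "finite A" "A \<noteq> {}" "\<And>x. x \<in> A \<Longrightarrow> reg m U (f x)"
  shows "reg m U (\<lambda>z. \<Sum>x\<in>A. f x z)"
  using assms
proof (induction A rule: finite_ne_induct)
  case (insert x A)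
  then show ?case using reg_add[of m U "f x" U "\<lambda>z. \<Sum>x\<in>A. f x z"] by simp
qed simp

lemma reg_compose:
  assumes "reg m U f" "\<And>i. i < m \<Longrightarrow> (\<lambda>z. s z i) \<in> polyfun m'"
  shows "reg m' {z. s z \<in> U} (\<lambda>z. f (s z))"
  unfolding reg_def
proof
  fix z assume "z \<in> {z. s z \<in> U}"
  then have "s z \<in> U" by simp
  obtain P Q where *: "P \<in> polyfun m" "Q \<in> polyfun m" "Q (s z) \<noteq> 0"
    "\<And>w. Q w \<noteq> 0 \<Longrightarrow> w \<in> U" "\<And>w. Q w \<noteq> 0 \<Longrightarrow> f w = P w / Q w"
    by (rule regE[OF assms(1) \<open>s z \<in> U\<close>]) blast
  show "\<exists>P\<in>polyfun m'. \<exists>Q\<in>polyfun m'. Q z \<noteq> 0 \<and>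
      (\<forall>w. Q w \<noteq> 0 \<longrightarrow> w \<in> {z. s z \<in> U} \<and> f (s w) = P w / Q w)"
    by (rule bexI[of _ "\<lambda>w. P (s w)"], rule bexI[of _ "\<lambda>w. Q (s w)"])
      (use * in \<open>auto intro: polyfun_compose[OF _ assms(2)]\<close>)
qed

text \<open>The identity principle: with \<open>f = P / Q\<close> near \<open>z\<close>, the product
  \<open>P Q g\<close> vanishes everywhere, hence so does \<open>P Q\<close>.\<close>

lemma reg_eq_zero:
  assumes f: "reg m U f" and z: "z \<in> U" and g: "g \<in> polyfun m" "g w \<noteq> 0"
    and zero: "\<And>z. z \<in> U \<Longrightarrow> g z \<noteq> 0 \<Longrightarrow> f z = 0"
  shows "f z = 0"
proof -
  obtain P Q where *: "P \<in> polyfun m" "Q \<in> polyfun m" "Q z \<noteq> 0"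
    "\<And>w. Q w \<noteq> 0 \<Longrightarrow> w \<in> U" "\<And>w. Q w \<noteq> 0 \<Longrightarrow> f w = P w / Q w"
    by (rule regE[OF f z]) blast
  have "P z * Q z = 0"
  proof (rule polyfun_no_zero_divisors[OF polyfun_mult[OF *(1,2)] g(1) _ g(2)])
    fix x
    show "P x * Q x * g x = 0"
      using *(4,5)[of x] zero[of x] by (cases "Q x = 0"; cases "g x = 0") auto
  qed
  then show ?thesis using *(3,5) by simp
qed

section \<open>Continuity along curves and rationality off the coordinate hyperplanes\<close>

lemma reg_isCont_along_curve:
  assumes f: "reg m U f" and \<gamma>: "\<And>i. i < m \<Longrightarrow> \<exists>q. \<forall>t. \<gamma> t i = poly q t" and t: "\<gamma> t \<in> U"
  shows "isCont (\<lambda>t. f (\<gamma> t)) t"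
proof -
  obtain P Q where *: "P \<in> polyfun m" "Q \<in> polyfun m" "Q (\<gamma> t) \<noteq> 0"
    "\<And>w. Q w \<noteq> 0 \<Longrightarrow> f w = P w / Q w"
    by (rule regE[OF f t]) blast
  obtain p q where p: "\<And>t. P (\<gamma> t) = poly p t" and q: "\<And>t. Q (\<gamma> t) = poly q t"
    using polyfun_along_curve[where \<gamma> = \<gamma>, OF *(1) \<gamma>]
      polyfun_along_curve[where \<gamma> = \<gamma>, OF *(2) \<gamma>] by blast
  have "open {s. poly q s \<noteq> 0}"
    by (intro open_Collect_neq continuous_intros)
  then have "\<forall>\<^sub>F s in nhds t. poly q s \<noteq> 0"
    using *(3) unfolding q eventually_nhds by (intro exI[of _ "{s. poly q s \<noteq> 0}"]) auto
  then have "\<forall>\<^sub>F s in nhds t. f (\<gamma> s) = poly p s / poly q s"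
    by eventually_elim (use * p q in auto)
  moreover have "isCont (\<lambda>s. poly p s / poly q s) t"
    using *(3) q by simp
  ultimately show ?thesis by (simp add: isCont_cong)
qed

lemma isCont_zero_cofinite:
  fixes f :: "complex \<Rightarrow> complex"
  assumes "isCont f a" "finite F" "\<And>t. t \<notin> F \<Longrightarrow> f t = 0"
  shows "f a = 0"
proof -
  have "open (- (F - {a}))" using assms(2) by (intro open_Compl finite_imp_closed) simp
  then have "\<forall>\<^sub>F t in at a. f t = 0"
    unfolding eventually_at_topological using assms(3) by (intro exI[of _ "- (F - {a})"]) auto
  then have "f \<midarrow>a\<rightarrow> 0" by (simp add: tendsto_eventually)
  then show ?thesis using assms(1) LIM_unique unfolding isCont_def by blast
qed

text \<open>Cancel the zeros of \<open>q\<close> one at a time; continuity carries the equation \<open>q f = p\<close> across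
  the cancelled zero.\<close>
lemma polynomial_if_continuous_quotient:
  fixes f :: "complex \<Rightarrow> complex"
  assumes "\<And>t. t \<notin> E \<Longrightarrow> isCont f t" "E \<subseteq> {0}" "q \<noteq> 0"
    "\<And>t. t \<notin> E \<Longrightarrow> poly q t * f t = poly p t"
  shows "\<exists>r. degree r \<le> degree p + degree q \<and>
    (\<forall>t. t \<notin> E \<longrightarrow> f t * (if E = {} then 1 else t ^ degree q) = poly r t)"
  using assms
proof (induction "degree q" arbitrary: p q f)
  case 0
  then obtain c where "q = [:c:]" "c \<noteq> 0"
    using degree_eq_zeroE[of q] by (metis pCons_eq_0_iff)
  then show ?case
    using 0 by (intro exI[of _ "smult (1 / c) p"]) (auto simp: field_simps)
next
  case (Suc d)
  then obtain a where "poly q a = 0"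
    using fundamental_theorem_of_algebra[of q] by (auto simp: constant_degree)
  then obtain q1 where q1: "q = [:- a, 1:] * q1" by (auto simp: poly_eq_0_iff_dvd elim: dvdE)
  with Suc.prems(3) have "q1 \<noteq> 0" by auto
  with q1 Suc.hyps(2) have d: "d = degree q1" by (simp add: degree_mult_eq del: mult_pCons_left)
  have fin: "finite E" using Suc.prems(2) finite_subset by blast
  show ?case
  proof (cases "a \<in> E")
    case True
    then have "a = 0" "E = {0}" using Suc.prems(2) by auto
    \<comment> \<open>A zero of \<open>q\<close> at the excluded point cannot be cancelled by
      continuity. The factor \<open>t\<close> is moved into \<open>f\<close> instead, which is why
      the conclusion carries the power \<open>t ^ degree q\<close>.\<close>
    have "\<exists>r. degree r \<le> degree p + degree q1 \<and>
      (\<forall>t. t \<notin> E \<longrightarrow> t * f t * (if E = {} then 1 else t ^ degree q1) = poly r t)"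
      using Suc.prems \<open>q1 \<noteq> 0\<close> d
      by (intro Suc.hyps) (auto simp: q1 \<open>a = 0\<close> algebra_simps)
    then obtain r where r: "degree r \<le> degree p + d"
      "\<And>t. t \<notin> E \<Longrightarrow> t * f t * t ^ d = poly r t" using \<open>E = {0}\<close> d by auto
    show ?thesis
      using r \<open>E = {0}\<close> by (intro exI[of _ r]) (auto simp flip: Suc.hyps(2) simp: ac_simps)
  next
    case False
    then have "poly p a = 0" using Suc.prems(4)[of a] q1 by simp
    then obtain p1 where p1: "p = [:- a, 1:] * p1" by (auto simp: poly_eq_0_iff_dvd elim: dvdE)
    have eq: "poly q1 t * f t = poly p1 t" if "t \<notin> E" "t \<noteq> a" for t
    proof -
      have "(t - a) * (poly q1 t * f t) = (t - a) * poly p1 t"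
        using Suc.prems(4)[OF that(1)] by (simp add: q1 p1 algebra_simps)
      then show ?thesis using that(2) by simp
    qed
    have "isCont (\<lambda>t. poly q1 t * f t - poly p1 t) a"
      using Suc.prems(1)[OF False] by (intro continuous_intros) auto
    then have "poly q1 a * f a - poly p1 a = 0"
      by (rule isCont_zero_cofinite[where F = "insert a E"]) (use fin eq in auto)
    then have "poly q1 t * f t = poly p1 t" if "t \<notin> E" for t
      using eq[OF that] by (cases "t = a") auto
    then have "\<exists>r. degree r \<le> degree p1 + degree q1 \<and>
        (\<forall>t. t \<notin> E \<longrightarrow> f t * (if E = {} then 1 else t ^ degree q1) = poly r t)"
      using Suc.prems \<open>q1 \<noteq> 0\<close> d by (intro Suc.hyps) auto
    then obtain r where r: "degree r \<le> degree p1 + d"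
      "\<And>t. t \<notin> E \<Longrightarrow> f t * (if E = {} then 1 else t ^ d) = poly r t" using d by auto
    have "degree p1 \<le> degree p" unfolding p1
      by (cases "p1 = 0") (auto simp: degree_mult_eq simp del: mult_pCons_left)
    show ?thesis
    proof (cases "E = {}")
      case True
      then show ?thesis using r \<open>degree p1 \<le> degree p\<close> Suc.hyps(2) by (intro exI[of _ r]) auto
    next
      case False
      \<comment> \<open>This zero was cancelled, but the exponent in the claim is still
        \<open>degree q\<close>; a spare factor \<open>t\<close> makes up the difference.\<close>
      have "degree ([:0, 1:] * r) \<le> Suc (degree p1 + d)"
        using degree_mult_le[of "[:0, 1:]" r] r(1) by simp
      then have "degree ([:0, 1:] * r) \<le> degree p + degree q"
        using \<open>degree p1 \<le> degree p\<close> Suc.hyps(2) by linarith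
      then show ?thesis using r False
        by (intro exI[of _ "[:0, 1:] * r"]) (auto simp flip: Suc.hyps(2) simp: ac_simps)
    qed
  qed
qed

text \<open>The basis \<open>L\<close> is independent of \<open>r\<close>. Interpolation along a
  line can therefore be written with the same \<open>L\<close> for all values of the remaining
  variables.\<close>

lemma lagrange_basis_exists:
  fixes \<tau> :: "nat \<Rightarrow> complex"
  assumes "inj \<tau>"
  shows "\<exists>L :: nat \<Rightarrow> complex poly. \<forall>r. degree r \<le> D \<longrightarrow>
    (\<forall>t. poly r t = (\<Sum>j\<le>D. poly r (\<tau> j) * poly (L j) t))"
proof -
  define M where "M j = (\<Prod>l\<in>{..D} - {j}. [:- \<tau> l, 1:])" for j
  define L where "L j = smult (1 / poly (M j) (\<tau> j)) (M j)" for j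
  have deg: "degree (L j) \<le> D" if "j \<le> D" for j
  proof -
    have "degree (M j) \<le> (\<Sum>l\<in>{..D} - {j}. degree [:- \<tau> l, 1:])"
      unfolding M_def using degree_prod_sum_le[of "{..D} - {j}" "\<lambda>l. [:- \<tau> l, 1:]"]
      by (simp add: o_def)
    also have "\<dots> = D" using that by simp
    finally show ?thesis unfolding L_def by (meson degree_smult_le order_trans)
  qed
  have M: "poly (M j) (\<tau> i) = 0 \<longleftrightarrow> i \<noteq> j" if "i \<le> D" for i j
    using that by (auto simp: M_def poly_prod inj_eq[OF assms])
  have L: "poly (L j) (\<tau> i) = (if i = j then 1 else 0)" if "i \<le> D" for i j
    using M[OF that, of j] by (auto simp: L_def)
  show ?thesis
  proof (intro exI[of _ L] allI impI)
    fix r :: "complex poly" and t assume r: "degree r \<le> D"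
    have "r = (\<Sum>j\<le>D. smult (poly r (\<tau> j)) (L j))"
    proof (rule poly_eqI_degree[of "\<tau> ` {..D}"])
      fix x assume "x \<in> \<tau> ` {..D}"
      then obtain i where i: "x = \<tau> i" "i \<le> D" by auto
      then show "poly r x = poly (\<Sum>j\<le>D. smult (poly r (\<tau> j)) (L j)) x"
        by (simp add: poly_sum L if_distrib cong: if_cong)
    next
      have card: "card (\<tau> ` {..D}) = Suc D"
        using assms by (simp add: card_image inj_on_subset)
      then show "card (\<tau> ` {..D}) > degree r" using r by simp
      have "degree (\<Sum>j\<le>D. smult (poly r (\<tau> j)) (L j)) \<le> D"
        by (intro degree_sum_le) (auto intro: order_trans[OF degree_smult_le] deg)
      then show "card (\<tau> ` {..D}) > degree (\<Sum>j\<le>D. smult (poly r (\<tau> j)) (L j))"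
        using card by simp
    qed
    then have "poly r t = poly (\<Sum>j\<le>D. smult (poly r (\<tau> j)) (L j)) t" by simp
    then show "poly r t = (\<Sum>j\<le>D. poly r (\<tau> j) * poly (L j) t)"
      by (simp add: poly_sum)
  qed
qed


text \<open>A regular function off the coordinate hyperplanes is \<open>P / Q\<close> globally, so it is polynomial
  of bounded degree in each variable along every line on which \<open>Q\<close> does not vanish. Its Lagrange
  interpolation formula extends by continuity to the exceptional lines.\<close>
theorem reg_coordinate_complement:
  fixes f :: "(nat \<Rightarrow> complex) \<Rightarrow> complex"
  assumes f: "reg m {z. \<forall>i\<in>I. z i \<noteq> 0} f" and I: "I \<subseteq> {..<m}"
    and dep: "\<And>z w. (\<And>i. i < m \<Longrightarrow> z i = w i) \<Longrightarrow> f z = f w"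
  shows "\<exists>K. \<exists>p\<in>polyfun m. \<forall>z. (\<forall>i\<in>I. z i \<noteq> 0) \<longrightarrow> f z * (\<Prod>i\<in>I. z i) ^ K = p z"
proof -
  let ?U = "{z. \<forall>i\<in>I. z i \<noteq> (0::complex)}"
  let ?one = "\<lambda>_::nat. 1::complex"
  have finI: "finite I" using I finite_subset by blast
  have one: "?one \<in> ?U" by simp
  obtain P Q where PQ: "P \<in> polyfun m" "Q \<in> polyfun m" "Q ?one \<noteq> 0"
    "\<And>w. Q w \<noteq> 0 \<Longrightarrow> w \<in> ?U" "\<And>w. Q w \<noteq> 0 \<Longrightarrow> f w = P w / Q w"
    by (rule regE[OF f one]) blast
  \<comment> \<open>The quotient found near the point (1, ..., 1) is valid on all of
    \<open>?U\<close> by density, after clearing the denominator.\<close>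
  have fQ: "f z * Q z = P z" if "z \<in> ?U" for z
  proof -
    have "reg m ?U (\<lambda>z. Q z * f z - P z)"
      using reg_diff[OF reg_mult_polyfun[OF f PQ(2)] reg_polyfun[OF PQ(1)]] by simp
    from reg_eq_zero[OF this that PQ(2,3)] show ?thesis using PQ(5) by (simp add: mult.commute)
  qed
  have "\<forall>i. \<exists>p q Dp Dq. (\<forall>z. P z = poly (p z) (z i)) \<and> (\<forall>z. degree (p z) \<le> Dp) \<and>
      (\<forall>z t. p (z(i := t)) = p z) \<and> (\<forall>z. Q z = poly (q z) (z i)) \<and> (\<forall>z. degree (q z) \<le> Dq) \<and>
      (\<forall>z t. q (z(i := t)) = q z)"
    using polyfun_coord_expansion[OF PQ(1)] polyfun_coord_expansion[OF PQ(2)] by meson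
  then obtain p q Dp Dq where pq:
    "\<And>i z. P z = poly (p i z) (z i)" "\<And>i z. degree (p i z) \<le> Dp i" "\<And>i z t. p i (z(i := t)) = p i z"
    "\<And>i z. Q z = poly (q i z) (z i)" "\<And>i z. degree (q i z) \<le> Dq i" "\<And>i z t. q i (z(i := t)) = q i z"
    by metis
  \<comment> \<open>The pole of \<open>f\<close> along \<open>z i = 0\<close> has order at most the
    degree of \<open>Q\<close> in \<open>z i\<close>, hence at most \<open>K\<close>. In
    \<open>D\<close>, one \<open>K\<close> pays for the power multiplied onto \<open>f\<close> and
    the other for the degree bound of \<open>polynomial_if_continuous_quotient\<close>.\<close>
  define K where "K = (\<Sum>i<m. Dq i)"
  define D where "D = (\<Sum>i<m. Dp i) + 2 * K"
  have K: "degree (q i z) \<le> K" if "i < m" for i z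
    unfolding K_def using pq(5)[of i z] member_le_sum[of i "{..<m}" Dq] that by simp
  have D: "degree (p i z) + 2 * K \<le> D" if "i < m" for i z
    unfolding D_def using pq(2)[of i z] member_le_sum[of i "{..<m}" Dp] that by simp
  define g where "g z = f z * (\<Prod>i\<in>I. z i) ^ K" for z
  have "(\<lambda>z. (\<Prod>i\<in>I. z i) ^ K) \<in> polyfun m"
    using I by (intro polyfun_intros) auto
  then have reg_g: "reg m ?U g"
    unfolding g_def by (rule reg_cong[OF reg_mult_polyfun[OF f]]) simp
  have isCont_line: "isCont (\<lambda>t. h (z(i := t))) t"
    if "reg m ?U h" "z(i := t) \<in> ?U" for h z i t
  proof (rule reg_isCont_along_curve[OF that(1)])
    fix j
    show "\<exists>q. \<forall>t. (z(i := t)) j = poly q t"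
      by (cases "j = i") (auto intro: exI[of _ "[:0, 1:]"] exI[of _ "[:z j:]"])
  qed (rule that(2))
  \<comment> \<open>The condition \<open>q i z \<noteq> 0\<close> says that \<open>Q\<close> does
    not vanish identically on the line through \<open>z\<close> in direction
    \<open>i\<close>.\<close>
  have good: "\<exists>r. degree r \<le> D \<and> (\<forall>t. (i \<in> I \<longrightarrow> t \<noteq> 0) \<longrightarrow> g (z(i := t)) = poly r t)"
    if "i < m" "z \<in> ?U" "q i z \<noteq> 0" for i z
  proof -
    let ?E = "if i \<in> I then {0::complex} else {}"
    have U: "z(i := t) \<in> ?U" if "t \<notin> ?E" for t using that \<open>z \<in> ?U\<close> by (auto split: if_splits)
    have "\<exists>r. degree r \<le> degree (p i z) + degree (q i z) \<and>
      (\<forall>t. t \<notin> ?E \<longrightarrow> f (z(i := t)) * (if ?E = {} then 1 else t ^ degree (q i z)) = poly r t)"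
    proof (rule polynomial_if_continuous_quotient)
      show "isCont (\<lambda>t. f (z(i := t))) t" if "t \<notin> ?E" for t
        by (rule isCont_line[OF f U[OF that]])
      show "poly (q i z) t * f (z(i := t)) = poly (p i z) t" if "t \<notin> ?E" for t
        using fQ[OF U[OF that]] pq(1)[of "z(i := t)" i] pq(4)[of "z(i := t)" i] pq(3,6)
        by (simp add: mult.commute)
    qed (use that in auto)
    then obtain r where r: "degree r \<le> degree (p i z) + degree (q i z)"
      "\<And>t. t \<notin> ?E \<Longrightarrow> f (z(i := t)) * (if ?E = {} then 1 else t ^ degree (q i z)) = poly r t"
      by blast
    let ?c = "(\<Prod>j\<in>I - {i}. z j) ^ K"
    show ?thesis
    proof (cases "i \<in> I")
      case False
      then have "(\<Prod>j\<in>I. (z(i := t)) j) = (\<Prod>j\<in>I. z j)" for t by (intro prod.cong) auto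
      then have "g (z(i := t)) = poly (smult ?c r) t" for t
        using r(2) False by (simp add: g_def mult.commute)
      moreover have "degree (smult ?c r) \<le> D"
        using r(1) K[OF that(1), of z] D[OF that(1), of z] by (auto intro: order_trans[OF degree_smult_le])
      ultimately show ?thesis by blast
    next
      case True
      have "(\<Prod>j\<in>I. (z(i := t)) j) = t * (\<Prod>j\<in>I - {i}. z j)" for t
        using True finI by (simp add: prod.remove[of I i])
      then have *: "g (z(i := t)) = poly (smult ?c (monom 1 (K - degree (q i z)) * r)) t" if "t \<noteq> 0" for t
      proof -
        have "t ^ K = t ^ (K - degree (q i z)) * t ^ degree (q i z)"
          using K[OF \<open>i < m\<close>, of z] by (simp flip: power_add)
        then show ?thesis
          using r(2)[of t] True that \<open>\<And>t. (\<Prod>j\<in>I. (z(i := t)) j) = t * (\<Prod>j\<in>I - {i}. z j)\<close>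
          by (simp add: g_def poly_monom power_mult_distrib)
      qed
      have "degree (smult ?c (monom 1 (K - degree (q i z)) * r)) \<le> K + degree r"
        using degree_mult_le[of "monom 1 (K - degree (q i z))" r]
          degree_monom_le[of "1::complex" "K - degree (q i z)"]
          degree_smult_le[of ?c "monom 1 (K - degree (q i z)) * r"] by linarith
      also have "\<dots> \<le> D"
        using r(1) K[OF that(1), of z] D[OF that(1), of z] by linarith
      finally show ?thesis using * True by blast
    qed
  qed
  \<comment> \<open>The shift by one keeps the interpolation nodes off the hyperplanes
    \<open>z i = 0\<close>.\<close>
  define \<tau> :: "nat \<Rightarrow> complex" where "\<tau> j = of_nat (Suc j)" for j
  have "inj \<tau>" by (simp add: inj_def \<tau>_def del: of_nat_Suc)
  have \<tau>0: "\<tau> j \<noteq> 0" for j unfolding \<tau>_def by (simp del: of_nat_Suc)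
  obtain L :: "nat \<Rightarrow> complex poly" where
    L: "\<And>r t. degree r \<le> D \<Longrightarrow> poly r t = (\<Sum>j\<le>D. poly r (\<tau> j) * poly (L j) t)"
    using lagrange_basis_exists[OF \<open>inj \<tau>\<close>, of D] by blast
  have interp_good: "g (z(i := t)) = (\<Sum>j\<le>D. g (z(i := \<tau> j)) * poly (L j) t)"
    if i: "i < m" "z \<in> ?U" "q i z \<noteq> 0" "i \<in> I \<longrightarrow> t \<noteq> 0" for i z t
  proof -
    obtain r where "degree r \<le> D" "\<And>t. (i \<in> I \<longrightarrow> t \<noteq> 0) \<Longrightarrow> g (z(i := t)) = poly r t"
      using good[OF i(1-3)] by blast
    then show ?thesis using L[of r t] i(4) \<tau>0 by simp
  qed
  have interp: "g (z(i := t)) = (\<Sum>j\<le>D. g (z(i := \<tau> j)) * poly (L j) t)"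
    if i: "i < m" "z \<in> ?U" "i \<in> I \<longrightarrow> t \<noteq> 0" for i z t
  proof -
    \<comment> \<open>\<open>\<gamma>\<close> runs from \<open>z\<close> to (1, ..., 1), where
      \<open>Q\<close> is nonzero, so all but finitely many of its points lie on good lines.
      Continuity in \<open>s\<close> carries the interpolation formula to
      \<open>s = 0\<close>.\<close>
    define \<gamma> where "\<gamma> s j = z j + s * (1 - z j)" for s :: complex and j :: nat
    have \<gamma>_poly: "\<exists>q. \<forall>s. \<gamma> s j = poly q s" for j
      by (rule exI[of _ "[:z j, 1 - z j:]"]) (simp add: \<gamma>_def)
    obtain Q' where Q': "\<And>s. Q (\<gamma> s) = poly Q' s"
      using polyfun_along_curve[where \<gamma> = \<gamma>, OF PQ(2) \<gamma>_poly] by blast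
    have [simp]: "\<gamma> 1 = ?one" "\<gamma> 0 = z" by (auto simp: \<gamma>_def)
    have "Q' \<noteq> 0" using Q'[of 1] PQ(3) by auto
    then have fin: "finite {s. poly Q' s = 0}" by (rule poly_roots_finite)
    let ?\<psi> = "\<lambda>s. g ((\<gamma> s)(i := t)) - (\<Sum>j\<le>D. g ((\<gamma> s)(i := \<tau> j)) * poly (L j) t)"
    have cont: "isCont (\<lambda>s. g ((\<gamma> s)(i := t))) 0" if "i \<in> I \<longrightarrow> t \<noteq> 0" for t
    proof (rule reg_isCont_along_curve[OF reg_g])
      fix j
      show "\<exists>q. \<forall>s. ((\<gamma> s)(i := t)) j = poly q s"
        using \<gamma>_poly[of j] by (cases "j = i") (auto intro: exI[of _ "[:t:]"])
      show "(\<gamma> 0)(i := t) \<in> ?U" using i(2) that by auto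
    qed
    have "isCont ?\<psi> 0"
      by (intro continuous_intros cont) (use \<tau>0 i in auto)
    then have "?\<psi> 0 = 0"
    proof (rule isCont_zero_cofinite[OF _ fin])
      fix s assume "s \<notin> {s. poly Q' s = 0}"
      then have nz: "Q (\<gamma> s) \<noteq> 0" using Q' by simp
      then have "\<gamma> s \<in> ?U" by (rule PQ(4))
      moreover have "q i (\<gamma> s) \<noteq> 0" using nz pq(4)[of "\<gamma> s" i] by auto
      ultimately show "?\<psi> s = 0" using interp_good[OF i(1) _ _ i(3)] by simp
    qed
    then show ?thesis by simp
  qed
  have "\<forall>c\<in>?U. \<exists>p\<in>polyfun m. \<forall>z\<in>?U. g (\<lambda>l. if l < k then z l else c l) = p z" if "k \<le> m" for k
    using that
  proof (induction k)
    case 0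
    show ?case
      by (intro ballI, rule_tac x = "\<lambda>_. g c" in bexI) (auto intro: polyfun_const)
  next
    case (Suc k)
    show ?case
    proof
      fix c assume c: "c \<in> ?U"
      then have "\<forall>j. c(k := \<tau> j) \<in> ?U" using \<tau>0 by auto
      then have "\<forall>j. \<exists>p\<in>polyfun m. \<forall>z\<in>?U. g (\<lambda>l. if l < k then z l else (c(k := \<tau> j)) l) = p z"
        using Suc by simp
      then have "\<exists>p. \<forall>j. p j \<in> polyfun m \<and>
          (\<forall>z\<in>?U. g (\<lambda>l. if l < k then z l else (c(k := \<tau> j)) l) = p j z)"
        unfolding Bex_def by (rule choice)
      then obtain p where p: "\<And>j. p j \<in> polyfun m"
        "\<And>j z. z \<in> ?U \<Longrightarrow> g (\<lambda>l. if l < k then z l else (c(k := \<tau> j)) l) = p j z"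
        by blast
      show "\<exists>p\<in>polyfun m. \<forall>z\<in>?U. g (\<lambda>l. if l < Suc k then z l else c l) = p z"
      proof (intro bexI ballI)
        show "(\<lambda>z. \<Sum>j\<le>D. p j z * poly (L j) (z k)) \<in> polyfun m"
          using Suc.prems by (intro polyfun_intros p) auto
        fix z assume z: "z \<in> ?U"
        let ?w = "\<lambda>l. if l < k then z l else c l"
        have w: "?w \<in> ?U" using z c by simp
        have "(\<lambda>l. if l < Suc k then z l else c l) = ?w(k := z k)"
          by (auto simp: fun_eq_iff)
        moreover have "?w(k := \<tau> j) = (\<lambda>l. if l < k then z l else (c(k := \<tau> j)) l)" for j
          by (auto simp: fun_eq_iff)
        ultimately show "g (\<lambda>l. if l < Suc k then z l else c l) = (\<Sum>j\<le>D. p j z * poly (L j) (z k))"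
          using interp[OF _ w, of k "z k"] Suc.prems z p(2)[OF z] by simp
      qed
    qed
  qed
  from bspec[OF this[OF order_refl] one] obtain p where p: "p \<in> polyfun m"
    "\<And>z. z \<in> ?U \<Longrightarrow> g (\<lambda>l. if l < m then z l else 1) = p z" by blast
  have "g (\<lambda>l. if l < m then z l else 1) = g z" for z
  proof -
    have "(\<Prod>i\<in>I. if i < m then z i else 1) = (\<Prod>i\<in>I. z i)" using I by (intro prod.cong) auto
    then show ?thesis using dep[of "\<lambda>l. if l < m then z l else 1" z] by (simp add: g_def)
  qed
  then show ?thesis using p unfolding g_def by auto
qed

lemma reg_one_coordinate_complement:
  assumes "reg m {z. z i \<noteq> 0} f" "i < m" "\<And>z w. (\<And>i. i < m \<Longrightarrow> z i = w i) \<Longrightarrow> f z = f w"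
  obtains K p where "p \<in> polyfun m" "\<And>z. z i \<noteq> 0 \<Longrightarrow> f z * z i ^ K = p z"
proof -
  have "\<exists>K. \<exists>p\<in>polyfun m. \<forall>z. (\<forall>i\<in>{i}. z i \<noteq> 0) \<longrightarrow> f z * (\<Prod>i\<in>{i}. z i) ^ K = p z"
    by (rule reg_coordinate_complement[OF _ _ assms(3)]) (use assms(1,2) in simp_all)
  then show ?thesis using that by auto
qed

lemma reg_two_coordinate_complement:
  assumes "reg m {z. z i \<noteq> 0 \<and> z j \<noteq> 0} f" "i < m" "j < m" "i \<noteq> j"
    and "\<And>z w. (\<And>i. i < m \<Longrightarrow> z i = w i) \<Longrightarrow> f z = f w"
  obtains K p where "p \<in> polyfun m" "\<And>z. z i \<noteq> 0 \<Longrightarrow> z j \<noteq> 0 \<Longrightarrow> f z * (z i * z j) ^ K = p z"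
proof -
  have "\<exists>K. \<exists>p\<in>polyfun m. \<forall>z. (\<forall>i\<in>{i, j}. z i \<noteq> 0) \<longrightarrow> f z * (\<Prod>i\<in>{i, j}. z i) ^ K = p z"
    by (rule reg_coordinate_complement[OF _ _ assms(5)]) (use assms(1-3) in simp_all)
  then obtain K p where p: "p \<in> polyfun m"
    "\<forall>z. (\<forall>i\<in>{i, j}. z i \<noteq> 0) \<longrightarrow> f z * (\<Prod>i\<in>{i, j}. z i) ^ K = p z" by blast
  have "f z * (z i * z j) ^ K = p z" if "z i \<noteq> 0" "z j \<noteq> 0" for z
    using p(2)[THEN spec, of z] that assms(4) by simp
  with p(1) show ?thesis by (rule that)
qed

section \<open>Splitting and extension across codimension two\<close>

text \<open>Extension across codimension two: the common function
  \<open>a / z i ^ e = b / z j ^ e'\<close> has no pole along either hyperplane. Where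
  \<open>z j \<noteq> 0\<close>, the equation removes the coefficients of \<open>a\<close> below
  \<open>z i ^ e\<close>; by density they vanish identically.\<close>

lemma polyfun_divisible_if_quotients_agree:
  assumes a: "a \<in> polyfun m" and b: "b \<in> polyfun m" and i: "i < m" "j < m" "i \<noteq> j"
    and eq: "\<And>z. z i \<noteq> 0 \<Longrightarrow> z j \<noteq> 0 \<Longrightarrow> a z * z j ^ e' = b z * z i ^ e"
  shows "\<exists>d\<in>polyfun m. \<forall>z. a z = z i ^ e * d z"
proof -
  obtain q D where q: "\<And>z. a z = poly (q z) (z i)" "\<And>z. degree (q z) \<le> D"
      "\<And>j. (\<lambda>z. coeff (q z) j) \<in> polyfun m" "\<And>z t. q (z(i := t)) = q z"
    using polyfun_coord_expansion[OF a, of i] by blast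
  obtain p D' where p: "\<And>z. b z = poly (p z) (z i)" "\<And>z. degree (p z) \<le> D'"
      "\<And>j. (\<lambda>z. coeff (p z) j) \<in> polyfun m" "\<And>z t. p (z(i := t)) = p z"
    using polyfun_coord_expansion[OF b, of i] by blast
  have nz: "coeff (q z) l = 0" if "l < e" "z j \<noteq> 0" for l z
  proof (rule coeff_zero_if_eq_power_mult[of "{0}"])
    fix t :: complex assume "t \<notin> {0}"
    then have "a (z(i := t)) * z j ^ e' = b (z(i := t)) * t ^ e"
      using eq[of "z(i := t)"] that i(3) by simp
    then show "poly (q z) t = t ^ e * poly (smult (1 / z j ^ e') (p z)) t"
      using that(2) unfolding q(1) p(1) q(4) p(4) by (simp add: field_simps)
  qed (use that in auto)
  have "coeff (q z) l = 0" if "l < e" for l z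
    by (rule polyfun_no_zero_divisors[OF q(3) polyfun_coord[OF i(2)], where w = "\<lambda>_. 1"])
      (use nz[OF that] in auto)
  then show ?thesis
    using polyfun_divide_coord_power[OF a i(1) q(1,2,3)] by blast
qed

text \<open>A Laurent polynomial in \<open>z i\<close>, \<open>z j\<close> that is, over a dense set of values of the other variables,
  a sum of one without poles along \<open>z j = 0\<close> and one without poles along \<open>z i = 0\<close> has no terms with
  both exponents negative.\<close>
lemma polyfun_split:
  assumes P: "P \<in> polyfun m" and i: "i < m" "j < m" "i \<noteq> j"
    and h: "h \<in> polyfun m" "h w \<noteq> 0"
    and split: "\<And>z. h z \<noteq> 0 \<Longrightarrow> \<exists>M\<ge>K. \<exists>p1\<in>polyfun m. \<exists>p2\<in>polyfun m. \<forall>a b. a \<noteq> 0 \<longrightarrow> b \<noteq> 0 \<longrightarrow>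
        P (z(i := a, j := b)) * (a ^ M * b ^ M) =
        (a * b) ^ K * (b ^ M * p1 (z(i := a, j := b)) - a ^ M * p2 (z(i := a, j := b)))"
  shows "\<exists>P1\<in>polyfun m. \<exists>P2\<in>polyfun m. \<forall>z. P z = z i ^ K * P1 z + z j ^ K * P2 z"
proof -
  obtain q D where q: "\<And>z. P z = poly (q z) (z i)" "\<And>z. degree (q z) \<le> D"
      "\<And>l. (\<lambda>z. coeff (q z) l) \<in> polyfun m" "\<And>z t. q (z(i := t)) = q z"
    using polyfun_coord_expansion[OF P, of i] by blast
  have "\<exists>e\<in>polyfun m. \<forall>z. coeff (q z) l = z j ^ K * e z" if l: "l < K" for l
  proof -
    obtain q' D' where q': "\<And>z. coeff (q z) l = poly (q' z) (z j)" "\<And>z. degree (q' z) \<le> D'"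
      "\<And>l. (\<lambda>z. coeff (q' z) l) \<in> polyfun m" "\<And>z t. q' (z(j := t)) = q' z"
      using polyfun_coord_expansion[OF q(3)[of l], of j] by blast
    have "coeff (q' z) n = 0" if n: "n < K" and z: "h z \<noteq> 0" for n z
    proof -
      obtain M p1 p2 where M: "M \<ge> K" "p1 \<in> polyfun m" "p2 \<in> polyfun m"
        "\<And>a b. a \<noteq> 0 \<Longrightarrow> b \<noteq> 0 \<Longrightarrow> P (z(i := a, j := b)) * (a ^ M * b ^ M) =
          (a * b) ^ K * (b ^ M * p1 (z(i := a, j := b)) - a ^ M * p2 (z(i := a, j := b)))"
        using split[OF z] by blast
      obtain q1 D1 where q1: "\<And>z. p1 z = poly (q1 z) (z i)" "\<And>z. degree (q1 z) \<le> D1"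
        "\<And>l. (\<lambda>z. coeff (q1 z) l) \<in> polyfun m" "\<And>z t. q1 (z(i := t)) = q1 z"
        using polyfun_coord_expansion[OF M(2), of i] by blast
      obtain q2 D2 where q2: "\<And>z. p2 z = poly (q2 z) (z i)" "\<And>z. degree (q2 z) \<le> D2"
        "\<And>l. (\<lambda>z. coeff (q2 z) l) \<in> polyfun m" "\<And>z t. q2 (z(i := t)) = q2 z"
        using polyfun_coord_expansion[OF M(3), of i] by blast
      obtain r Dr where r: "\<And>z. coeff (q1 z) (M + l - K) = poly (r z) (z j)" "\<And>z. degree (r z) \<le> Dr"
        "\<And>l. (\<lambda>z. coeff (r z) l) \<in> polyfun m" "\<And>z t. r (z(j := t)) = r z"
        using polyfun_coord_expansion[OF q1(3)[of "M + l - K"], of j] by blast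
      have "poly (q' z) b = b ^ K * poly (r z) b" if "b \<notin> {0}" for b
      proof -
        let ?z = "z(j := b)"
        have "smult (b ^ M) (monom 1 M * q ?z) =
          smult (b ^ K) (monom 1 K * (smult (b ^ M) (q1 ?z) - monom 1 M * q2 ?z))"
        proof (rule poly_eqI_cofinite[of "{0}"])
          fix a :: complex assume "a \<notin> {0}"
          moreover have "z(i := a, j := b) = ?z(i := a)" using i(3) by (simp add: fun_upd_twist)
          ultimately show "poly (smult (b ^ M) (monom 1 M * q ?z)) a =
            poly (smult (b ^ K) (monom 1 K * (smult (b ^ M) (q1 ?z) - monom 1 M * q2 ?z))) a"
            using M(4)[of a b] that unfolding q(1) q1(1) q2(1)
            by (simp add: q(4) q1(4) q2(4) poly_monom power_mult_distrib algebra_simps)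
        qed simp
        then have "coeff (smult (b ^ M) (monom 1 M * q ?z)) (M + l) =
          coeff (smult (b ^ K) (monom 1 K * (smult (b ^ M) (q1 ?z) - monom 1 M * q2 ?z))) (M + l)"
          by simp
        \<comment> \<open>After multiplication by \<open>a ^ K\<close>, the \<open>p2\<close> term
          starts at \<open>a ^ (M + K)\<close> and does not reach the coefficient
          \<open>M + l\<close>. What remains is \<open>b ^ K\<close> times a coefficient of
          \<open>p1\<close>.\<close>
        moreover have "M + l - K < M" using l M(1) by simp
        ultimately have "coeff (q ?z) l = b ^ K * coeff (q1 ?z) (M + l - K)"
          using M(1) that by (simp add: coeff_monom_mult mult.left_commute)
        then show ?thesis unfolding q'(1) r(1) by (simp add: q'(4) r(4))
      qed
      then show ?thesis
        by (intro coeff_zero_if_eq_power_mult[of "{0}" "q' z" K "r z"]) (use n in auto)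
    qed
    then have "coeff (q' z) n = 0" if "n < K" for n z
      by (intro polyfun_no_zero_divisors[OF q'(3) h(1) _ h(2)]) (use that in auto)
    then show ?thesis using polyfun_divide_coord_power[OF q(3) i(2) q'(1,2,3)] by blast
  qed
  then obtain e where e: "\<And>l. l < K \<Longrightarrow> e l \<in> polyfun m"
    "\<And>l z. l < K \<Longrightarrow> coeff (q z) l = z j ^ K * e l z" by metis
  \<comment> \<open>Terms of degree at least \<open>K\<close> in \<open>z i\<close> go to the first
    summand; each remaining coefficient has just been shown to contain
    \<open>z j ^ K\<close>.\<close>
  show ?thesis
  proof (intro bexI allI)
    show "(\<lambda>z. \<Sum>l<K. z i ^ l * e l z) \<in> polyfun m"
      by (intro polyfun_intros e i) auto
    show "(\<lambda>z. \<Sum>l\<in>{K..K + D}. z i ^ (l - K) * coeff (q z) l) \<in> polyfun m"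
      by (intro polyfun_intros i q)
    fix z
    have "P z = (\<Sum>l\<le>K + D. coeff (q z) l * z i ^ l)"
      unfolding q(1) poly_altdef using q(2)[of z]
      by (intro sum.mono_neutral_left) (auto simp: coeff_eq_0)
    also have "{..K + D} = {..<K} \<union> {K..K + D}" by auto
    also have "(\<Sum>l\<in>\<dots>. coeff (q z) l * z i ^ l) =
        (\<Sum>l<K. coeff (q z) l * z i ^ l) + (\<Sum>l\<in>{K..K + D}. coeff (q z) l * z i ^ l)"
      by (rule sum.union_disjoint) auto
    also have "(\<Sum>l<K. coeff (q z) l * z i ^ l) = z j ^ K * (\<Sum>l<K. z i ^ l * e l z)"
      unfolding sum_distrib_left by (intro sum.cong) (auto simp: e(2))
    also have "(\<Sum>l\<in>{K..K + D}. coeff (q z) l * z i ^ l) =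
        z i ^ K * (\<Sum>l\<in>{K..K + D}. z i ^ (l - K) * coeff (q z) l)"
      unfolding sum_distrib_left
    proof (intro sum.cong refl)
      fix l assume "l \<in> {K..K + D}"
      then have "z i ^ l = z i ^ K * z i ^ (l - K)" by (simp flip: power_add)
      then show "coeff (q z) l * z i ^ l = z i ^ K * (z i ^ (l - K) * coeff (q z) l)" by simp
    qed
    finally show "P z = z i ^ K * (\<Sum>l\<in>{K..K + D}. z i ^ (l - K) * coeff (q z) l) +
        z j ^ K * (\<Sum>l<K. z i ^ l * e l z)" by simp
  qed
qed

text \<open>Both summands may be replaced by their components of degree \<open>K\<close>, since only
  these contribute to degree \<open>2 * K\<close>.\<close>

lemma homogeneous_split:
  assumes P: "\<And>z t. P (\<lambda>i. t * z i) = t ^ (2 * K) * P z"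
    and P1: "P1 \<in> polyfun m" and P2: "P2 \<in> polyfun m"
    and eq: "\<And>z. P z = z i ^ K * P1 z + z j ^ K * P2 z"
  shows "\<exists>P1\<in>polyfun m. \<exists>P2\<in>polyfun m. (\<forall>z. P z = z i ^ K * P1 z + z j ^ K * P2 z) \<and>
    (\<forall>z t. P1 (\<lambda>i. t * z i) = t ^ K * P1 z) \<and> (\<forall>z t. P2 (\<lambda>i. t * z i) = t ^ K * P2 z)"
proof -
  obtain q1 where q1: "\<And>z t. P1 (\<lambda>i. t * z i) = poly (q1 z) t" "\<And>j. (\<lambda>z. coeff (q1 z) j) \<in> polyfun m"
      "\<And>z t j. coeff (q1 (\<lambda>i. t * z i)) j = t ^ j * coeff (q1 z) j"
    using polyfun_homogeneous_expansion[OF P1] by blast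
  obtain q2 where q2: "\<And>z t. P2 (\<lambda>i. t * z i) = poly (q2 z) t" "\<And>j. (\<lambda>z. coeff (q2 z) j) \<in> polyfun m"
      "\<And>z t j. coeff (q2 (\<lambda>i. t * z i)) j = t ^ j * coeff (q2 z) j"
    using polyfun_homogeneous_expansion[OF P2] by blast
  have "P z = z i ^ K * coeff (q1 z) K + z j ^ K * coeff (q2 z) K" for z
  proof -
    have "monom (P z) K = smult (z i ^ K) (q1 z) + smult (z j ^ K) (q2 z)"
    proof (rule poly_eqI_cofinite[of "{0}"])
      fix t :: complex assume t: "t \<notin> {0}"
      have "t ^ K * (t ^ K * P z) = t ^ K * (z i ^ K * poly (q1 z) t + z j ^ K * poly (q2 z) t)"
        using P[of t z] eq[of "\<lambda>i. t * z i"]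
        by (simp add: q1(1) q2(1) power_mult_distrib algebra_simps flip: power_add mult_2_right)
      then show "poly (monom (P z) K) t = poly (smult (z i ^ K) (q1 z) + smult (z j ^ K) (q2 z)) t"
        using t by (simp add: poly_monom ac_simps)
    qed simp
    then have "coeff (monom (P z) K) K = coeff (smult (z i ^ K) (q1 z) + smult (z j ^ K) (q2 z)) K"
      by simp
    then show ?thesis by simp
  qed
  then show ?thesis
    by (intro bexI[of _ "\<lambda>z. coeff (q1 z) K"] bexI[of _ "\<lambda>z. coeff (q2 z) K"])
      (auto simp: q1(3) q2(3) intro: q1 q2)
qed


text \<open>Formulas with denominators give homogeneity only for nonzero \<open>t\<close> and on a
  dense set. Density covers the other \<open>z\<close>; comparing polynomials in \<open>t\<close>
  covers \<open>t = 0\<close>.\<close>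

lemma homogeneousI_dense:
  assumes f: "f \<in> polyfun m" and h: "h \<in> polyfun m" "h (\<lambda>_. 1) \<noteq> 0"
    and hom: "\<And>z t. h z \<noteq> 0 \<Longrightarrow> t \<noteq> 0 \<Longrightarrow> f (\<lambda>i. t * z i) = t ^ d * f z"
  shows "f (\<lambda>i. t * z i) = t ^ d * f z"
proof -
  have *: "f (\<lambda>i. t * z i) = t ^ d * f z" if "t \<noteq> 0" for z t
  proof (rule polyfun_eq_on_nonzero[OF _ _ h, where f = "\<lambda>z. f (\<lambda>i. t * z i)" and f' = "\<lambda>z. t ^ d * f z"])
    show "(\<lambda>z. f (\<lambda>i. t * z i)) \<in> polyfun m"
      by (rule polyfun_compose[OF f]) (intro polyfun_intros)
  qed (use hom that in \<open>auto intro!: polyfun_intros f\<close>)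
  obtain q where q: "\<And>t. f (\<lambda>l. t * z l) = poly (q z) t"
    using polyfun_homogeneous_expansion[OF f] by blast
  have "q z = monom (f z) d"
    by (rule poly_eqI_cofinite[of "{0}"]) (auto simp: poly_monom * simp flip: q)
  then show ?thesis unfolding q by (simp add: poly_monom)
qed

section \<open>Lifting sections modulo the image of a matrix of linear forms\<close>

text \<open>
  \<open>L\<close> is an \<open>R \<times> k\<close> matrix of linear forms, \<open>\<Gamma> d / g d\<close> a left inverse of it on the chart
  \<open>g d \<noteq> 0\<close>, and \<open>\<rho> z\<close> represents a global section of \<open>\<O>(1)\<^sup>R / im L\<close> at \<open>z\<close>, with no regularity in
  \<open>z\<close>. On the chart, \<open>chart_rep d\<close> is the representative killed by \<open>\<Gamma> d\<close>; being unique, it is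
  regular, and two such representatives differ by \<open>L\<close> times a regular function. The third chart is
  what makes the resulting cocycle on \<open>{z i\<^sub>0 \<noteq> 0} \<inter> {z i\<^sub>1 \<noteq> 0}\<close> split.
\<close>
locale charted_quotient =
  fixes m R k i0 i1 :: nat
    and L :: "(nat \<Rightarrow> complex) \<Rightarrow> nat \<Rightarrow> nat \<Rightarrow> complex"
    and \<Gamma> :: "nat \<Rightarrow> (nat \<Rightarrow> complex) \<Rightarrow> nat \<Rightarrow> nat \<Rightarrow> complex"
    and g :: "nat \<Rightarrow> (nat \<Rightarrow> complex) \<Rightarrow> complex"
    and \<rho> :: "(nat \<Rightarrow> complex) \<Rightarrow> nat \<Rightarrow> complex"
    and w2 :: "nat \<Rightarrow> complex"
  assumes R: "R > 0" and k: "k > 0" and i0: "i0 < m" and i1: "i1 < m" and i01: "i0 \<noteq> i1"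
    and L_polyfun: "\<And>r i. r < R \<Longrightarrow> i < k \<Longrightarrow> (\<lambda>z. L z r i) \<in> polyfun m"
    and L_hom: "\<And>z t r i. r < R \<Longrightarrow> i < k \<Longrightarrow> L (\<lambda>l. t * z l) r i = t * L z r i"
    and \<Gamma>_polyfun: "\<And>d r i. r < R \<Longrightarrow> i < k \<Longrightarrow> (\<lambda>z. \<Gamma> d z i r) \<in> polyfun m"
    and \<Gamma>_hom: "\<And>d z t r i. r < R \<Longrightarrow> i < k \<Longrightarrow> \<Gamma> d (\<lambda>l. t * z l) i r = t ^ (k - 1) * \<Gamma> d z i r"
    and g_polyfun: "\<And>d. g d \<in> polyfun m"
    and g_hom: "\<And>d z t. g d (\<lambda>l. t * z l) = t ^ k * g d z"
    and left_inverse: "\<And>d z i j. i < k \<Longrightarrow> j < k \<Longrightarrow>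
      (\<Sum>r<R. \<Gamma> d z i r * L z r j) = (if i = j then g d z else 0)"
    and g0: "\<And>z. g 0 z = z i0 ^ k" and g1: "\<And>z. g 1 z = z i1 ^ k"
    and g2: "\<And>z a b. g 2 (z(i0 := a, i1 := b)) = g 2 z" "g 2 w2 \<noteq> 0"
    and \<rho>_coords: "\<And>z w. (\<And>i. i < m \<Longrightarrow> z i = w i) \<Longrightarrow> \<rho> z = \<rho> w"
    and \<rho>_local: "\<And>z. \<exists>l<m. z l \<noteq> 0 \<Longrightarrow> \<exists>U v. z \<in> U \<and> (\<forall>r<R. reg m U (\<lambda>w. v w r)) \<and>
      (\<forall>w\<in>U. \<exists>c. \<forall>r<R. \<rho> w r = v w r + (\<Sum>i<k. L w r i * c i))"
    and \<rho>_hom: "\<And>z t. \<exists>l<m. z l \<noteq> 0 \<Longrightarrow> t \<noteq> 0 \<Longrightarrow>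
      \<exists>c. \<forall>r<R. \<rho> (\<lambda>l. t * z l) r = t * \<rho> z r + (\<Sum>i<k. L (\<lambda>l. t * z l) r i * c i)"
begin

section \<open>Chart representatives and their transition coefficients\<close>

definition chart_coeff :: "nat \<Rightarrow> (nat \<Rightarrow> complex) \<Rightarrow> (nat \<Rightarrow> complex) \<Rightarrow> nat \<Rightarrow> complex" where
  "chart_coeff d u z i = (\<Sum>r<R. \<Gamma> d z i r * u r) / g d z"

definition chart_rep :: "nat \<Rightarrow> (nat \<Rightarrow> complex) \<Rightarrow> (nat \<Rightarrow> complex) \<Rightarrow> nat \<Rightarrow> complex" where
  "chart_rep d u z r = u r - (\<Sum>i<k. L z r i * chart_coeff d u z i)"

text \<open>The first Cech cocycle of the section with values in the source of \<open>L\<close>.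
  Changing \<open>\<rho> z\<close> by \<open>L c\<close> shifts both coefficients by the same
  \<open>c\<close>, so only the section matters.\<close>

definition transition :: "nat \<Rightarrow> nat \<Rightarrow> (nat \<Rightarrow> complex) \<Rightarrow> nat \<Rightarrow> complex" where
  "transition d e z i = chart_coeff e (\<rho> z) z i - chart_coeff d (\<rho> z) z i"

lemma chart_coeff_add_image:
  assumes "g d z \<noteq> 0" "i < k" "\<And>r. r < R \<Longrightarrow> u r = v r + (\<Sum>j<k. L z r j * c j)"
  shows "chart_coeff d u z i = chart_coeff d v z i + c i"
proof -
  have "(\<Sum>r<R. \<Gamma> d z i r * u r) =
      (\<Sum>r<R. \<Gamma> d z i r * v r) + (\<Sum>r<R. \<Sum>j<k. \<Gamma> d z i r * L z r j * c j)"
    unfolding sum.distrib[symmetric]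
    by (intro sum.cong) (auto simp: assms(3) algebra_simps sum_distrib_left)
  also have "(\<Sum>r<R. \<Sum>j<k. \<Gamma> d z i r * L z r j * c j) =
      (\<Sum>j<k. (\<Sum>r<R. \<Gamma> d z i r * L z r j) * c j)"
    by (subst sum.swap) (simp add: sum_distrib_right)
  also have "\<dots> = (\<Sum>j<k. if i = j then g d z * c j else 0)"
    by (intro sum.cong) (auto simp: left_inverse assms(2))
  also have "\<dots> = g d z * c i" using assms(2) by simp
  finally show ?thesis using assms(1) by (simp add: chart_coeff_def field_simps)
qed

lemma chart_rep_add_image:
  assumes "g d z \<noteq> 0" "r < R" "\<And>r. r < R \<Longrightarrow> u r = v r + (\<Sum>j<k. L z r j * c j)"
  shows "chart_rep d u z r = chart_rep d v z r"
proof -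
  have "(\<Sum>i<k. L z r i * chart_coeff d u z i) =
      (\<Sum>i<k. L z r i * chart_coeff d v z i) + (\<Sum>i<k. L z r i * c i)"
    unfolding sum.distrib[symmetric]
    by (intro sum.cong) (auto simp: chart_coeff_add_image[OF assms(1) _ assms(3)] algebra_simps)
  then show ?thesis using assms(2,3) by (simp add: chart_rep_def)
qed

text \<open>\<open>g d\<close> is homogeneous of positive degree, so its chart avoids the vertex of
  the cone, where \<open>\<rho>\<close> carries no information.\<close>

lemma g_nonzero_coord: "g d z \<noteq> 0 \<Longrightarrow> \<exists>l<m. z l \<noteq> 0"
proof (rule ccontr)
  assume "g d z \<noteq> 0" and "\<not> (\<exists>l<m. z l \<noteq> 0)"
  then have "g d z = g d (\<lambda>l. 0 * z l)"
    by (intro polyfun_cong_coords[OF g_polyfun]) auto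
  also have "\<dots> = 0" using g_hom[of d 0 z] k by simp
  finally show False using \<open>g d z \<noteq> 0\<close> by simp
qed

lemma reg_chart_coeff:
  assumes "i < k" "\<And>r. r < R \<Longrightarrow> reg m U (\<lambda>w. v w r)"
  shows "reg m (U \<inter> {z. g d z \<noteq> 0}) (\<lambda>z. chart_coeff d (v z) z i)"
  unfolding chart_coeff_def
  using R assms by (intro reg_divide_polyfun reg_sum reg_mult_polyfun g_polyfun \<Gamma>_polyfun) auto

text \<open>Although \<open>\<rho>\<close> itself is arbitrary from point to point, it may be
  replaced locally by a regular \<open>v\<close>, because the transition coefficient ignores changes
  by the image of \<open>L\<close>.\<close>

lemma reg_transition:
  assumes "i < k"
  shows "reg m {z. g d z \<noteq> 0 \<and> g e z \<noteq> 0} (\<lambda>z. transition d e z i)"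
proof (rule reg_locally)
  fix z assume z: "z \<in> {z. g d z \<noteq> 0 \<and> g e z \<noteq> 0}"
  then obtain U v where U: "z \<in> U" "\<And>r. r < R \<Longrightarrow> reg m U (\<lambda>w. v w r)"
    "\<And>w. w \<in> U \<Longrightarrow> \<exists>c. \<forall>r<R. \<rho> w r = v w r + (\<Sum>i<k. L w r i * c i)"
    using \<rho>_local[OF g_nonzero_coord[of d z]] by blast
  let ?V = "(U \<inter> {z. g e z \<noteq> 0}) \<inter> (U \<inter> {z. g d z \<noteq> 0})"
  have "reg m ?V (\<lambda>z. chart_coeff e (v z) z i - chart_coeff d (v z) z i)"
    by (intro reg_diff reg_chart_coeff assms U)
  moreover have "chart_coeff e (v w) w i - chart_coeff d (v w) w i = transition d e w i"
    if w: "w \<in> ?V" for w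
  proof -
    obtain c where "\<And>r. r < R \<Longrightarrow> \<rho> w r = v w r + (\<Sum>i<k. L w r i * c i)"
      using U(3)[of w] w by blast
    from chart_coeff_add_image[OF _ assms this] show ?thesis
      using w by (simp add: transition_def)
  qed
  ultimately have "reg m ?V (\<lambda>z. transition d e z i)" by (rule reg_cong)
  then show "\<exists>V. z \<in> V \<and> V \<subseteq> {z. g d z \<noteq> 0 \<and> g e z \<noteq> 0} \<and> reg m V (\<lambda>z. transition d e z i)"
    using U(1) z by (intro exI[of _ ?V]) auto
qed

lemma reg_chart_rep:
  assumes "r < R"
  shows "reg m {z. g d z \<noteq> 0} (\<lambda>z. chart_rep d (\<rho> z) z r)"
proof (rule reg_locally)
  fix z assume z: "z \<in> {z. g d z \<noteq> 0}"
  then obtain U v where U: "z \<in> U" "\<And>r. r < R \<Longrightarrow> reg m U (\<lambda>w. v w r)"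
    "\<And>w. w \<in> U \<Longrightarrow> \<exists>c. \<forall>r<R. \<rho> w r = v w r + (\<Sum>i<k. L w r i * c i)"
    using \<rho>_local[OF g_nonzero_coord[of d z]] by blast
  let ?V = "U \<inter> (U \<inter> {z. g d z \<noteq> 0})"
  have "reg m ?V (\<lambda>z. chart_rep d (v z) z r)"
    unfolding chart_rep_def using k
    by (intro reg_diff reg_sum reg_mult_polyfun reg_chart_coeff L_polyfun assms U) auto
  moreover have "chart_rep d (v w) w r = chart_rep d (\<rho> w) w r" if w: "w \<in> ?V" for w
  proof -
    obtain c where "\<And>r. r < R \<Longrightarrow> \<rho> w r = v w r + (\<Sum>i<k. L w r i * c i)"
      using U(3)[of w] w by blast
    from chart_rep_add_image[OF _ assms this] show ?thesis using w by simp
  qed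
  ultimately have "reg m ?V (\<lambda>z. chart_rep d (\<rho> z) z r)" by (rule reg_cong)
  then show "\<exists>V. z \<in> V \<and> V \<subseteq> {z. g d z \<noteq> 0} \<and> reg m V (\<lambda>z. chart_rep d (\<rho> z) z r)"
    using U(1) z by (intro exI[of _ ?V]) auto
qed

lemma chart_coeff_scale:
  assumes "t \<noteq> 0" "i < k"
  shows "chart_coeff d (\<lambda>r. t * u r) (\<lambda>l. t * z l) i = chart_coeff d u z i"
proof -
  have "t ^ k = t * t ^ (k - 1)" using k by (simp flip: power_Suc)
  moreover have "(\<Sum>r<R. \<Gamma> d (\<lambda>l. t * z l) i r * (t * u r)) = t * t ^ (k - 1) * (\<Sum>r<R. \<Gamma> d z i r * u r)"
    unfolding sum_distrib_left by (intro sum.cong) (auto simp: \<Gamma>_hom assms)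
  ultimately show ?thesis using assms(1) by (simp add: chart_coeff_def g_hom)
qed

lemma transition_hom:
  assumes "t \<noteq> 0" "i < k" "g d z \<noteq> 0" "g e z \<noteq> 0"
  shows "transition d e (\<lambda>l. t * z l) i = transition d e z i"
proof -
  obtain c where c: "\<And>r. r < R \<Longrightarrow> \<rho> (\<lambda>l. t * z l) r = t * \<rho> z r + (\<Sum>i<k. L (\<lambda>l. t * z l) r i * c i)"
    using \<rho>_hom[OF g_nonzero_coord[OF assms(3)] assms(1)] by blast
  have "g d (\<lambda>l. t * z l) \<noteq> 0" "g e (\<lambda>l. t * z l) \<noteq> 0" using assms by (auto simp: g_hom)
  from this[THEN chart_coeff_add_image, OF assms(2) c] show ?thesis
    by (simp add: transition_def chart_coeff_scale assms)
qed

lemma chart_rep_hom: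
  assumes "t \<noteq> 0" "r < R" "g d z \<noteq> 0"
  shows "chart_rep d (\<rho> (\<lambda>l. t * z l)) (\<lambda>l. t * z l) r = t * chart_rep d (\<rho> z) z r"
proof -
  obtain c where c: "\<And>r. r < R \<Longrightarrow> \<rho> (\<lambda>l. t * z l) r = t * \<rho> z r + (\<Sum>i<k. L (\<lambda>l. t * z l) r i * c i)"
    using \<rho>_hom[OF g_nonzero_coord[OF assms(3)] assms(1)] by blast
  have "g d (\<lambda>l. t * z l) \<noteq> 0" using assms by (auto simp: g_hom)
  from chart_rep_add_image[OF this assms(2) c] show ?thesis
    by (simp add: chart_rep_def chart_coeff_scale L_hom assms right_diff_distrib sum_distrib_left mult.assoc)
qed

lemma coords_cong:
  assumes "\<And>i. i < m \<Longrightarrow> z i = w i"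
  shows "i < k \<Longrightarrow> transition d e z i = transition d e w i"
    and "r < R \<Longrightarrow> chart_rep d (\<rho> z) z r = chart_rep d (\<rho> w) w r"
proof -
  have [simp]: "\<rho> z = \<rho> w" "g d z = g d w" for d
    using assms by (auto intro: \<rho>_coords polyfun_cong_coords[OF g_polyfun])
  have [simp]: "\<Gamma> d z i r = \<Gamma> d w i r" if "r < R" "i < k" for d r i
    by (rule polyfun_cong_coords[OF \<Gamma>_polyfun[OF that] assms])
  have [simp]: "L z r i = L w r i" if "r < R" "i < k" for r i
    by (rule polyfun_cong_coords[OF L_polyfun[OF that] assms])
  have *: "chart_coeff d u z i = chart_coeff d u w i" if "i < k" for d u i
    using that by (simp add: chart_coeff_def)
  show "i < k \<Longrightarrow> transition d e z i = transition d e w i" by (simp add: transition_def *)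
  show "r < R \<Longrightarrow> chart_rep d (\<rho> z) z r = chart_rep d (\<rho> w) w r" by (simp add: chart_rep_def *)
qed

text \<open>The cocycle rule writes the coefficient between charts 0 and 1 as that between 0 and 2
  minus that between 1 and 2. On a plane where only coordinates \<open>i0\<close> and
  \<open>i1\<close> vary, \<open>g 2\<close> is constant, so these two have poles along one axis
  each; \<open>polyfun_split\<close> turns this into a global splitting.\<close>

lemma transition_split:
  assumes "i < k"
  shows "\<exists>K. \<exists>P1\<in>polyfun m. \<exists>P2\<in>polyfun m.
    (\<forall>z t. P1 (\<lambda>l. t * z l) = t ^ K * P1 z) \<and> (\<forall>z t. P2 (\<lambda>l. t * z l) = t ^ K * P2 z) \<and>
    (\<forall>z. z i0 \<noteq> 0 \<longrightarrow> z i1 \<noteq> 0 \<longrightarrow> transition 0 1 z i = P1 z / z i1 ^ K + P2 z / z i0 ^ K)"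
proof -
  have "{z. g 0 z \<noteq> 0 \<and> g 1 z \<noteq> 0} = {z. z i0 \<noteq> 0 \<and> z i1 \<noteq> 0}"
    using k by (auto simp: g0 g1 simp del: One_nat_def)
  then have "reg m {z. z i0 \<noteq> 0 \<and> z i1 \<noteq> 0} (\<lambda>z. transition 0 1 z i)"
    using reg_transition[OF assms, of 0 1] by simp
  then obtain K P where P: "P \<in> polyfun m"
    "\<And>z. z i0 \<noteq> 0 \<Longrightarrow> z i1 \<noteq> 0 \<Longrightarrow> transition 0 1 z i * (z i0 * z i1) ^ K = P z"
    by (rule reg_two_coordinate_complement[OF _ i0 i1 i01]) (use coords_cong(1) assms in blast)+
  have P_hom: "P (\<lambda>l. t * z l) = t ^ (2 * K) * P z" for z t
  proof (rule homogeneousI_dense[OF P(1), where h = "\<lambda>z. z i0 * z i1"])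
    fix z :: "nat \<Rightarrow> complex" and t assume z: "z i0 * z i1 \<noteq> 0" and t: "t \<noteq> (0::complex)"
    then have *: "transition 0 1 (\<lambda>l. t * z l) i = transition 0 1 z i"
      by (intro transition_hom t assms) (auto simp: g0 g1 simp del: One_nat_def)
    have "P (\<lambda>l. t * z l) = transition 0 1 (\<lambda>l. t * z l) i * (t * z i0 * (t * z i1)) ^ K"
      using P(2)[of "\<lambda>l. t * z l"] z t by simp
    also have "\<dots> = t ^ (2 * K) * (transition 0 1 z i * (z i0 * z i1) ^ K)"
      unfolding * by (simp add: power_mult_distrib power_mult power2_eq_square mult_ac)
    also have "transition 0 1 z i * (z i0 * z i1) ^ K = P z" using P(2)[of z] z by simp
    finally show "P (\<lambda>l. t * z l) = t ^ (2 * K) * P z" .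
  qed (use i0 i1 in \<open>auto intro!: polyfun_intros\<close>)
  have "\<exists>P1\<in>polyfun m. \<exists>P2\<in>polyfun m. \<forall>z. P z = z i0 ^ K * P1 z + z i1 ^ K * P2 z"
  proof (rule polyfun_split[OF P(1) i0 i1 i01 g_polyfun g2(2)])
    fix z assume z: "g 2 z \<noteq> 0"
    \<comment> \<open>Retraction to the plane through \<open>z\<close> in the directions
      \<open>i0\<close> and \<open>i1\<close>, which lies inside the third chart.\<close>
    let ?s = "\<lambda>w. z(i0 := w i0, i1 := w i1)"
    have s: "(\<lambda>w. ?s w l) \<in> polyfun m" if "l < m" for l
      by (cases "l = i1"; cases "l = i0") (auto intro: polyfun_intros i0 i1)
    have gs: "g 0 (?s w) = w i0 ^ k" "g 1 (?s w) = w i1 ^ k" "g 2 (?s w) \<noteq> 0" for w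
      using z i01 by (auto simp: g0 g1 g2 simp del: One_nat_def)
    have "{w. ?s w \<in> {z. g 0 z \<noteq> 0 \<and> g 2 z \<noteq> 0}} = {w. w i0 \<noteq> 0}"
      using gs k by (auto simp del: One_nat_def)
    with reg_compose[OF reg_transition[OF assms, of 0 2], of ?s m] s
    have "reg m {w. w i0 \<noteq> 0} (\<lambda>w. transition 0 2 (?s w) i)" by simp
    then obtain M1 p1 where p1: "p1 \<in> polyfun m"
      "\<And>w. w i0 \<noteq> 0 \<Longrightarrow> transition 0 2 (?s w) i * w i0 ^ M1 = p1 w"
      by (rule reg_one_coordinate_complement[OF _ i0]) (use i0 i1 in \<open>auto intro: that\<close>)
    have "{w. ?s w \<in> {z. g 1 z \<noteq> 0 \<and> g 2 z \<noteq> 0}} = {w. w i1 \<noteq> 0}"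
      using gs k by (auto simp del: One_nat_def)
    with reg_compose[OF reg_transition[OF assms, of 1 2], of ?s m] s
    have "reg m {w. w i1 \<noteq> 0} (\<lambda>w. transition 1 2 (?s w) i)" by simp
    then obtain M2 p2 where p2: "p2 \<in> polyfun m"
      "\<And>w. w i1 \<noteq> 0 \<Longrightarrow> transition 1 2 (?s w) i * w i1 ^ M2 = p2 w"
      by (rule reg_one_coordinate_complement[OF _ i1]) (use i0 i1 in \<open>auto intro: that\<close>)
    \<comment> \<open>A common exponent that clears both poles and is at least
      \<open>K\<close>.\<close>
    let ?M = "M1 + M2 + K"
    show "\<exists>M\<ge>K. \<exists>p1\<in>polyfun m. \<exists>p2\<in>polyfun m. \<forall>a b. a \<noteq> 0 \<longrightarrow> b \<noteq> 0 \<longrightarrow>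
        P (z(i0 := a, i1 := b)) * (a ^ M * b ^ M) =
        (a * b) ^ K * (b ^ M * p1 (z(i0 := a, i1 := b)) - a ^ M * p2 (z(i0 := a, i1 := b)))"
    proof (rule exI[of _ ?M], rule conjI, simp, rule bexI[of _ "\<lambda>w. w i0 ^ (M2 + K) * p1 w"],
        rule bexI[of _ "\<lambda>w. w i1 ^ (M1 + K) * p2 w"], intro allI impI)
      show "(\<lambda>w. w i0 ^ (M2 + K) * p1 w) \<in> polyfun m" "(\<lambda>w. w i1 ^ (M1 + K) * p2 w) \<in> polyfun m"
        by (intro polyfun_intros p1 p2 i0 i1)+
      fix a b :: complex assume ab: "a \<noteq> 0" "b \<noteq> 0"
      let ?w = "z(i0 := a, i1 := b)"
      have w: "?w i0 = a" "?w i1 = b" "?s ?w = ?w" using i01 by auto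
      have "P ?w = transition 0 1 ?w i * (a * b) ^ K" using P(2)[of ?w] w ab by simp
      also have "transition 0 1 ?w i = transition 0 2 ?w i - transition 1 2 ?w i"
        by (simp add: transition_def)
      finally have P_eq: "P ?w = (transition 0 2 ?w i - transition 1 2 ?w i) * (a * b) ^ K" .
      have "P ?w * (a ^ ?M * b ^ ?M) = (a * b) ^ K *
          (b ^ ?M * (a ^ (M2 + K) * (transition 0 2 ?w i * a ^ M1)) -
           a ^ ?M * (b ^ (M1 + K) * (transition 1 2 ?w i * b ^ M2)))"
        unfolding P_eq by (simp add: power_add algebra_simps)
      then show "P ?w * (a ^ ?M * b ^ ?M) = (a * b) ^ K *
          (b ^ ?M * (?w i0 ^ (M2 + K) * p1 ?w) - a ^ ?M * (?w i1 ^ (M1 + K) * p2 ?w))"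
        using p1(2)[of ?w] p2(2)[of ?w] ab unfolding w by simp
    qed
  qed
  then obtain P1 P2 where P12: "P1 \<in> polyfun m" "P2 \<in> polyfun m"
    "\<And>z. P z = z i0 ^ K * P1 z + z i1 ^ K * P2 z" "\<And>z t. P1 (\<lambda>i. t * z i) = t ^ K * P1 z"
    "\<And>z t. P2 (\<lambda>i. t * z i) = t ^ K * P2 z"
    using homogeneous_split[of P, OF P_hom] by blast
  have "transition 0 1 z i = P1 z / z i1 ^ K + P2 z / z i0 ^ K" if "z i0 \<noteq> 0" "z i1 \<noteq> 0" for z
    using P(2)[OF that] that unfolding P12(3) by (simp add: field_simps power_mult_distrib)
  then show ?thesis using P12 by blast
qed

text \<open>Agreement with \<open>\<rho>\<close> is claimed only where
  \<open>z i0 \<noteq> 0\<close>. This is a dense set, which suffices because everything derived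
  from it is an identity of regular functions.\<close>

theorem lift_exists:
  "\<exists>v. (\<forall>r<R. v r \<in> polyfun m \<and> (\<forall>z t. v r (\<lambda>l. t * z l) = t * v r z)) \<and>
    (\<forall>z. z i0 \<noteq> 0 \<longrightarrow> (\<exists>c. \<forall>r<R. \<rho> z r = v r z + (\<Sum>i<k. L z r i * c i)))"
proof -
  have "\<forall>i. \<exists>K P1 P2. i < k \<longrightarrow> P1 \<in> polyfun m \<and> P2 \<in> polyfun m \<and>
    (\<forall>z t. P2 (\<lambda>l. t * z l) = t ^ K * P2 z) \<and>
    (\<forall>z. z i0 \<noteq> 0 \<longrightarrow> z i1 \<noteq> 0 \<longrightarrow> transition 0 1 z i = P1 z / z i1 ^ K + P2 z / z i0 ^ K)"
    using transition_split by blast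
  then obtain K P1 P2 where P: "\<And>i. i < k \<Longrightarrow> P1 i \<in> polyfun m" "\<And>i. i < k \<Longrightarrow> P2 i \<in> polyfun m"
    "\<And>i z t. i < k \<Longrightarrow> P2 i (\<lambda>l. t * z l) = t ^ K i * P2 i z"
    "\<And>i z. i < k \<Longrightarrow> z i0 \<noteq> 0 \<Longrightarrow> z i1 \<noteq> 0 \<Longrightarrow>
      transition 0 1 z i = P1 i z / z i1 ^ K i + P2 i z / z i0 ^ K i"
    unfolding choice_iff by blast
  have U0: "{z. g 0 z \<noteq> 0} = {z. z i0 \<noteq> 0}" and U1: "{z. g 1 z \<noteq> 0} = {z. z i1 \<noteq> 0}"
    using k by (auto simp: g0 g1 simp del: One_nat_def)
  \<comment> \<open>Each half of the splitting is regular on one of the two charts and is absorbed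
    there. The signs are such that \<open>W0\<close> and \<open>W1\<close> agree on the
    overlap.\<close>
  define W0 where "W0 r z = chart_rep 0 (\<rho> z) z r - (\<Sum>i<k. L z r i * (P2 i z / z i0 ^ K i))" for r z
  define W1 where "W1 r z = chart_rep 1 (\<rho> z) z r + (\<Sum>i<k. L z r i * (P1 i z / z i1 ^ K i))" for r z
  have P_coords: "P1 i z = P1 i w" "P2 i z = P2 i w" "L z r i = L w r i"
    if "i < k" "r < R" "\<And>i. i < m \<Longrightarrow> z i = w i" for i r z w
    using polyfun_cong_coords[OF P(1)] polyfun_cong_coords[OF P(2)]
      polyfun_cong_coords[OF L_polyfun] that by metis+
  have fraction: "reg m {z. z j \<noteq> 0} (\<lambda>z. p z / z j ^ n)"
    if p: "p \<in> polyfun m" and j: "j < m" for p j n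
  proof -
    have "reg m (UNIV \<inter> {z. z j \<noteq> 0}) (\<lambda>z. p z / z j)"
      by (rule reg_divide_polyfun[OF reg_polyfun[OF p] polyfun_coord[OF j]])
    then have "reg m {z. z j \<noteq> 0} p"
      using reg_mult_polyfun[OF reg_open p, of "{z. z j \<noteq> 0}" _ 1] by simp
    from reg_divide_polyfun[OF this polyfun_power[OF polyfun_coord[OF j]], of n]
    show ?thesis by (rule back_subst[of "\<lambda>U. reg m U _"]) auto
  qed
  have "\<exists>d\<in>polyfun m. (\<forall>z t. d (\<lambda>l. t * z l) = t * d z) \<and> (\<forall>z. z i0 \<noteq> 0 \<longrightarrow> W0 r z = d z)"
    if r: "r < R" for r
  proof -
    have "reg m ({z. z i0 \<noteq> 0} \<inter> {z. z i0 \<noteq> 0}) (W0 r)"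
      unfolding W0_def
      using k r by (intro reg_diff reg_sum reg_mult_polyfun fraction P L_polyfun i0
          reg_chart_rep[of r 0, unfolded U0]) auto
    then have reg0: "reg m {z. z i0 \<noteq> 0} (W0 r)" by simp
    have "W0 r z = W0 r w" if "\<And>i. i < m \<Longrightarrow> z i = w i" for z w
      unfolding W0_def using coords_cong(2)[OF that r] P_coords[OF _ r that] that[OF i0] by simp
    with reg0 obtain e0 a where a: "a \<in> polyfun m" "\<And>z. z i0 \<noteq> 0 \<Longrightarrow> W0 r z * z i0 ^ e0 = a z"
      using reg_one_coordinate_complement[OF _ i0] by blast
    have "reg m ({z. z i1 \<noteq> 0} \<inter> {z. z i1 \<noteq> 0}) (W1 r)"
      unfolding W1_def
      using k r by (intro reg_add reg_sum reg_mult_polyfun fraction P L_polyfun i1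
          reg_chart_rep[of r 1, unfolded U1]) auto
    then have reg1: "reg m {z. z i1 \<noteq> 0} (W1 r)" by simp
    have "W1 r z = W1 r w" if "\<And>i. i < m \<Longrightarrow> z i = w i" for z w
      unfolding W1_def using coords_cong(2)[OF that r] P_coords[OF _ r that] that[OF i1] by simp
    with reg1 obtain e1 b where b: "b \<in> polyfun m" "\<And>z. z i1 \<noteq> 0 \<Longrightarrow> W1 r z * z i1 ^ e1 = b z"
      using reg_one_coordinate_complement[OF _ i1] by blast
    have W01: "W0 r z = W1 r z" if z: "z i0 \<noteq> 0" "z i1 \<noteq> 0" for z
    proof -
      have "chart_rep 0 (\<rho> z) z r - chart_rep 1 (\<rho> z) z r = (\<Sum>i<k. L z r i * transition 0 1 z i)"
        by (simp add: chart_rep_def transition_def right_diff_distrib sum_subtractf)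
      also have "\<dots> = (\<Sum>i<k. L z r i * (P1 i z / z i1 ^ K i)) + (\<Sum>i<k. L z r i * (P2 i z / z i0 ^ K i))"
        unfolding sum.distrib[symmetric]
        by (intro sum.cong) (auto simp: P(4)[OF _ z] distrib_left simp del: One_nat_def)
      finally show ?thesis by (simp add: W0_def W1_def algebra_simps)
    qed
    have "a z * z i1 ^ e1 = b z * z i0 ^ e0" if "z i0 \<noteq> 0" "z i1 \<noteq> 0" for z
      using a(2)[of z] b(2)[of z] W01[of z] that by (simp flip: a(2) b(2) add: mult_ac)
    from polyfun_divisible_if_quotients_agree[OF a(1) b(1) i0 i1 i01 this]
    obtain d where d: "d \<in> polyfun m" "\<And>z. a z = z i0 ^ e0 * d z" by blast
    have W0: "W0 r z = d z" if "z i0 \<noteq> 0" for z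
      using a(2)[of z] that by (simp add: d(2))
    have "d (\<lambda>l. t * z l) = t ^ 1 * d z" for z t
    proof (rule homogeneousI_dense[OF d(1) polyfun_coord[OF i0]])
      fix z :: "nat \<Rightarrow> complex" and t assume z: "z i0 \<noteq> 0" and t: "t \<noteq> (0::complex)"
      have "(\<Sum>i<k. L (\<lambda>l. t * z l) r i * (P2 i (\<lambda>l. t * z l) / (t * z i0) ^ K i)) =
          t * (\<Sum>i<k. L z r i * (P2 i z / z i0 ^ K i))"
        unfolding sum_distrib_left using t r
        by (intro sum.cong) (auto simp: L_hom P(3) power_mult_distrib)
      then have "W0 r (\<lambda>l. t * z l) = t * W0 r z"
        using z t by (simp add: W0_def chart_rep_hom[OF t r] g0 right_diff_distrib)
      then show "d (\<lambda>l. t * z l) = t ^ 1 * d z"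
        using z t by (simp flip: W0)
    qed simp
    then show ?thesis using d(1) W0 by (intro bexI[of _ d]) auto
  qed
  then have "\<forall>r. \<exists>d. r < R \<longrightarrow> d \<in> polyfun m \<and> (\<forall>z t. d (\<lambda>l. t * z l) = t * d z) \<and>
      (\<forall>z. z i0 \<noteq> 0 \<longrightarrow> W0 r z = d z)" by blast
  then obtain v where v: "\<And>r. r < R \<Longrightarrow> v r \<in> polyfun m"
    "\<And>r z t. r < R \<Longrightarrow> v r (\<lambda>l. t * z l) = t * v r z" "\<And>r z. r < R \<Longrightarrow> z i0 \<noteq> 0 \<Longrightarrow> W0 r z = v r z"
    unfolding choice_iff by blast
  have "\<rho> z r = v r z + (\<Sum>i<k. L z r i * (P2 i z / z i0 ^ K i + chart_coeff 0 (\<rho> z) z i))"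
    if "z i0 \<noteq> 0" "r < R" for z r
    using v(3)[of r z] that by (simp add: W0_def chart_rep_def distrib_left sum.distrib algebra_simps)
  note lift = this
  show ?thesis
  proof (rule exI[of _ v], intro conjI allI impI)
    fix z :: "nat \<Rightarrow> complex" assume "z i0 \<noteq> 0"
    then show "\<exists>c. \<forall>r<R. \<rho> z r = v r z + (\<Sum>i<k. L z r i * c i)"
      by (intro exI[of _ "\<lambda>i. P2 i z / z i0 ^ K i + chart_coeff 0 (\<rho> z) z i"] allI impI lift)
  qed (use v in auto)
qed

end

section \<open>Linear syzygies of the RS matrix\<close>

text \<open>
  Along an antidiagonal \<open>T\<close> changes by at most \<open>2 \<delta>\<close> per step, and the hypothesis pairs \<open>T j a\<close>
  with the negative of another entry of the same antidiagonal.
\<close>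
lemma skew_band_bound:
  fixes T :: "nat \<Rightarrow> nat \<Rightarrow> complex"
  assumes k: "k \<ge> 2"
    and T: "\<And>i l a. i < k \<Longrightarrow> l \<le> n \<Longrightarrow> a \<le> n \<Longrightarrow> cmod (T (i + l) a + T (i + a) l) \<le> \<delta>"
    and j: "j < n + k" and a: "a \<le> n"
  shows "cmod (T j a) \<le> (real n + 1) * \<delta>"
proof -
  have "cmod (T (0 + 0) 0 + T (0 + 0) 0) \<le> \<delta>" using k by (intro T) auto
  then have "0 \<le> \<delta>" by (rule order_trans[OF norm_ge_zero])
  have step: "cmod (T (Suc j) a - T j (Suc a)) \<le> 2 * \<delta>" if "Suc j < n + k" "a < n" for j a
  proof -
    \<comment> \<open>A row such that \<open>i\<close> and \<open>i - 1\<close> are both admissible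
      and the offset \<open>l\<close> is at most \<open>n\<close>. The relations for
      \<open>(i, l, a)\<close> and \<open>(i - 1, l, a + 1)\<close> share the entry
      \<open>T (i + a) l\<close>, which cancels on subtraction.\<close>
    define i where "i = max 1 (Suc j - n)"
    define l where "l = Suc j - i"
    have il: "1 \<le> i" "i < k" "l \<le> n" "Suc j = i + l" "j = (i - 1) + l" "i + a = (i - 1) + Suc a"
      using that k by (auto simp: i_def l_def max_def split: if_splits)
    have "cmod (T (i + l) a + T (i + a) l) \<le> \<delta>" using il that by (intro T) auto
    moreover have "cmod (T ((i - 1) + l) (Suc a) + T ((i - 1) + Suc a) l) \<le> \<delta>"
      using il that by (intro T) auto
    ultimately have "cmod ((T (Suc j) a + T (i + a) l) - (T j (Suc a) + T (i + a) l)) \<le> \<delta> + \<delta>"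
      unfolding il(4) il(5)[symmetric] il(6)[symmetric]
      by (metis add_mono norm_triangle_ineq4 order_trans)
    then show ?thesis by simp
  qed
  have walk: "cmod (T (j + d) a - T j (a + d)) \<le> 2 * real d * \<delta>" if "j + d < n + k" "a + d \<le> n" for j a d
    using that
  proof (induction d arbitrary: a)
    case (Suc d)
    have "cmod (T (Suc (j + d)) a - T (j + d) (Suc a)) \<le> 2 * \<delta>" using Suc.prems by (intro step) auto
    moreover have "cmod (T (j + d) (Suc a) - T j (Suc a + d)) \<le> 2 * real d * \<delta>"
      using Suc.prems by (intro Suc.IH) auto
    ultimately have "cmod ((T (Suc (j + d)) a - T (j + d) (Suc a)) + (T (j + d) (Suc a) - T j (Suc a + d)))
        \<le> 2 * \<delta> + 2 * real d * \<delta>"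
      by (metis add_mono norm_triangle_ineq order_trans)
    then show ?case by (simp add: algebra_simps)
  qed simp
  \<comment> \<open>For \<open>j = i + l\<close>, the hypothesis makes \<open>T (i + a) l\<close>
    nearly the negative of \<open>T j a\<close>, while walking along their common antidiagonal makes
    the two nearly equal.\<close>
  define i where "i = min j (k - 1)"
  define l where "l = j - i"
  have il: "i < k" "l \<le> n" "j = i + l" using j k by (auto simp: i_def l_def)
  have le: "2 * real d * \<delta> \<le> 2 * real n * \<delta>" if "d \<le> n" for d
    using that \<open>0 \<le> \<delta>\<close> by (intro mult_right_mono) auto
  have "cmod (T j a - T (i + a) l) \<le> 2 * real n * \<delta>"
  proof (cases "l \<le> a")
    case True
    then have "i + a = j + (a - l)" "a = l + (a - l)" using il by auto
    then show ?thesis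
      using walk[of j "a - l" l] le[of "a - l"] a il by (simp add: norm_minus_commute)
  next
    case False
    then have "j = (i + a) + (l - a)" "l = a + (l - a)" using il by auto
    then show ?thesis
      using walk[of "i + a" "l - a" a] le[of "l - a"] a il j by simp
  qed
  moreover have "cmod (T j a + T (i + a) l) \<le> \<delta>" using T[OF il(1,2) a] il(3) by simp
  ultimately have "cmod ((T j a - T (i + a) l) + (T j a + T (i + a) l)) \<le> 2 * real n * \<delta> + \<delta>"
    by (metis add_mono norm_triangle_ineq order_trans)
  then have "2 * cmod (T j a) \<le> 2 * real n * \<delta> + \<delta>"
    by (simp add: norm_mult flip: mult_2)
  also have "\<dots> \<le> 2 * ((real n + 1) * \<delta>)" using \<open>0 \<le> \<delta>\<close> by (simp add: algebra_simps)
  finally show ?thesis by simp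
qed

text \<open>A maximum argument. Each relation has at most four corner terms, so it holds up to
  \<open>4 * cmod \<epsilon> * M\<close>, where \<open>M\<close> is the largest modulus. The
  unperturbed estimate then gives \<open>M \<le> 4 * (real n + 1) * cmod \<epsilon> * M\<close>,
  hence \<open>M = 0\<close>; this is where the smallness constant comes from.\<close>

lemma skew_band_perturbed_zero:
  fixes T :: "nat \<Rightarrow> nat \<Rightarrow> complex"
  assumes k: "k \<ge> 2" and \<epsilon>: "4 * (real n + 1) * cmod \<epsilon> < 1"
    and T: "\<And>i l b. i < k \<Longrightarrow> l \<le> n \<Longrightarrow> b \<le> n \<Longrightarrow>
      T (k - 1 - i + l) b + T (k - 1 - i + b) l +
      \<epsilon> * ((if l = 1 then (if i = 0 then T 0 b else 0) + (if i = k - 1 then T (n + k - 1) b else 0) else 0) +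
           (if b = 1 then (if i = 0 then T 0 l else 0) + (if i = k - 1 then T (n + k - 1) l else 0) else 0)) = 0"
    and j: "j < n + k" and a: "a \<le> n"
  shows "T j a = 0"
proof -
  let ?S = "(\<lambda>(j, a). cmod (T j a)) ` ({..<n + k} \<times> {..n})"
  define M where "M = Max ?S"
  have fin: "finite ?S" by simp
  have M: "cmod (T j a) \<le> M" if "j < n + k" "a \<le> n" for j a
    unfolding M_def using that by (intro Max_ge[OF fin]) auto
  have "M \<in> ?S" unfolding M_def using k by (intro Max_in[OF fin]) (auto simp: lessThan_empty_iff)
  then obtain j0 a0 where M0: "M = cmod (T j0 a0)" "j0 < n + k" "a0 \<le> n" by auto
  then have "0 \<le> M" by simp
  have bound: "cmod (if P then (if Q then x else 0) + (if Q' then y else 0) else 0) \<le> 2 * M"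
    if "cmod x \<le> M" "cmod y \<le> M" for P Q Q' x y
    using that \<open>0 \<le> M\<close> norm_triangle_ineq[of x y] by auto
  have "cmod (T (i + l) b + T (i + b) l) \<le> 4 * cmod \<epsilon> * M" if ilb: "i < k" "l \<le> n" "b \<le> n" for i l b
  proof -
    let ?e1 = "if l = 1 then (if k - 1 - i = 0 then T 0 b else 0) + (if k - 1 - i = k - 1 then T (n + k - 1) b else 0) else 0"
    let ?e2 = "if b = 1 then (if k - 1 - i = 0 then T 0 l else 0) + (if k - 1 - i = k - 1 then T (n + k - 1) l else 0) else 0"
    \<comment> \<open>The band of H runs backwards; reversing the rows brings it into the form of
      \<open>skew_band_bound\<close>.\<close>
    have "k - 1 - (k - 1 - i) = i" "k - 1 - i < k" using ilb(1) by auto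
    with T[of "k - 1 - i" l b] ilb have "T (i + l) b + T (i + b) l + \<epsilon> * (?e1 + ?e2) = 0" by simp
    then have "T (i + l) b + T (i + b) l = - (\<epsilon> * (?e1 + ?e2))" by (simp only: eq_neg_iff_add_eq_0)
    moreover have "cmod (?e1 + ?e2) \<le> 2 * M + 2 * M"
      using ilb k by (intro norm_triangle_mono bound M) auto
    ultimately have "cmod (T (i + l) b + T (i + b) l) \<le> cmod \<epsilon> * (2 * M + 2 * M)"
      by (simp only: norm_minus_cancel norm_mult) (intro mult_left_mono norm_ge_zero)
    then show ?thesis by simp
  qed
  from skew_band_bound[of k n T "4 * cmod \<epsilon> * M", OF k this M0(2,3)]
  have "M \<le> 4 * (real n + 1) * cmod \<epsilon> * M" unfolding M0(1)[symmetric] by (simp add: mult_ac)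
  then have "M * (1 - 4 * (real n + 1) * cmod \<epsilon>) \<le> 0" by (simp add: algebra_simps)
  then have "M \<le> 0" using \<epsilon> by (simp add: mult_le_0_iff)
  then have "cmod (T j a) \<le> 0" using M[OF j a] by linarith
  then show ?thesis by simp
qed

text \<open>The band matrix is Toeplitz up to the corner terms; comparing the two rows that
  compute the same Toeplitz relation, once with and once without a corner term, shows that the corner
  entries vanish (this is where \<open>\<epsilon> \<noteq> 0\<close>, \<open>n \<ge> 2\<close> and \<open>k \<ge> 3\<close> are needed).\<close>
lemma mixed_band_zero:
  fixes U W :: "nat \<Rightarrow> nat \<Rightarrow> complex"
  assumes n: "n \<ge> 2" and k: "k \<ge> 3" and \<epsilon>: "\<epsilon> \<noteq> 0"
    and eq: "\<And>i l b. i < k \<Longrightarrow> l \<le> n \<Longrightarrow> b \<le> n \<Longrightarrow>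
      U (i + l) b + W (k - 1 - i + b) l +
      (if b = 1 then \<epsilon> * ((if i = 0 then W 0 l else 0) + (if i = k - 1 then W (n + k - 1) l else 0)) else 0) = 0"
    and W0: "\<And>j. j < k \<Longrightarrow> W j 0 = 0"
    and j: "j < n + k" and l: "l \<le> n"
  shows "W j l = 0" and "U j l = 0"
proof -
  define E where "E i b l = (if b = 1 then \<epsilon> * ((if i = 0 then W 0 l else 0) +
    (if i = k - 1 then W (n + k - 1) l else 0)) else 0)" for i b l :: nat
  \<comment> \<open>The relations for \<open>(i, l + 1)\<close> and \<open>(i + 1, l)\<close>
    contain the same entry of \<open>U\<close>; subtracting eliminates \<open>U\<close>.\<close>
  have rel: "W (Suc (k - 2 - i + b)) (Suc l) + E i b (Suc l) = W (k - 2 - i + b) l + E (Suc i) b l"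
    if "Suc i < k" "b \<le> n" "l < n" for i b l
  proof -
    have "U (i + Suc l) b + W (k - 1 - i + b) (Suc l) + E i b (Suc l) = 0"
      unfolding E_def using that by (intro eq) auto
    moreover have "U (Suc i + l) b + W (k - 1 - Suc i + b) l + E (Suc i) b l = 0"
      unfolding E_def using that by (intro eq) auto
    moreover have "k - 1 - i + b = Suc (k - 2 - i + b)" "k - 1 - Suc i + b = k - 2 - i + b"
      using that by auto
    ultimately have "U (Suc (i + l)) b + (W (Suc (k - 2 - i + b)) (Suc l) + E i b (Suc l)) =
        U (Suc (i + l)) b + (W (k - 2 - i + b) l + E (Suc i) b l)"
      by (simp only: add_Suc_right add_Suc add.assoc)
    then show ?thesis by simp
  qed
  \<comment> \<open>Rows \<open>(0, 1)\<close> and \<open>(1, 2)\<close> both compare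
    \<open>W k (l + 1)\<close> with \<open>W (k - 1) l\<close>, but only the first meets the upper
    corner. The value \<open>b = 2\<close> uses \<open>n \<ge> 2\<close>.\<close>
  have top: "W 0 (Suc l) = 0" if "l < n" for l
  proof -
    have "W k (Suc l) + \<epsilon> * W 0 (Suc l) = W (k - 1) l"
    proof -
      have "Suc (k - 2 - 0 + 1) = k" "k - 2 - 0 + 1 = k - 1" using k by auto
      then show ?thesis using rel[of 0 1 l] that n k by (simp add: E_def)
    qed
    moreover have "W k (Suc l) = W (k - 1) l"
    proof -
      have "Suc (k - 2 - 1 + 2) = k" "k - 2 - 1 + 2 = k - 1" using k by auto
      then show ?thesis using rel[of 1 2 l] that n k by (simp add: E_def)
    qed
    ultimately show ?thesis using \<epsilon> by simp
  qed
  \<comment> \<open>The same comparison at the lower corner, between rows \<open>k - 2\<close> and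
    \<open>k - 3\<close>; the latter exists because \<open>k \<ge> 3\<close>.\<close>
  have bot: "W (n + k - 1) l = 0" if "l < n" for l
  proof -
    have "W 2 (Suc l) = W 1 l + \<epsilon> * W (n + k - 1) l"
    proof -
      have "Suc (k - 2) = k - 1" "k - 2 \<noteq> k - 1" "k - 2 \<noteq> 0" "k - 1 \<noteq> 0" using k by auto
      then show ?thesis using rel[of "k - 2" 1 l] that n k by (simp add: E_def numeral_2_eq_2)
    qed
    moreover have "W 2 (Suc l) = W 1 l"
    proof -
      have "Suc (k - 2 - (k - 3) + 0) = 2" "k - 2 - (k - 3) + 0 = 1" using k by auto
      then show ?thesis using rel[of "k - 3" 0 l] that n k by (simp add: E_def numeral_2_eq_2)
    qed
    ultimately show ?thesis using \<epsilon> by simp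
  qed
  have diag1: "W (Suc j) (Suc l) = W j l" if "Suc j < n + k" "l < n" for j l
  proof -
    define i where "i = k - 2 - min j (k - 2)"
    define b where "b = j - min j (k - 2)"
    have "Suc i < k" "b \<le> n" "k - 2 - i + b = j" using that k by (auto simp: i_def b_def)
    moreover from this have "E i b (Suc l) = 0" "E (Suc i) b l = 0"
      using top bot that by (auto simp: E_def)
    ultimately show ?thesis using rel[of i b l] that by simp
  qed
  have diag: "W (j + d) (l + d) = W j l" if "j + d < n + k" "l + d \<le> n" for j l d
    using that by (induction d) (auto simp: diag1)
  \<comment> \<open>With the corners gone, \<open>W\<close> is constant on diagonals. Every diagonal
    meets row 0 in a positive column, column 0 in a normalized entry, or the last row before column
    \<open>n\<close>, and all of these entries are zero.\<close>
  have W: "W j l = 0" if "j < n + k" "l \<le> n" for j l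
  proof (cases "j < l")
    case True
    have "W j l = W (0 + j) ((l - j) + j)" using True by simp
    also have "\<dots> = W 0 (l - j)" using True that by (subst diag) auto
    also have "l - j = Suc (l - j - 1)" using True by simp
    also have "W 0 (Suc (l - j - 1)) = 0" using True that by (intro top) auto
    finally show ?thesis .
  next
    case False
    show ?thesis
    proof (cases "j - l < k")
      case True
      have "W j l = W ((j - l) + l) (0 + l)" using False by simp
      also have "\<dots> = W (j - l) 0" using False that by (subst diag) auto
      finally show ?thesis using W0 True by simp
    next
      case jl: False
      define d where "d = n + k - 1 - j"
      have "W j l = W (j + d) (l + d)" using that jl False by (subst diag) (auto simp: d_def)
      also have "j + d = n + k - 1" using that by (auto simp: d_def)
      also have "W (n + k - 1) (l + d) = 0"
        using that jl k False by (intro bot) (auto simp: d_def)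
      finally show ?thesis .
    qed
  qed
  show "W j l = 0" by (rule W[OF j l])
  define i where "i = min j (k - 1)"
  have "i < k" "j - i \<le> n" "i + (j - i) = j" using j k by (auto simp: i_def)
  moreover from this have "W (k - 1 - i + l) (j - i) = 0" using l by (intro W) auto
  moreover have "W 0 (j - i) = 0" "W (n + k - 1) (j - i) = 0"
    using W \<open>j - i \<le> n\<close> k by auto
  ultimately show "U j l = 0" using eq[of i "j - i" l] l k by (simp split: if_splits)
qed

text \<open>Polarization: the form is evaluated at unit vectors and at sums of two of them.\<close>

lemma quadratic_form_zero:
  fixes B :: "nat \<Rightarrow> nat \<Rightarrow> complex"
  assumes B: "\<And>z. (\<Sum>p<m. z p * (\<Sum>q<m. B p q * z q)) = 0" and "a < m" "b < m"
  shows "B a b + B b a = 0"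
proof -
  let ?e = "\<lambda>a l. if l = a then 1 else (0::complex)"
  have sum_e: "(\<Sum>p<m. (?e a p + c * ?e b p) * f p) = f a + c * f b"
    if "a < m" "b < m" for a b c and f :: "nat \<Rightarrow> complex"
  proof -
    have "(\<Sum>p<m. (?e a p + c * ?e b p) * f p) =
        (\<Sum>p<m. if p = a then f p else 0) + (\<Sum>p<m. if p = b then c * f p else 0)"
      unfolding sum.distrib[symmetric] by (intro sum.cong) (auto simp: distrib_right)
    then show ?thesis using that by simp
  qed
  have quad: "B a a + c * B a b + c * (B b a + c * B b b) = 0" if "a < m" "b < m" for a b c
  proof -
    have "(\<Sum>q<m. B p q * (?e a q + c * ?e b q)) = B p a + c * B p b" for p
      using sum_e[OF that, of c "B p"] by (simp add: mult.commute)
    then show ?thesis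
      using B[of "\<lambda>l. ?e a l + c * ?e b l"] sum_e[OF that, of c "\<lambda>p. B p a + c * B p b"] by simp
  qed
  have "B a a = 0" "B b b = 0"
    using quad[of a a 0] quad[of b b 0] assms(2,3) by auto
  then show ?thesis using quad[of a b 1] assms(2,3) by simp
qed


section \<open>Entries and row sums of the RS matrix; its linear syzygies\<close>

lemma sum_lessThan_add: "(\<Sum>r<a + b. g r) = (\<Sum>r<a. g r) + (\<Sum>r<b. g (a + r))"
  for a b :: nat and g :: "nat \<Rightarrow> complex"
  by (induction b) (auto simp: add.assoc)

definition rs_entry :: "nat \<Rightarrow> nat \<Rightarrow> complex \<Rightarrow> (nat \<Rightarrow> complex) \<Rightarrow> nat \<Rightarrow> nat \<Rightarrow> complex" where
  "rs_entry n k \<epsilon> z i r = A_mat n k \<epsilon> (vec (2 * n + 2) z) $$ (i, r)"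

lemma A_mat_carrier [simp]: "A_mat n k \<epsilon> p \<in> carrier_mat k (2 * (n + k))"
  by (intro carrier_matI) (simp_all add: A_mat_def F_mat_def H_mat_def)

lemma rs_entry_F:
  "i < k \<Longrightarrow> j < n + k \<Longrightarrow> rs_entry n k \<epsilon> z i j = (if i \<le> j \<and> j - i \<le> n then z (j - i) else 0)"
  by (auto simp: rs_entry_def A_mat_def F_mat_def H_mat_def coord_x_def)

lemma rs_entry_H:
  assumes "i < k" "j < n + k" "n \<ge> 1"
  shows "rs_entry n k \<epsilon> z i (n + k + j) =
    (if (i, j) = (0, 0) \<or> (i, j) = (k - 1, n + k - 1) then \<epsilon> * z (n + 2)
     else if k \<le> i + j + 1 \<and> i + j + 1 - k \<le> n then z (n + 1 + (i + j + 1 - k)) else 0)"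
  using assms by (auto simp: rs_entry_def A_mat_def F_mat_def H_mat_def coord_y_def)

text \<open>For \<open>k \<ge> 2\<close> the two corners lie outside the band of H, so their terms
  add to the band sum instead of replacing part of it. The coordinate y_1 is
  \<open>z (n + 2)\<close>.\<close>

lemma rs_row_sum:
  assumes n: "n \<ge> 1" and k: "k \<ge> 2" and i: "i < k"
  shows "(\<Sum>r<2 * (n + k). rs_entry n k \<epsilon> z i r * f r) =
    (\<Sum>l\<le>n. z l * f (i + l)) + (\<Sum>l\<le>n. z (n + 1 + l) * f (n + k + (k - 1 - i + l))) +
    \<epsilon> * z (n + 2) * ((if i = 0 then f (n + k) else 0) + (if i = k - 1 then f (n + k + (n + k - 1)) else 0))"
proof -
  let ?N = "n + k"
  have "(\<Sum>r<2 * ?N. rs_entry n k \<epsilon> z i r * f r) =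
      (\<Sum>r<?N. rs_entry n k \<epsilon> z i r * f r) + (\<Sum>j<?N. rs_entry n k \<epsilon> z i (?N + j) * f (?N + j))"
    unfolding mult_2 by (rule sum_lessThan_add)
  also have "(\<Sum>r<?N. rs_entry n k \<epsilon> z i r * f r) = (\<Sum>r\<in>(+) i ` {..n}. z (r - i) * f r)"
  proof (intro sum.mono_neutral_cong_right ballI)
    show "(+) i ` {..n} \<subseteq> {..<?N}" using i by auto
    have "r \<in> (+) i ` {..n}" if "i \<le> r" "r - i \<le> n" for r
      using that by (intro image_eqI[of _ _ "r - i"]) auto
    then show "rs_entry n k \<epsilon> z i r * f r = 0" if "r \<in> {..<?N} - (+) i ` {..n}" for r
      using that i by (auto simp: rs_entry_F)
    show "rs_entry n k \<epsilon> z i r * f r = z (r - i) * f r" if "r \<in> (+) i ` {..n}" for r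
      using that i by (auto simp: rs_entry_F)
  qed simp
  also have "\<dots> = (\<Sum>l\<le>n. z l * f (i + l))"
    by (simp add: sum.reindex)
  also have "(\<Sum>j<?N. rs_entry n k \<epsilon> z i (?N + j) * f (?N + j)) =
      (\<Sum>j<?N. if k \<le> i + j + 1 \<and> i + j + 1 - k \<le> n then z (n + 1 + (i + j + 1 - k)) * f (?N + j) else 0) +
      (\<Sum>j<?N. if j = 0 \<and> i = 0 then \<epsilon> * z (n + 2) * f (?N + j) else 0) +
      (\<Sum>j<?N. if j = ?N - 1 \<and> i = k - 1 then \<epsilon> * z (n + 2) * f (?N + j) else 0)"
    unfolding sum.distrib[symmetric]
    using i n k by (intro sum.cong refl) (auto simp: rs_entry_H)
  also have "(\<Sum>j<?N. if k \<le> i + j + 1 \<and> i + j + 1 - k \<le> n then z (n + 1 + (i + j + 1 - k)) * f (?N + j) else 0) =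
      (\<Sum>j\<in>(+) (k - 1 - i) ` {..n}. z (n + 1 + (i + j + 1 - k)) * f (?N + j))"
  proof (intro sum.mono_neutral_cong_right ballI)
    show "(+) (k - 1 - i) ` {..n} \<subseteq> {..<?N}" using i by auto
    have "j \<in> (+) (k - 1 - i) ` {..n}" if "k \<le> i + j + 1" "i + j + 1 - k \<le> n" for j
      using that i by (intro image_eqI[of _ _ "i + j + 1 - k"]) auto
    then show "(if k \<le> i + j + 1 \<and> i + j + 1 - k \<le> n then z (n + 1 + (i + j + 1 - k)) * f (?N + j) else 0) = 0"
      if "j \<in> {..<?N} - (+) (k - 1 - i) ` {..n}" for j
      using that by auto
    show "(if k \<le> i + j + 1 \<and> i + j + 1 - k \<le> n then z (n + 1 + (i + j + 1 - k)) * f (?N + j) else 0) =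
        z (n + 1 + (i + j + 1 - k)) * f (?N + j)" if "j \<in> (+) (k - 1 - i) ` {..n}" for j
      using that i by auto
  qed simp
  also have "\<dots> = (\<Sum>l\<le>n. z (n + 1 + l) * f (?N + (k - 1 - i + l)))"
  proof -
    have "i + (k - 1 - i + l) + 1 - k = l" for l using i by simp
    then show ?thesis by (simp add: sum.reindex del: One_nat_def)
  qed
  also have "(\<Sum>j<?N. if j = 0 \<and> i = 0 then \<epsilon> * z (n + 2) * f (?N + j) else 0) =
      \<epsilon> * z (n + 2) * (if i = 0 then f ?N else 0)"
    using k by (cases "i = 0") auto
  also have "(\<Sum>j<?N. if j = ?N - 1 \<and> i = k - 1 then \<epsilon> * z (n + 2) * f (?N + j) else 0) =
      \<epsilon> * z (n + 2) * (if i = k - 1 then f (?N + (?N - 1)) else 0)"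
    using k by (cases "i = k - 1") auto
  finally show ?thesis by (simp add: distrib_left)
qed

text \<open>The entries of \<open>J A\<^sup>t\<close>.\<close>
definition rs_image :: "nat \<Rightarrow> nat \<Rightarrow> complex \<Rightarrow> (nat \<Rightarrow> complex) \<Rightarrow> nat \<Rightarrow> nat \<Rightarrow> complex" where
  "rs_image n k \<epsilon> z r i =
    (if r < n + k then rs_entry n k \<epsilon> z i (n + k + r) else - rs_entry n k \<epsilon> z i (r - (n + k)))"

text \<open>The identity A J A^t = 0 amounts to symmetry of F H^t, whose entries sum H along
  \<open>i + j + l\<close> because H depends only on the sum of its indices. The corners respect
  this symmetry.\<close>

lemma rs_entry_image:
  assumes "n \<ge> 1" "k \<ge> 2" "i < k" "j < k"
  shows "(\<Sum>r<2 * (n + k). rs_entry n k \<epsilon> z i r * rs_image n k \<epsilon> z r j) = 0"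
proof -
  let ?N = "n + k"
  have split: "(\<Sum>r<2 * ?N. g r) = (\<Sum>r<?N. g r) + (\<Sum>r<?N. g (?N + r))" for g :: "nat \<Rightarrow> complex"
    unfolding mult_2 by (rule sum_lessThan_add)
  have *: "(\<Sum>r<?N. rs_entry n k \<epsilon> z i r * g r) = (\<Sum>l\<le>n. z l * g (i + l))" if "i < k" for g i
  proof -
    have "(\<Sum>r<2 * ?N. rs_entry n k \<epsilon> z i r * (if r < ?N then g r else 0)) = (\<Sum>l\<le>n. z l * g (i + l))"
      using that by (subst rs_row_sum[OF assms(1,2) that]) (auto intro!: sum.cong)
    then show ?thesis unfolding split by simp
  qed
  have "(\<Sum>r<2 * ?N. rs_entry n k \<epsilon> z i r * rs_image n k \<epsilon> z r j) =
      (\<Sum>r<?N. rs_entry n k \<epsilon> z i r * rs_entry n k \<epsilon> z j (?N + r)) -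
      (\<Sum>r<?N. rs_entry n k \<epsilon> z j r * rs_entry n k \<epsilon> z i (?N + r))"
    unfolding split by (simp add: rs_image_def sum_negf mult.commute)
  also have "\<dots> = (\<Sum>l\<le>n. z l * rs_entry n k \<epsilon> z j (?N + (i + l))) - (\<Sum>l\<le>n. z l * rs_entry n k \<epsilon> z i (?N + (j + l)))"
    using assms by (simp add: *)
  also have "(\<Sum>l\<le>n. z l * rs_entry n k \<epsilon> z j (?N + (i + l))) = (\<Sum>l\<le>n. z l * rs_entry n k \<epsilon> z i (?N + (j + l)))"
  proof (intro sum.cong refl arg_cong2[where f = "(*)"])
    fix l assume "l \<in> {..n}"
    then have l: "i + l < ?N" "j + l < ?N" using assms(3,4) by auto
    have "j + (i + l) = i + (j + l)" by simp
    moreover have "(j, i + l) = (0, 0) \<longleftrightarrow> (i, j + l) = (0, 0)" by auto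
    \<comment> \<open>With \<open>i < k\<close> and \<open>l \<le> n\<close>, the sum
      \<open>i + l\<close> reaches \<open>n + k - 1\<close> only for \<open>i = k - 1\<close> and
      \<open>l = n\<close>, so both sides force \<open>i = j\<close>.\<close>
    moreover have "(j, i + l) = (k - 1, ?N - 1) \<longleftrightarrow> (i, j + l) = (k - 1, ?N - 1)"
      using assms(2-4) \<open>l \<in> {..n}\<close> by auto
    ultimately show "rs_entry n k \<epsilon> z j (?N + (i + l)) = rs_entry n k \<epsilon> z i (?N + (j + l))"
      unfolding rs_entry_H[OF assms(4) l(1) assms(1)] rs_entry_H[OF assms(3) l(2) assms(1)]
      by (simp only:)
  qed
  finally show ?thesis by simp
qed

text \<open>Here \<open>C r q\<close> is the coefficient of \<open>z q\<close> in entry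
  \<open>r\<close> of the syzygy. The assumption \<open>norm\<close> removes the freedom of adding
  constant combinations of the columns of J A^t.\<close>

lemma linear_syzygy_zero:
  fixes C :: "nat \<Rightarrow> nat \<Rightarrow> complex"
  assumes n: "n \<ge> 2" and k: "k \<ge> 3" and \<epsilon>: "\<epsilon> \<noteq> 0" "4 * (real n + 1) * cmod \<epsilon> < 1"
    and syz: "\<And>z i. i < k \<Longrightarrow>
      (\<Sum>r<2 * (n + k). rs_entry n k \<epsilon> z i r * (\<Sum>q<2 * n + 2. C r q * z q)) = 0"
    and norm: "\<And>i. i < k \<Longrightarrow> C (n + k + i) 0 = 0"
    and r: "r < 2 * (n + k)" and q: "q < 2 * n + 2"
  shows "C r q = 0"
proof -
  let ?N = "n + k"
  \<comment> \<open>\<open>G i\<close> is the coefficient matrix of the quadratic form that row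
    \<open>i\<close> of A produces from the syzygy; vanishing of this form means that
    \<open>G i\<close> is skew.\<close>
  define G where "G i p q = (if p \<le> n then C (i + p) q
    else C (?N + (k - 1 - i + (p - (n + 1)))) q +
      (if p = n + 2 then \<epsilon> * ((if i = 0 then C ?N q else 0) + (if i = k - 1 then C (?N + (?N - 1)) q else 0)) else 0))"
    for i p q
  have skew: "G i p q + G i q p = 0" if "i < k" "p < 2 * n + 2" "q < 2 * n + 2" for i p q
  proof (rule quadratic_form_zero[OF _ that(2,3)])
    fix z :: "nat \<Rightarrow> complex"
    let ?v = "\<lambda>r. \<Sum>q<2 * n + 2. C r q * z q"
    have split: "(\<Sum>p<2 * n + 2. g p) = (\<Sum>l\<le>n. g l) + (\<Sum>l\<le>n. g (n + 1 + l))"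
      for g :: "nat \<Rightarrow> complex"
      using sum_lessThan_add[of g "Suc n" "Suc n"] unfolding lessThan_Suc_atMost
      by (simp add: mult_2)
    have sum_perturbed:
      "(\<Sum>q\<in>Q. (a q + (if P then \<epsilon> * ((if P1 then b q else 0) + (if P2 then c q else 0)) else 0)) * z q) =
       (\<Sum>q\<in>Q. a q * z q) + (if P then \<epsilon> * ((if P1 then \<Sum>q\<in>Q. b q * z q else 0) +
         (if P2 then \<Sum>q\<in>Q. c q * z q else 0)) else 0)"
      for a P P1 b P2 c and Q :: "nat set"
      by (cases P; cases P1; cases P2)
        (simp_all add: distrib_right distrib_left sum.distrib sum_distrib_left mult.assoc)
    have "(\<Sum>p<2 * n + 2. z p * (\<Sum>q<2 * n + 2. G i p q * z q)) =
        (\<Sum>l\<le>n. z l * (\<Sum>q<2 * n + 2. G i l q * z q)) +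
        (\<Sum>l\<le>n. z (n + 1 + l) * (\<Sum>q<2 * n + 2. G i (n + 1 + l) q * z q))"
      by (rule split)
    also have "(\<Sum>l\<le>n. z l * (\<Sum>q<2 * n + 2. G i l q * z q)) = (\<Sum>l\<le>n. z l * ?v (i + l))"
      by (intro sum.cong) (auto simp: G_def)
    also have "(\<Sum>l\<le>n. z (n + 1 + l) * (\<Sum>q<2 * n + 2. G i (n + 1 + l) q * z q)) =
        (\<Sum>l\<le>n. z (n + 1 + l) * ?v (?N + (k - 1 - i + l))) +
        (\<Sum>l\<le>n. if l = 1 then \<epsilon> * z (n + 2) *
          ((if i = 0 then ?v ?N else 0) + (if i = k - 1 then ?v (?N + (?N - 1)) else 0)) else 0)"
      unfolding sum.distrib[symmetric]
    proof (intro sum.cong refl)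
      fix l
      have G_eq: "G i (n + 1 + l) q = C (?N + (k - 1 - i + l)) q +
          (if l = 1 then \<epsilon> * ((if i = 0 then C ?N q else 0) + (if i = k - 1 then C (?N + (?N - 1)) q else 0)) else 0)" for q
        by (simp add: G_def)
      have "(\<Sum>q<2 * n + 2. G i (n + 1 + l) q * z q) = ?v (?N + (k - 1 - i + l)) +
          (if l = 1 then \<epsilon> * ((if i = 0 then ?v ?N else 0) + (if i = k - 1 then ?v (?N + (?N - 1)) else 0)) else 0)"
        unfolding G_eq by (rule sum_perturbed)
      then show "z (n + 1 + l) * (\<Sum>q<2 * n + 2. G i (n + 1 + l) q * z q) =
          z (n + 1 + l) * ?v (?N + (k - 1 - i + l)) +
          (if l = 1 then \<epsilon> * z (n + 2) *
            ((if i = 0 then ?v ?N else 0) + (if i = k - 1 then ?v (?N + (?N - 1)) else 0)) else 0)"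
        by (simp add: distrib_left mult_ac)
    qed
    also have "(\<Sum>l\<le>n. if l = 1 then \<epsilon> * z (n + 2) *
          ((if i = 0 then ?v ?N else 0) + (if i = k - 1 then ?v (?N + (?N - 1)) else 0)) else 0) =
        \<epsilon> * z (n + 2) * ((if i = 0 then ?v ?N else 0) + (if i = k - 1 then ?v (?N + (?N - 1)) else 0))"
      using n by simp
    also have "(\<Sum>l\<le>n. z l * ?v (i + l)) + ((\<Sum>l\<le>n. z (n + 1 + l) * ?v (?N + (k - 1 - i + l))) +
        \<epsilon> * z (n + 2) * ((if i = 0 then ?v ?N else 0) + (if i = k - 1 then ?v (?N + (?N - 1)) else 0))) =
        (\<Sum>r<2 * ?N. rs_entry n k \<epsilon> z i r * ?v r)"
    proof -
      have "n \<ge> 1" "k \<ge> 2" using n k by auto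
      then show ?thesis
        by (subst rs_row_sum[OF _ _ that(1)]) (simp_all only: add.assoc[symmetric])
    qed
    also have "\<dots> = 0" by (rule syz[OF that(1)])
    finally show "(\<Sum>p<2 * n + 2. z p * (\<Sum>q<2 * n + 2. G i p q * z q)) = 0" .
  qed
  \<comment> \<open>\<open>U\<close> and \<open>W\<close> are the mixed coefficients: those of y in
    the half paired with F, and those of x in the half paired with H.\<close>
  define U where "U j b = C j (n + 1 + b)" for j b
  define W where "W j a = C (?N + j) a" for j a
  have U0: "C j a = 0" if "j < ?N" "a \<le> n" for j a
  proof -
    \<comment> \<open>The xx relations contain no corner terms, so the estimate applies with error
      zero.\<close>
    have "cmod (C j a) \<le> (real n + 1) * 0"
    proof (rule skew_band_bound[of k n C 0])
      fix i l a assume "i < k" "l \<le> n" "a \<le> n"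
      then show "cmod (C (i + l) a + C (i + a) l) \<le> 0"
        using skew[of i l a] by (simp add: G_def)
    qed (use k that in auto)
    then show ?thesis by simp
  qed
  have W'0: "C (?N + j) (n + 1 + b) = 0" if "j < ?N" "b \<le> n" for j b
  proof (rule skew_band_perturbed_zero[of k n \<epsilon> "\<lambda>j b. C (?N + j) (n + 1 + b)", OF _ \<epsilon>(2) _ that])
    fix i l b assume "i < k" "l \<le> n" "b \<le> n"
    then show "C (?N + (k - 1 - i + l)) (n + 1 + b) + C (?N + (k - 1 - i + b)) (n + 1 + l) +
      \<epsilon> * ((if l = 1 then (if i = 0 then C (?N + 0) (n + 1 + b) else 0) + (if i = k - 1 then C (?N + (n + k - 1)) (n + 1 + b) else 0) else 0) +
           (if b = 1 then (if i = 0 then C (?N + 0) (n + 1 + l) else 0) + (if i = k - 1 then C (?N + (n + k - 1)) (n + 1 + l) else 0) else 0)) = 0"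
      using skew[of i "n + 1 + l" "n + 1 + b"] k by (auto simp: G_def algebra_simps)
  qed (use k in auto)
  have mixed: "U (i + l) b + W (k - 1 - i + b) l +
      (if b = 1 then \<epsilon> * ((if i = 0 then W 0 l else 0) + (if i = k - 1 then W (n + k - 1) l else 0)) else 0) = 0"
    if "i < k" "l \<le> n" "b \<le> n" for i l b
    using skew[of i l "n + 1 + b"] that k by (auto simp: G_def U_def W_def algebra_simps)
  have W0: "W j 0 = 0" if "j < k" for j using norm[OF that] by (simp add: W_def)
  note mixed_zero = mixed_band_zero[of n k \<epsilon> U W, OF n k \<epsilon>(1) mixed W0]
  show ?thesis
  proof (cases "r < ?N"; cases "q \<le> n")
    assume "r < ?N" "q \<le> n" then show ?thesis by (rule U0)
  next
    assume "r < ?N" "\<not> q \<le> n"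
    then show ?thesis using mixed_zero(2)[of r "q - (n + 1)"] q by (simp add: U_def)
  next
    assume "\<not> r < ?N" "q \<le> n"
    then show ?thesis using mixed_zero(1)[of "r - ?N" q] r by (simp add: W_def)
  next
    assume "\<not> r < ?N" "\<not> q \<le> n"
    then show ?thesis using W'0[of "r - ?N" "q - (n + 1)"] r q by simp
  qed
qed


lemma homogeneous_linear_polyfun:
  assumes f: "f \<in> polyfun m" and hom: "\<And>z t. f (\<lambda>l. t * z l) = t * f z"
  shows "f z = (\<Sum>q<m. f (\<lambda>l. if l = q then 1 else 0) * z q)"
proof -
  have "is_form m 1 (\<lambda>p. f (\<lambda>l. if l < m then p $ l else 0))"
  proof -
    have *: "f (\<lambda>l. if l < m then vec m z $ l else 0) = f z" for z
      by (rule polyfun_cong_coords[OF f]) simp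
    have "f (\<lambda>l. if l < m then vec m (\<lambda>l. t * z l) $ l else 0) = t * f z" for t z
      unfolding * by (rule hom)
    then show ?thesis unfolding is_form_iff_polyfun using * f by simp
  qed
  then obtain c where c: "\<And>p. p \<in> carrier_vec m \<Longrightarrow> f (\<lambda>l. if l < m then p $ l else 0) =
      (\<Sum>a\<in>exponents m 1. c a * (\<Prod>i<m. (p $ i) ^ a i))"
    unfolding is_form_def by blast
  let ?u = "\<lambda>q l. if l = q then 1 else (0::nat)"
  have exps: "exponents m 1 = ?u ` {..<m}"
  proof (intro equalityI subsetI)
    fix a assume "a \<in> exponents m 1"
    then have a: "\<And>i. i \<ge> m \<Longrightarrow> a i = 0" "(\<Sum>i<m. a i) = 1" by (auto simp: exponents_def)
    then obtain q where q: "q < m" "a q \<noteq> 0" by (metis lessThan_iff sum.neutral zero_neq_one)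
    then have "(\<Sum>i<m. a i) = a q + (\<Sum>i\<in>{..<m} - {q}. a i)" by (intro sum.remove) auto
    with a(2) q have aq: "a q = 1" "(\<Sum>i\<in>{..<m} - {q}. a i) = 0" by linarith+
    have "a i = 0" if "i \<noteq> q" for i
      using a(1)[of i] aq(2) that by (cases "i < m") (auto simp: sum_eq_0_iff)
    then have "a = ?u q" using aq(1) by (auto simp: fun_eq_iff)
    then show "a \<in> ?u ` {..<m}" using q by auto
  qed (auto simp: exponents_def)
  have expand: "f z = (\<Sum>q<m. c (?u q) * z q)" for z
  proof -
    have "f z = f (\<lambda>l. if l < m then vec m z $ l else 0)"
      by (rule polyfun_cong_coords[OF f]) simp
    also have "\<dots> = (\<Sum>a\<in>exponents m 1. c a * (\<Prod>i<m. z i ^ a i))" by (subst c) auto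
    also have "\<dots> = (\<Sum>q<m. c (?u q) * (\<Prod>i<m. z i ^ ?u q i))"
      unfolding exps by (subst sum.reindex) (auto simp: inj_on_def fun_eq_iff split: if_splits)
    also have "\<dots> = (\<Sum>q<m. c (?u q) * z q)"
      by (intro sum.cong refl arg_cong2[where f = "(*)"])
        (simp add: if_distrib[of "\<lambda>e. _ ^ e"] cong: if_cong)
    finally show ?thesis .
  qed
  have "f (\<lambda>l. if l = q then 1 else 0) = c (?u q)" if "q < m" for q
    unfolding expand using that by (simp add: if_distrib cong: if_cong)
  then show ?thesis unfolding expand[of z] by simp
qed

lemma rs_entry_polyfun:
  assumes "n \<ge> 1" "i < k" "r < 2 * (n + k)"
  shows "(\<lambda>z. rs_entry n k \<epsilon> z i r) \<in> polyfun (2 * n + 2)"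
proof (cases "r < n + k")
  case True
  show ?thesis
    unfolding rs_entry_F[OF assms(2) True]
    by (cases "i \<le> r \<and> r - i \<le> n") (auto intro: polyfun_const polyfun_coord)
next
  case False
  define j where "j = r - (n + k)"
  have r: "r = n + k + j" and j: "j < n + k" using False assms by (auto simp: j_def)
  show ?thesis
    unfolding r rs_entry_H[OF assms(2) j assms(1)]
    using assms(1)
    by (cases "(i, j) = (0, 0) \<or> (i, j) = (k - 1, n + k - 1)";
        cases "k \<le> i + j + 1 \<and> i + j + 1 - k \<le> n")
      (auto intro!: polyfun_const polyfun_coord polyfun_mult)
qed

lemma rs_entry_hom:
  assumes "n \<ge> 1" "i < k" "r < 2 * (n + k)"
  shows "rs_entry n k \<epsilon> (\<lambda>l. t * z l) i r = t * rs_entry n k \<epsilon> z i r"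
proof (cases "r < n + k")
  case True
  then show ?thesis using assms by (auto simp: rs_entry_F)
next
  case False
  then have "r = n + k + (r - (n + k))" "r - (n + k) < n + k" using assms by auto
  then show ?thesis
    using rs_entry_H[OF assms(2) _ assms(1), of "r - (n + k)"] assms by auto
qed

lemma rs_image_polyfun:
  "n \<ge> 1 \<Longrightarrow> i < k \<Longrightarrow> r < 2 * (n + k) \<Longrightarrow> (\<lambda>z. rs_image n k \<epsilon> z r i) \<in> polyfun (2 * n + 2)"
  unfolding rs_image_def
  by (cases "r < n + k")
    (simp_all del: add_2_eq_Suc' add: polyfun_minus rs_entry_polyfun)

lemma rs_image_hom:
  "n \<ge> 1 \<Longrightarrow> i < k \<Longrightarrow> r < 2 * (n + k) \<Longrightarrow>
    rs_image n k \<epsilon> (\<lambda>l. t * z l) r i = t * rs_image n k \<epsilon> z r i"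
  unfolding rs_image_def by (auto simp: rs_entry_hom)

theorem linear_syzygy_in_image:
  assumes n: "n \<ge> 2" and k: "k \<ge> 3" and \<epsilon>: "\<epsilon> \<noteq> 0" "4 * (real n + 1) * cmod \<epsilon> < 1"
    and v: "\<And>r. r < 2 * (n + k) \<Longrightarrow> v r \<in> polyfun (2 * n + 2)"
      "\<And>r z t. r < 2 * (n + k) \<Longrightarrow> v r (\<lambda>l. t * z l) = t * v r z"
    and syz: "\<And>z i. i < k \<Longrightarrow> (\<Sum>r<2 * (n + k). rs_entry n k \<epsilon> z i r * v r z) = 0"
  shows "\<exists>c. \<forall>r<2 * (n + k). \<forall>z. v r z = (\<Sum>i<k. rs_image n k \<epsilon> z r i * c i)"
proof -
  let ?e = "\<lambda>q l. if l = q then 1 else (0::complex)"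
  \<comment> \<open>At the point with x_0 = 1 and all other coordinates zero, the first
    \<open>k\<close> columns of F form the identity, and J A^t contains their negatives. Hence this
    \<open>c\<close> achieves the normalization.\<close>
  define c where "c i = - v (n + k + i) (?e 0)" for i
  define w where "w r z = v r z - (\<Sum>i<k. rs_image n k \<epsilon> z r i * c i)" for r z
  have w: "w r \<in> polyfun (2 * n + 2)" if "r < 2 * (n + k)" for r
    unfolding w_def[abs_def] by (intro polyfun_intros rs_image_polyfun v) (use n that in auto)
  have w_hom: "w r (\<lambda>l. t * z l) = t * w r z" if "r < 2 * (n + k)" for r t z
    unfolding w_def using that n v(2)[OF that]
    by (simp add: rs_image_hom right_diff_distrib sum_distrib_left mult.assoc)
  have w_linear: "w r z = (\<Sum>q<2 * n + 2. w r (?e q) * z q)" if "r < 2 * (n + k)" for r z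
    by (rule homogeneous_linear_polyfun[OF w[OF that] w_hom[OF that]])
  have "w r (?e q) = 0" if "r < 2 * (n + k)" "q < 2 * n + 2" for r q
  proof (rule linear_syzygy_zero[OF n k \<epsilon>])
    fix z i assume i: "i < k"
    have "(\<Sum>r<2 * (n + k). rs_entry n k \<epsilon> z i r * (\<Sum>q<2 * n + 2. w r (?e q) * z q)) =
        (\<Sum>r<2 * (n + k). rs_entry n k \<epsilon> z i r * w r z)"
      by (intro sum.cong refl arg_cong2[where f = "(*)"] w_linear[symmetric]) simp
    also have "\<dots> = (\<Sum>r<2 * (n + k). rs_entry n k \<epsilon> z i r * v r z) -
        (\<Sum>r<2 * (n + k). \<Sum>j<k. rs_entry n k \<epsilon> z i r * rs_image n k \<epsilon> z r j * c j)"
      unfolding w_def right_diff_distrib sum_subtractf sum_distrib_left mult.assoc ..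
    also have "(\<Sum>r<2 * (n + k). \<Sum>j<k. rs_entry n k \<epsilon> z i r * rs_image n k \<epsilon> z r j * c j) =
        (\<Sum>j<k. (\<Sum>r<2 * (n + k). rs_entry n k \<epsilon> z i r * rs_image n k \<epsilon> z r j) * c j)"
      by (subst sum.swap) (simp only: sum_distrib_right)
    also have "\<dots> = 0"
    proof (intro sum.neutral ballI)
      fix j assume "j \<in> {..<k}"
      then have "(\<Sum>r<2 * (n + k). rs_entry n k \<epsilon> z i r * rs_image n k \<epsilon> z r j) = 0"
        using n k i by (intro rs_entry_image) auto
      then show "(\<Sum>r<2 * (n + k). rs_entry n k \<epsilon> z i r * rs_image n k \<epsilon> z r j) * c j = 0"
        by (simp only: mult_zero_left)
    qed
    finally show "(\<Sum>r<2 * (n + k). rs_entry n k \<epsilon> z i r * (\<Sum>q<2 * n + 2. w r (?e q) * z q)) = 0"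
      using syz[OF i] by simp
  next
    fix i assume i: "i < k"
    have "(\<Sum>j<k. rs_image n k \<epsilon> (?e 0) (n + k + i) j * c j) = (\<Sum>j<k. if j = i then - c j else 0)"
      using i by (intro sum.cong) (auto simp: rs_image_def rs_entry_F)
    then show "w (n + k + i) (?e 0) = 0" using i by (simp add: w_def c_def)
  qed (use that in auto)
  then have "w r z = 0" if "r < 2 * (n + k)" for r z
    by (subst w_linear[OF that]) (use that in \<open>intro sum.neutral; auto\<close>)
  then show ?thesis by (intro exI[of _ c]) (auto simp: w_def)
qed

section \<open>Independence of the rows and charts\<close>

text \<open>By Vieta, up to sign and leading coefficient, the constant term is the product of all
  roots and the linear coefficient is the sum of the \<open>degree p\<close> products that omit one
  root. The induction splits off one root at a time.\<close>

lemma roots_on_circle_coeffs: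
  fixes p :: "complex poly"
  assumes "p \<noteq> 0" "\<And>t. poly p t = 0 \<Longrightarrow> cmod t = r"
  shows "cmod (coeff p 0) = cmod (lead_coeff p) * r ^ degree p"
    and "r = 1 \<Longrightarrow> cmod (coeff p 1) \<le> degree p * cmod (lead_coeff p)"
proof -
  have "cmod (coeff p 0) = cmod (lead_coeff p) * r ^ degree p \<and>
    (r = 1 \<longrightarrow> cmod (coeff p 1) \<le> degree p * cmod (lead_coeff p))"
    using assms
  proof (induction "degree p" arbitrary: p)
    case 0
    then show ?case by (simp add: coeff_eq_0)
  next
    case (Suc d)
    then obtain a where a: "poly p a = 0"
      using fundamental_theorem_of_algebra[of p] by (auto simp: constant_degree)
    then obtain q where q: "p = [:- a, 1:] * q" by (auto simp: poly_eq_0_iff_dvd elim: dvdE)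
    have "q \<noteq> 0" using Suc.prems(1) q by auto
    have deg: "degree p = Suc (degree q)"
      unfolding q using \<open>q \<noteq> 0\<close> by (subst degree_mult_eq) auto
    have lead: "lead_coeff p = lead_coeff q" unfolding q lead_coeff_mult by simp
    have "cmod a = r" using Suc.prems(2) a by blast
    have roots: "cmod t = r" if "poly q t = 0" for t using Suc.prems(2)[of t] that q by simp
    have IH: "cmod (coeff q 0) = cmod (lead_coeff q) * r ^ degree q"
      "r = 1 \<Longrightarrow> cmod (coeff q 1) \<le> degree q * cmod (lead_coeff q)"
      using Suc.hyps(1)[of q] Suc.hyps(2) deg \<open>q \<noteq> 0\<close> roots by auto
    have c0: "coeff p 0 = - a * coeff q 0" and c1: "coeff p 1 = coeff q 0 - a * coeff q 1"
      unfolding q by simp_all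
    have "cmod (coeff p 0) = cmod (lead_coeff q) * r ^ Suc (degree q)"
      unfolding c0 norm_mult norm_minus_cancel IH(1) \<open>cmod a = r\<close> by simp
    then have "cmod (coeff p 0) = cmod (lead_coeff p) * r ^ degree p"
      unfolding lead unfolding deg .
    moreover have "cmod (coeff p 1) \<le> degree p * cmod (lead_coeff p)" if "r = 1"
    proof -
      have "cmod (coeff p 1) \<le> cmod (coeff q 0) + cmod (coeff q 1)"
        unfolding c1 using norm_triangle_ineq4[of "coeff q 0" "a * coeff q 1"]
        by (simp add: norm_mult \<open>cmod a = r\<close> that)
      then show ?thesis using IH that unfolding lead unfolding deg by (simp add: algebra_simps)
    qed
    ultimately show ?case by blast
  qed
  then show "cmod (coeff p 0) = cmod (lead_coeff p) * r ^ degree p"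
    and "r = 1 \<Longrightarrow> cmod (coeff p 1) \<le> degree p * cmod (lead_coeff p)" by auto
qed

text \<open>All roots of \<open>B Y\<close> lie on one circle; comparing the constant and leading
  coefficients of \<open>B\<close> shows that it is the unit circle.\<close>
lemma perturbed_product_zero:
  fixes B Y :: "complex poly"
  assumes n: "n \<ge> 1" and k: "k \<ge> 2" and small: "real n * cmod \<epsilon> < 1"
    and deg: "degree B \<le> k - 1" "degree Y \<le> n" and "Y \<noteq> 0"
    and eq: "B * Y = - smult (\<epsilon> * coeff Y 1) ([:coeff B (k - 1):] + monom (coeff B 0) (n + k - 1))"
  shows "B = 0"
proof (rule ccontr)
  assume "B \<noteq> 0"
  define e where "e = \<epsilon> * coeff Y 1"
  define \<alpha> where "\<alpha> = coeff B 0"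
  define \<beta> where "\<beta> = coeff B (k - 1)"
  have eq: "B * Y = - smult e ([:\<beta>:] + monom \<alpha> (n + k - 1))"
    using eq by (simp add: e_def \<alpha>_def \<beta>_def)
  have "B * Y \<noteq> 0" using \<open>B \<noteq> 0\<close> \<open>Y \<noteq> 0\<close> by simp
  then have "e \<noteq> 0" using eq by auto
  then have "coeff Y 1 \<noteq> 0" by (auto simp: e_def)
  then have "degree Y \<ge> 1" by (rule le_degree)
  have degBY: "degree (B * Y) = degree B + degree Y" using \<open>B \<noteq> 0\<close> \<open>Y \<noteq> 0\<close> by (rule degree_mult_eq)
  have "\<alpha> \<noteq> 0"
  proof
    assume "\<alpha> = 0"
    then have "degree (B * Y) = 0" unfolding eq by simp
    then show False using degBY \<open>degree Y \<ge> 1\<close> by simp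
  qed
  have top: "coeff (B * Y) (n + k - 1) = - (e * \<alpha>)"
    unfolding eq using n k by (simp add: coeff_pCons split: nat.split)
  then have "n + k - 1 \<le> degree (B * Y)" using \<open>e \<noteq> 0\<close> \<open>\<alpha> \<noteq> 0\<close> by (intro le_degree) simp
  then have degs: "degree B = k - 1" "degree Y = n" using deg degBY k by auto
  have lead: "lead_coeff B = \<beta>" by (simp add: degs \<beta>_def)
  then have "\<beta> \<noteq> 0" using \<open>B \<noteq> 0\<close> by auto
  define r where "r = root (n + k - 1) (cmod \<beta> / cmod \<alpha>)"
  have r: "r > 0" "r ^ (n + k - 1) = cmod \<beta> / cmod \<alpha>"
  proof -
    have "n + k - 1 > 0" "cmod \<beta> / cmod \<alpha> > 0" using \<open>\<alpha> \<noteq> 0\<close> \<open>\<beta> \<noteq> 0\<close> n k by auto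
    then show "r > 0" "r ^ (n + k - 1) = cmod \<beta> / cmod \<alpha>"
      unfolding r_def by (rule real_root_gt_zero, intro real_root_pow_pos)
  qed
  have root: "cmod t = r" if "poly (B * Y) t = 0" for t
  proof -
    have "\<beta> + \<alpha> * t ^ (n + k - 1) = 0" using that \<open>e \<noteq> 0\<close> unfolding eq by (simp add: poly_monom)
    then have "\<alpha> * t ^ (n + k - 1) = - \<beta>" by (simp add: add_eq_0_iff add.commute)
    then have "cmod \<alpha> * cmod t ^ (n + k - 1) = cmod \<beta>"
      by (metis norm_minus_cancel norm_mult norm_power)
    then have "cmod t ^ (n + k - 1) = r ^ (n + k - 1)" unfolding r using \<open>\<alpha> \<noteq> 0\<close> by (simp add: field_simps)
    moreover have "n + k - 1 > 0" using n k by simp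
    ultimately show ?thesis using r(1) power_eq_iff_eq_base[of "n + k - 1" "cmod t" r] by simp
  qed
  \<comment> \<open>The roots of \<open>B\<close> alone relate \<alpha> and \<beta> through
    \<open>r ^ (k - 1)\<close>, those of \<open>B * Y\<close> in the opposite direction through
    \<open>r ^ (n + k - 1)\<close>. Together they force a power of \<open>r\<close> to be 1.\<close>
  have "cmod \<alpha> = cmod \<beta> * r ^ (k - 1)"
    using roots_on_circle_coeffs(1)[OF \<open>B \<noteq> 0\<close>, of r] root lead degs by (simp add: \<alpha>_def)
  also have "cmod \<beta> = r ^ (n + k - 1) * cmod \<alpha>" using r(2) \<open>\<alpha> \<noteq> 0\<close> by (simp add: field_simps)
  finally have "r ^ (n + k - 1) * r ^ (k - 1) = 1" using \<open>\<alpha> \<noteq> 0\<close> by simp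
  then have "r ^ (n + k - 1 + (k - 1)) = 1" by (simp add: power_add)
  then have "r ^ (n + k - 1 + (k - 1)) = 1 ^ (n + k - 1 + (k - 1))" by simp
  moreover have "n + k - 1 + (k - 1) > 0" using n k by simp
  ultimately have "r = 1"
    using r(1) power_eq_iff_eq_base[of "n + k - 1 + (k - 1)" r 1] by (simp only: order.strict_implies_order zero_le_one)
  then have "cmod \<alpha> = cmod \<beta>" using r(2) \<open>\<alpha> \<noteq> 0\<close> by simp
  \<comment> \<open>On the unit circle the linear coefficient of \<open>Y\<close> is at most
    \<open>n\<close> times the leading one, whereas the top coefficient of \<open>B * Y\<close>
    makes the leading one only \<open>cmod \<epsilon>\<close> times the linear one. For
    \<open>n * cmod \<epsilon> < 1\<close> both vanish.\<close>
  have Y1: "cmod (coeff Y 1) \<le> n * cmod (coeff Y n)"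
    using roots_on_circle_coeffs(2)[OF \<open>Y \<noteq> 0\<close>, of r] root \<open>r = 1\<close> degs by auto
  have "coeff (B * Y) (n + k - 1) = \<beta> * coeff Y n"
    using lead_coeff_mult[of B Y] degBY degs lead k by (simp add: add.commute)
  then have "cmod \<beta> * cmod (coeff Y n) = cmod e * cmod \<alpha>"
    using top by (metis norm_minus_cancel norm_mult)
  then have "cmod (coeff Y n) = cmod \<epsilon> * cmod (coeff Y 1)"
    using \<open>cmod \<alpha> = cmod \<beta>\<close> \<open>\<beta> \<noteq> 0\<close> by (simp add: e_def norm_mult)
  also have "\<dots> \<le> cmod \<epsilon> * (n * cmod (coeff Y n))" by (intro mult_left_mono Y1) auto
  finally have "cmod (coeff Y n) * (1 - n * cmod \<epsilon>) \<le> 0" by (simp add: algebra_simps)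
  then have "cmod (coeff Y n) \<le> 0" using small by (simp add: mult_le_0_iff)
  then show False using \<open>Y \<noteq> 0\<close> degs leading_coeff_0_iff[of Y] by simp
qed

text \<open>Multiplying a row vector by a Toeplitz band matrix is multiplication of
  polynomials.\<close>

lemma coeff_product_window:
  fixes b x :: "nat \<Rightarrow> complex"
  shows "coeff ((\<Sum>i<k. monom (b i) i) * (\<Sum>l\<le>n. monom (x l) l)) j =
    (\<Sum>i<k. b i * (if i \<le> j \<and> j - i \<le> n then x (j - i) else 0))"
proof -
  have "coeff ((\<Sum>i<k. monom (b i) i) * (\<Sum>l\<le>n. monom (x l) l)) j =
      (\<Sum>i\<le>j. (if i < k then b i else 0) * (if j - i \<le> n then x (j - i) else 0))"
    by (simp add: coeff_mult coeff_sum)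
  also have "\<dots> = (\<Sum>i\<in>{..j} \<inter> {..<k}. b i * (if i \<le> j \<and> j - i \<le> n then x (j - i) else 0))"
    by (intro sum.mono_neutral_cong_right) auto
  also have "\<dots> = (\<Sum>i<k. b i * (if i \<le> j \<and> j - i \<le> n then x (j - i) else 0))"
    by (intro sum.mono_neutral_cong_left) auto
  finally show ?thesis .
qed

text \<open>A linear relation among the rows of F is a polynomial equation \<open>B * X = 0\<close>,
  impossible for nonzero \<open>B\<close> and \<open>X\<close>. Only on the linear space where all
  x_i vanish does H matter; there the relation becomes \<open>B' * Y\<close> equal to the corner
  terms, which \<open>perturbed_product_zero\<close> excludes.\<close>

lemma rs_rows_independent:
  assumes n: "n \<ge> 1" and k: "k \<ge> 3" and small: "real n * cmod \<epsilon> < 1"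
    and z: "\<exists>l<2 * n + 2. z l \<noteq> 0"
    and dep: "\<And>r. r < 2 * (n + k) \<Longrightarrow> (\<Sum>i<k. b i * rs_entry n k \<epsilon> z i r) = 0" and i: "i < k"
  shows "b i = 0"
proof -
  define X where "X = (\<Sum>l\<le>n. monom (z l) l)"
  define Y where "Y = (\<Sum>l\<le>n. monom (z (n + 1 + l)) l)"
  define B where "B = (\<Sum>i<k. monom (b i) i)"
  \<comment> \<open>Reversing the rows turns the backward band of H into a Toeplitz band.\<close>
  define B' where "B' = (\<Sum>i<k. monom (b (k - 1 - i)) i)"
  have coeffs: "coeff X l = (if l \<le> n then z l else 0)" "coeff Y l = (if l \<le> n then z (n + 1 + l) else 0)"
    "coeff B l = (if l < k then b l else 0)" "coeff B' l = (if l < k then b (k - 1 - l) else 0)" for l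
    by (auto simp: X_def Y_def B_def B'_def coeff_sum)
  have degs: "degree B \<le> k - 1" "degree B' \<le> k - 1" "degree X \<le> n" "degree Y \<le> n"
    by (auto intro!: degree_le simp: coeffs)
  show ?thesis
  proof (cases "X = 0")
    case False
    have "coeff (B * X) j = 0" for j
    proof (cases "j < n + k")
      case True
      then have "coeff (B * X) j = (\<Sum>i<k. b i * rs_entry n k \<epsilon> z i j)"
        unfolding B_def X_def coeff_product_window by (intro sum.cong) (auto simp: rs_entry_F)
      moreover have "j < 2 * (n + k)" using True by simp
      ultimately show ?thesis using dep[of j] by simp
    next
      case False
      then have "degree (B * X) < j" using degree_mult_le[of B X] degs k by linarith
      then show ?thesis by (rule coeff_eq_0)
    qed
    then have "B * X = 0" by (simp add: poly_eq_iff)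
    then have "B = 0" using False by simp
    then show ?thesis using coeffs(3)[of i] i by simp
  next
    case True
    have "z l = 0" if "l \<le> n" for l using coeffs(1)[of l] True that by simp
    then obtain l where "n < l" "l < 2 * n + 2" "z l \<noteq> 0" using z not_le by blast
    then have "coeff Y (l - (n + 1)) \<noteq> 0" by (auto simp: coeffs)
    then have "Y \<noteq> 0" by auto
    have "B' * Y = - smult (\<epsilon> * coeff Y 1) ([:coeff B' (k - 1):] + monom (coeff B' 0) (n + k - 1))"
    proof (rule poly_eqI)
      fix j
      show "coeff (B' * Y) j =
        coeff (- smult (\<epsilon> * coeff Y 1) ([:coeff B' (k - 1):] + monom (coeff B' 0) (n + k - 1))) j"
      proof (cases "j < n + k")
        case False
        then have "degree (B' * Y) < j" using degree_mult_le[of B' Y] degs k by linarith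
        then show ?thesis using False by (simp add: coeff_eq_0 coeff_pCons split: nat.split)
      next
        case True
        have "0 = (\<Sum>i<k. b i * rs_entry n k \<epsilon> z i (n + k + j))" using dep[of "n + k + j"] True by simp
        also have "\<dots> = (\<Sum>i<k. b i * (if k - 1 - i \<le> j \<and> j - (k - 1 - i) \<le> n then z (n + 1 + (j - (k - 1 - i))) else 0)) +
            ((\<Sum>i<k. if i = 0 then (if j = 0 then b i * \<epsilon> * z (n + 2) else 0) else 0) +
             (\<Sum>i<k. if i = k - 1 then (if j = n + k - 1 then b i * \<epsilon> * z (n + 2) else 0) else 0))"
          unfolding sum.distrib[symmetric]
        proof (intro sum.cong refl)
          fix i assume "i \<in> {..<k}"
          then have i: "i < k" by simp
          have "k - 1 - i \<le> j \<longleftrightarrow> k \<le> i + j + 1" "j - (k - 1 - i) = i + j + 1 - k" using i by auto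
          then show "b i * rs_entry n k \<epsilon> z i (n + k + j) =
            b i * (if k - 1 - i \<le> j \<and> j - (k - 1 - i) \<le> n then z (n + 1 + (j - (k - 1 - i))) else 0) +
            ((if i = 0 then if j = 0 then b i * \<epsilon> * z (n + 2) else 0 else 0) +
             (if i = k - 1 then if j = n + k - 1 then b i * \<epsilon> * z (n + 2) else 0 else 0))"
            using i n k unfolding rs_entry_H[OF i True n] by auto
        qed
        also have "(\<Sum>i<k. b i * (if k - 1 - i \<le> j \<and> j - (k - 1 - i) \<le> n then z (n + 1 + (j - (k - 1 - i))) else 0)) =
            coeff (B' * Y) j"
          unfolding B'_def Y_def coeff_product_window
        proof (subst sum.nat_diff_reindex[symmetric], intro sum.cong refl)
          fix x assume "x \<in> {..<k}"
          then have "k - 1 - (k - Suc x) = x" by auto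
          then show "b (k - Suc x) * (if k - 1 - (k - Suc x) \<le> j \<and> j - (k - 1 - (k - Suc x)) \<le> n
              then z (n + 1 + (j - (k - 1 - (k - Suc x)))) else 0) =
            b (k - 1 - x) * (if x \<le> j \<and> j - x \<le> n then z (n + 1 + (j - x)) else 0)"
            by simp
        qed
        finally show ?thesis
          using k n i by (auto simp: coeffs coeff_pCons eq_neg_iff_add_eq_0 mult_ac split: nat.split)
      qed
    qed
    then have "B' = 0"
      using n k by (intro perturbed_product_zero[OF n _ small degs(2,4) \<open>Y \<noteq> 0\<close>]) auto
    then show ?thesis using coeffs(4)[of "k - 1 - i"] i by simp
  qed
qed


section \<open>Charts defined by determinants\<close>

lemma det_polyfun:
  assumes "\<And>z. M z \<in> carrier_mat d d" "\<And>i j. i < d \<Longrightarrow> j < d \<Longrightarrow> (\<lambda>z. M z $$ (i, j)) \<in> polyfun m"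
  shows "(\<lambda>z. det (M z)) \<in> polyfun m"
  unfolding det_def'[OF assms(1)]
  by (intro polyfun_intros assms(2)) (auto dest: permutes_in_image)

lemma adj_mat_polyfun:
  assumes M: "\<And>z. M z \<in> carrier_mat d d" "\<And>i j. i < d \<Longrightarrow> j < d \<Longrightarrow> (\<lambda>z. M z $$ (i, j)) \<in> polyfun m"
    and ij: "i < d" "j < d"
  shows "(\<lambda>z. adj_mat (M z) $$ (i, j)) \<in> polyfun m"
proof -
  have "(\<lambda>z. det (mat_delete (M z) j i)) \<in> polyfun m"
  proof (rule det_polyfun)
    show "mat_delete (M z) j i \<in> carrier_mat (d - 1) (d - 1)" for z
      by (rule mat_delete_carrier[OF M(1)])
    fix a b assume ab: "a < d - 1" "b < d - 1"
    have "mat_delete (M z) j i $$ (a, b) = M z $$ (if a < j then a else Suc a, if b < i then b else Suc b)" for z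
      using M(1)[of z] ab by (simp add: mat_delete_def)
    then show "(\<lambda>z. mat_delete (M z) j i $$ (a, b)) \<in> polyfun m"
      using ab by (auto intro!: M(2))
  qed
  moreover have "adj_mat (M z) $$ (i, j) = (- 1) ^ (j + i) * det (mat_delete (M z) j i)" for z
    using M(1)[of z] ij by (simp add: adj_mat_def cofactor_def)
  ultimately show ?thesis by (simp add: polyfun_mult polyfun_const)
qed

lemma adj_mat_smult:
  assumes "M \<in> carrier_mat d d" "i < d" "j < d"
  shows "adj_mat (t \<cdot>\<^sub>m M) $$ (i, j) = t ^ (d - 1) * adj_mat M $$ (i, j)"
proof -
  have "mat_delete (t \<cdot>\<^sub>m M) j i = t \<cdot>\<^sub>m mat_delete M j i"
    using assms by (intro eq_matI) (auto simp: mat_delete_def)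
  then show ?thesis using assms by (simp add: adj_mat_def cofactor_def)
qed

definition rs_mat :: "nat \<Rightarrow> nat \<Rightarrow> complex \<Rightarrow> (nat \<Rightarrow> complex) \<Rightarrow> complex mat" where
  "rs_mat n k \<epsilon> z = A_mat n k \<epsilon> (vec (2 * n + 2) z)"

text \<open>The constant matrix \<open>B\<close> combines columns of A. Column selectors give
  maximal minors; a general \<open>B\<close> allows a chart around any prescribed point.\<close>

definition chart_det :: "nat \<Rightarrow> nat \<Rightarrow> complex \<Rightarrow> complex mat \<Rightarrow> (nat \<Rightarrow> complex) \<Rightarrow> complex" where
  "chart_det n k \<epsilon> B z = det (rs_mat n k \<epsilon> z * B)"

text \<open>The adjugate form of a left inverse of \<open>J A\<^sup>t\<close> where \<open>A B\<close> is invertible.\<close>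
definition chart_mat ::
    "nat \<Rightarrow> nat \<Rightarrow> complex \<Rightarrow> complex mat \<Rightarrow> (nat \<Rightarrow> complex) \<Rightarrow> nat \<Rightarrow> nat \<Rightarrow> complex" where
  "chart_mat n k \<epsilon> B z i r =
    (adj_mat (transpose_mat (rs_mat n k \<epsilon> z * B)) *
      (transpose_mat B * transpose_mat (sympl_J (n + k)))) $$ (i, r)"

lemma rs_mat_carrier: "rs_mat n k \<epsilon> z \<in> carrier_mat k (2 * (n + k))"
  unfolding rs_mat_def by (rule A_mat_carrier)

lemma rs_mat_carrier' [simp]: "rs_mat n k \<epsilon> z \<in> carrier_mat k (2 * n + 2 * k)"
  using rs_mat_carrier by (simp add: distrib_left)

lemma rs_mat_dim [simp]: "dim_row (rs_mat n k \<epsilon> z) = k" "dim_col (rs_mat n k \<epsilon> z) = 2 * (n + k)"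
  using carrier_matD[OF rs_mat_carrier[of n k \<epsilon> z]] by auto

lemma rs_mat_index: "rs_mat n k \<epsilon> z $$ (i, r) = rs_entry n k \<epsilon> z i r"
  by (simp add: rs_mat_def rs_entry_def)

lemma sympl_J_carrier [simp]: "sympl_J N \<in> carrier_mat (2 * N) (2 * N)"
  by (intro carrier_matI) (simp_all add: sympl_J_def)

lemma sympl_J_carrier' [simp]:
  "sympl_J (n + k) \<in> carrier_mat (2 * n + 2 * k) (2 * n + 2 * k)"
  using sympl_J_carrier[of "n + k"] by simp

lemma sympl_J_dim [simp]: "dim_row (sympl_J N) = 2 * N" "dim_col (sympl_J N) = 2 * N"
  using carrier_matD[OF sympl_J_carrier[of N]] by auto

lemma rs_image_index:
  assumes "r < 2 * (n + k)" "i < k"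
  shows "(sympl_J (n + k) * transpose_mat (rs_mat n k \<epsilon> z)) $$ (r, i) = rs_image n k \<epsilon> z r i"
proof -
  let ?N = "n + k"
  have "(sympl_J ?N * transpose_mat (rs_mat n k \<epsilon> z)) $$ (r, i) =
      (\<Sum>s<2 * ?N. sympl_J ?N $$ (r, s) * rs_entry n k \<epsilon> z i s)"
    using assms by (simp add: scalar_prod_def rs_mat_index lessThan_atLeast0)
  also have "\<dots> = (\<Sum>s<2 * ?N. if s = (if r < ?N then ?N + r else r - ?N)
      then (if r < ?N then rs_entry n k \<epsilon> z i s else - rs_entry n k \<epsilon> z i s) else 0)"
  proof (intro sum.cong refl)
    fix s assume "s \<in> {..<2 * ?N}"
    then show "sympl_J ?N $$ (r, s) * rs_entry n k \<epsilon> z i s = (if s = (if r < ?N then ?N + r else r - ?N)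
      then (if r < ?N then rs_entry n k \<epsilon> z i s else - rs_entry n k \<epsilon> z i s) else 0)"
      using assms(1) by (auto simp: sympl_J_def)
  qed
  also have "\<dots> = rs_image n k \<epsilon> z r i"
    using assms(1) by (auto simp: rs_image_def)
  finally show ?thesis .
qed

lemma sympl_J_transpose_mult: "transpose_mat (sympl_J N) * sympl_J N = 1\<^sub>m (2 * N)"
proof -
  have "transpose_mat (sympl_J N) = four_block_mat (0\<^sub>m N N) (- 1\<^sub>m N) (1\<^sub>m N) (0\<^sub>m N N)"
    unfolding sympl_J_def by (subst transpose_four_block_mat) (auto simp: transpose_uminus)
  moreover have *: "- 0\<^sub>m N N = (0\<^sub>m N N :: complex mat)" by (rule eq_matI) auto
  ultimately show ?thesis
    unfolding sympl_J_def
    by (simp add: mult_four_block_mat[of _ N N _ N _ N _ _ N _ N] * )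
      (simp add: mult_2 flip: four_block_one_mat)
qed

lemma index_mat_mult_sum:
  assumes "A \<in> carrier_mat a b" "B \<in> carrier_mat b c" "i < a" "j < c"
  shows "(A * B) $$ (i, j) = (\<Sum>r<b. A $$ (i, r) * B $$ (r, j))"
  using assms by (simp add: scalar_prod_def lessThan_atLeast0)

text \<open>Since J^t J = 1, the product B^t J^t J A^t collapses to (A B)^t, and the adjugate of
  that matrix is its inverse up to the determinant.\<close>

lemma chart_mat_left_inverse:
  assumes B: "B \<in> carrier_mat (2 * (n + k)) k" and ij: "i < k" "j < k"
  shows "(\<Sum>r<2 * (n + k). chart_mat n k \<epsilon> B z i r * rs_image n k \<epsilon> z r j) =
    (if i = j then chart_det n k \<epsilon> B z else 0)"
proof -
  let ?A = "rs_mat n k \<epsilon> z" and ?J = "sympl_J (n + k)"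
  let ?M = "transpose_mat (?A * B)"
  let ?G = "adj_mat ?M * (transpose_mat B * transpose_mat ?J)"
  have carr: "?A * B \<in> carrier_mat k k" by (rule mult_carrier_mat[OF rs_mat_carrier B])
  then have M: "?M \<in> carrier_mat k k" by simp
  have adj: "adj_mat ?M \<in> carrier_mat k k" by (rule adj_mat(1)[OF M])
  have BT: "transpose_mat B \<in> carrier_mat k (2 * (n + k))" using B by simp
  have JT: "transpose_mat ?J \<in> carrier_mat (2 * (n + k)) (2 * (n + k))" using sympl_J_carrier by simp
  have AT: "transpose_mat ?A \<in> carrier_mat (2 * (n + k)) k" using rs_mat_carrier by simp
  have G: "?G \<in> carrier_mat k (2 * (n + k))" by (rule mult_carrier_mat[OF adj mult_carrier_mat[OF BT JT]])
  have JA: "?J * transpose_mat ?A \<in> carrier_mat (2 * (n + k)) k"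
    by (rule mult_carrier_mat[OF sympl_J_carrier AT])
  have "?G * (?J * transpose_mat ?A) = adj_mat ?M * (transpose_mat B * (transpose_mat ?J * (?J * transpose_mat ?A)))"
    by (simp only: assoc_mult_mat[OF adj mult_carrier_mat[OF BT JT] JA] assoc_mult_mat[OF BT JT JA])
  also have "transpose_mat ?J * (?J * transpose_mat ?A) = (transpose_mat ?J * ?J) * transpose_mat ?A"
    by (rule assoc_mult_mat[OF JT sympl_J_carrier AT, symmetric])
  also have "\<dots> = transpose_mat ?A" unfolding sympl_J_transpose_mult by (rule left_mult_one_mat[OF AT])
  also have "transpose_mat B * transpose_mat ?A = ?M"
    by (rule transpose_mult[OF rs_mat_carrier B, symmetric])
  also have "adj_mat ?M * ?M = det ?M \<cdot>\<^sub>m 1\<^sub>m k" by (rule adj_mat(3)[OF M])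
  finally have "(?G * (?J * transpose_mat ?A)) $$ (i, j) = (det ?M \<cdot>\<^sub>m 1\<^sub>m k) $$ (i, j)" by simp
  moreover have "(?G * (?J * transpose_mat ?A)) $$ (i, j) =
      (\<Sum>r<2 * (n + k). ?G $$ (i, r) * (?J * transpose_mat ?A) $$ (r, j))"
    by (rule index_mat_mult_sum[OF G JA ij])
  moreover have "(\<Sum>r<2 * (n + k). ?G $$ (i, r) * (?J * transpose_mat ?A) $$ (r, j)) =
      (\<Sum>r<2 * (n + k). chart_mat n k \<epsilon> B z i r * rs_image n k \<epsilon> z r j)"
    unfolding chart_mat_def
    by (intro sum.cong refl arg_cong2[where f = "(*)"] rs_image_index) (use ij in auto)
  ultimately have "(\<Sum>r<2 * (n + k). chart_mat n k \<epsilon> B z i r * rs_image n k \<epsilon> z r j) =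
      (det ?M \<cdot>\<^sub>m 1\<^sub>m k) $$ (i, j)" by (simp only:)
  then show ?thesis using ij det_transpose[OF carr] by (simp add: chart_det_def)
qed

lemma rs_mat_mult_index:
  assumes "B \<in> carrier_mat (2 * (n + k)) k" "i < k" "j < k"
  shows "(rs_mat n k \<epsilon> z * B) $$ (i, j) = (\<Sum>r<2 * (n + k). rs_entry n k \<epsilon> z i r * B $$ (r, j))"
  using assms carrier_matD[OF assms(1)]
  by (simp add: scalar_prod_def lessThan_atLeast0 rs_mat_index)

lemma rs_mat_smult:
  assumes "n \<ge> 1"
  shows "rs_mat n k \<epsilon> (\<lambda>l. t * z l) = t \<cdot>\<^sub>m rs_mat n k \<epsilon> z"
proof (rule eq_matI)
  fix i r assume "i < dim_row (t \<cdot>\<^sub>m rs_mat n k \<epsilon> z)" "r < dim_col (t \<cdot>\<^sub>m rs_mat n k \<epsilon> z)"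
  then show "rs_mat n k \<epsilon> (\<lambda>l. t * z l) $$ (i, r) = (t \<cdot>\<^sub>m rs_mat n k \<epsilon> z) $$ (i, r)"
    using assms by (simp add: rs_mat_index rs_entry_hom)
qed simp_all

lemma chart_polyfun_hom:
  assumes n: "n \<ge> 1" and B: "B \<in> carrier_mat (2 * (n + k)) k"
  shows "chart_det n k \<epsilon> B \<in> polyfun (2 * n + 2)"
    and "chart_det n k \<epsilon> B (\<lambda>l. t * z l) = t ^ k * chart_det n k \<epsilon> B z"
    and "i < k \<Longrightarrow> r < 2 * (n + k) \<Longrightarrow> (\<lambda>z. chart_mat n k \<epsilon> B z i r) \<in> polyfun (2 * n + 2)"
    and "i < k \<Longrightarrow> r < 2 * (n + k) \<Longrightarrow>
      chart_mat n k \<epsilon> B (\<lambda>l. t * z l) i r = t ^ (k - 1) * chart_mat n k \<epsilon> B z i r"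
proof -
  have AB: "rs_mat n k \<epsilon> z * B \<in> carrier_mat k k" for z
    by (rule mult_carrier_mat[OF rs_mat_carrier B])
  have entries: "(\<lambda>z. (rs_mat n k \<epsilon> z * B) $$ (i, j)) \<in> polyfun (2 * n + 2)" if "i < k" "j < k" for i j
    unfolding rs_mat_mult_index[OF B that]
    using n that by (intro polyfun_intros rs_entry_polyfun) auto
  have scale: "rs_mat n k \<epsilon> (\<lambda>l. t * z l) * B = t \<cdot>\<^sub>m (rs_mat n k \<epsilon> z * B)" for t z
    unfolding rs_mat_smult[OF n] by (rule mult_smult_assoc_mat[OF rs_mat_carrier B])
  show "chart_det n k \<epsilon> B \<in> polyfun (2 * n + 2)"
    unfolding chart_det_def[abs_def] by (rule det_polyfun[OF AB entries])
  show "chart_det n k \<epsilon> B (\<lambda>l. t * z l) = t ^ k * chart_det n k \<epsilon> B z"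
    unfolding chart_det_def scale using AB[of z] by (subst det_smult) auto
  let ?C = "transpose_mat B * transpose_mat (sympl_J (n + k))"
  have C: "?C \<in> carrier_mat k (2 * (n + k))" using B by auto
  have T: "transpose_mat (rs_mat n k \<epsilon> z * B) \<in> carrier_mat k k" for z using AB by simp
  have expand: "chart_mat n k \<epsilon> B z i r =
      (\<Sum>j<k. adj_mat (transpose_mat (rs_mat n k \<epsilon> z * B)) $$ (i, j) * ?C $$ (j, r))"
    if "i < k" "r < 2 * (n + k)" for z i r
    unfolding chart_mat_def by (rule index_mat_mult_sum[OF adj_mat(1)[OF T] C that])
  show "(\<lambda>z. chart_mat n k \<epsilon> B z i r) \<in> polyfun (2 * n + 2)" if "i < k" "r < 2 * (n + k)"
  proof -
    have "(\<lambda>z. transpose_mat (rs_mat n k \<epsilon> z * B) $$ (i, j)) \<in> polyfun (2 * n + 2)"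
      if "i < k" "j < k" for i j
    proof -
      have "transpose_mat (rs_mat n k \<epsilon> z * B) $$ (i, j) = (rs_mat n k \<epsilon> z * B) $$ (j, i)" for z
        using carrier_matD[OF AB[of z]] that by simp
      then show ?thesis using entries[OF that(2,1)] by simp
    qed
    then show ?thesis
      unfolding expand[OF that] using that
      by (intro polyfun_intros adj_mat_polyfun[OF T]) auto
  qed
  show "chart_mat n k \<epsilon> B (\<lambda>l. t * z l) i r = t ^ (k - 1) * chart_mat n k \<epsilon> B z i r"
    if "i < k" "r < 2 * (n + k)"
  proof -
    have "transpose_mat (rs_mat n k \<epsilon> (\<lambda>l. t * z l) * B) = t \<cdot>\<^sub>m transpose_mat (rs_mat n k \<epsilon> z * B)"
      unfolding scale by (rule eq_matI) auto
    then show ?thesis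
      unfolding expand[OF that] sum_distrib_left using that
      by (intro sum.cong refl) (simp add: adj_mat_smult[OF T])
  qed
qed

text \<open>At a point where the rows are independent, the conjugate transpose of \<open>A\<close> gives a chart.\<close>
lemma chart_exists:
  assumes indep: "\<And>b i. (\<And>r. r < 2 * (n + k) \<Longrightarrow> (\<Sum>i<k. b i * rs_entry n k \<epsilon> z i r) = 0) \<Longrightarrow> i < k \<Longrightarrow> b i = 0"
  shows "\<exists>B\<in>carrier_mat (2 * (n + k)) k. chart_det n k \<epsilon> B z \<noteq> 0"
proof
  let ?a = "rs_entry n k \<epsilon> z"
  let ?B = "mat (2 * (n + k)) k (\<lambda>(r, j). cnj (?a j r))"
  show B: "?B \<in> carrier_mat (2 * (n + k)) k" by simp
  have AB: "rs_mat n k \<epsilon> z * ?B \<in> carrier_mat k k" by (rule mult_carrier_mat[OF rs_mat_carrier B])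
  show "chart_det n k \<epsilon> ?B z \<noteq> 0"
  proof
    assume "chart_det n k \<epsilon> ?B z = 0"
    then obtain v where v: "v \<in> carrier_vec k" "v \<noteq> 0\<^sub>v k" "(rs_mat n k \<epsilon> z * ?B) *\<^sub>v v = 0\<^sub>v k"
      unfolding chart_det_def using det_0_iff_vec_prod_zero_field[OF AB] by blast
    have eq: "(\<Sum>j<k. (\<Sum>r<2 * (n + k). ?a i r * cnj (?a j r)) * v $ j) = 0" if i: "i < k" for i
    proof -
      have "((rs_mat n k \<epsilon> z * ?B) *\<^sub>v v) $ i = (\<Sum>j<k. (rs_mat n k \<epsilon> z * ?B) $$ (i, j) * v $ j)"
        using AB v(1) i by (auto simp: scalar_prod_def lessThan_atLeast0 intro!: sum.cong)
      also have "\<dots> = (\<Sum>j<k. (\<Sum>r<2 * (n + k). ?a i r * cnj (?a j r)) * v $ j)"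
        by (intro sum.cong refl arg_cong2[where f = "(*)"])
          (subst rs_mat_mult_index[OF B i], auto)
      finally show ?thesis unfolding v(3) using i by simp
    qed
    \<comment> \<open>A null vector \<open>v\<close> of A A^* is paired with itself: the result is
      the squared norm of v^* A, so v^* is a relation among the rows.\<close>
    define s where "s r = (\<Sum>j<k. cnj (v $ j) * ?a j r)" for r
    have "(\<Sum>r<2 * (n + k). s r * cnj (s r)) =
        (\<Sum>i<k. cnj (v $ i) * (\<Sum>j<k. (\<Sum>r<2 * (n + k). ?a i r * cnj (?a j r)) * v $ j))"
    proof -
      have "s r * cnj (s r) = (\<Sum>i<k. \<Sum>j<k. cnj (v $ i) * (?a i r * cnj (?a j r) * v $ j))" for r
        unfolding s_def cnj_sum sum_product by (intro sum.cong refl) (simp add: mult_ac)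
      then show ?thesis
        by (simp add: sum_distrib_left sum_distrib_right)
          (rule trans[OF sum.swap sum.cong[OF refl sum.swap]])
    qed
    also have "\<dots> = 0" using eq by simp
    finally have "(\<Sum>r<2 * (n + k). complex_of_real ((cmod (s r))\<^sup>2)) = 0"
      by (simp only: complex_norm_square)
    then have "(\<Sum>r<2 * (n + k). (cmod (s r))\<^sup>2) = 0"
      by (simp only: of_real_eq_0_iff flip: of_real_sum)
    then have "s r = 0" if "r < 2 * (n + k)" for r using that by (simp add: sum_nonneg_eq_0_iff)
    then have "cnj (v $ i) = 0" if "i < k" for i
      using that unfolding s_def by (intro indep[of "\<lambda>i. cnj (v $ i)"]) auto
    then have "v = 0\<^sub>v k" using v(1) by (intro eq_vecI) auto
    then show False using v(2) by simp
  qed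
qed

text \<open>B adj(A B) / det(A B) is a right inverse of A, so the columns of A span.\<close>

lemma rank_full_if_chart:
  assumes B: "B \<in> carrier_mat (2 * (n + k)) k" and det: "chart_det n k \<epsilon> B z \<noteq> 0"
  shows "vec_space.rank k (rs_mat n k \<epsilon> z) = k"
proof -
  interpret vec_space "TYPE(complex)" k .
  let ?A = "rs_mat n k \<epsilon> z"
  have AB: "?A * B \<in> carrier_mat k k" by (rule mult_carrier_mat[OF rs_mat_carrier B])
  have "\<exists>x\<in>carrier_vec (2 * (n + k)). ?A *\<^sub>v x = y" if y: "y \<in> carrier_vec k" for y
  proof
    let ?d = "chart_det n k \<epsilon> B z"
    let ?x = "B *\<^sub>v (adj_mat (?A * B) *\<^sub>v ((1 / ?d) \<cdot>\<^sub>v y))"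
    have w: "(1 / ?d) \<cdot>\<^sub>v y \<in> carrier_vec k" using y by simp
    have adj: "adj_mat (?A * B) \<in> carrier_mat k k" by (rule adj_mat(1)[OF AB])
    show "?x \<in> carrier_vec (2 * (n + k))" using B adj w by auto
    have "?A *\<^sub>v ?x = (?A * B) *\<^sub>v (adj_mat (?A * B) *\<^sub>v ((1 / ?d) \<cdot>\<^sub>v y))"
      using B adj w by (subst assoc_mult_mat_vec[of _ k "2 * (n + k)" _ k]) auto
    also have "\<dots> = ((?A * B) * adj_mat (?A * B)) *\<^sub>v ((1 / ?d) \<cdot>\<^sub>v y)"
      using AB adj w by (subst assoc_mult_mat_vec[of _ k k _ k]) auto
    also have "(?A * B) * adj_mat (?A * B) = ?d \<cdot>\<^sub>m 1\<^sub>m k"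
      unfolding chart_det_def by (rule adj_mat(2)[OF AB])
    also have "(?d \<cdot>\<^sub>m 1\<^sub>m k) *\<^sub>v ((1 / ?d) \<cdot>\<^sub>v y) = y"
      using y det by (intro eq_vecI) (auto simp: scalar_prod_def if_distrib if_distribR cong: if_cong)
    finally show "?A *\<^sub>v ?x = y" .
  qed
  then have "span (set (cols ?A)) = carrier_vec k"
    using col_space_eq[OF rs_mat_carrier] unfolding col_space_def by auto
  then have "span_vs (set (cols ?A)) = V" by simp
  then show ?thesis unfolding rank_def using dim_is_n by simp
qed


section \<open>The three charts used for lifting\<close>

definition column_selector :: "nat \<Rightarrow> nat \<Rightarrow> (nat \<Rightarrow> nat) \<Rightarrow> complex mat" where
  "column_selector N k \<sigma> = mat (2 * N) k (\<lambda>(r, j). if r = \<sigma> j then 1 else 0)"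

lemma column_selector_carrier: "column_selector N k \<sigma> \<in> carrier_mat (2 * N) k"
  by (simp add: column_selector_def)

lemma rs_mat_mult_column_selector:
  assumes "\<And>j. j < k \<Longrightarrow> \<sigma> j < 2 * (n + k)" "i < k" "j < k"
  shows "(rs_mat n k \<epsilon> z * column_selector (n + k) k \<sigma>) $$ (i, j) = rs_entry n k \<epsilon> z i (\<sigma> j)"
proof -
  have "(rs_mat n k \<epsilon> z * column_selector (n + k) k \<sigma>) $$ (i, j) =
      (\<Sum>r<2 * (n + k). if r = \<sigma> j then rs_entry n k \<epsilon> z i r else 0)"
    unfolding rs_mat_mult_index[OF column_selector_carrier assms(2,3)]
    using assms(3) by (intro sum.cong) (auto simp: column_selector_def)
  also have "\<dots> = rs_entry n k \<epsilon> z i (\<sigma> j)" using assms(1)[OF assms(3)] by simp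
  finally show ?thesis .
qed

text \<open>These columns form an upper triangular matrix with x_0 along the diagonal.\<close>

lemma chart_det_first_columns:
  "chart_det n k \<epsilon> (column_selector (n + k) k (\<lambda>j. j)) z = z 0 ^ k"
proof -
  let ?M = "rs_mat n k \<epsilon> z * column_selector (n + k) k (\<lambda>j. j)"
  have M: "?M \<in> carrier_mat k k"
    by (rule mult_carrier_mat[OF rs_mat_carrier column_selector_carrier])
  have index: "?M $$ (i, j) = (if i \<le> j \<and> j - i \<le> n then z (j - i) else 0)" if "i < k" "j < k" for i j
    using that by (subst rs_mat_mult_column_selector) (auto simp: rs_entry_F)
  have "upper_triangular ?M"
    using index carrier_matD[OF M] by (intro upper_triangularI) simp
  then have "det ?M = prod_list (diag_mat ?M)" by (rule det_upper_triangular[OF _ M])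
  also have "diag_mat ?M = replicate k (z 0)"
    using index carrier_matD[OF M] by (intro nth_equalityI) (auto simp: diag_mat_def)
  finally show ?thesis by (simp add: chart_det_def)
qed

text \<open>These columns form a lower triangular matrix with x_n along the diagonal.\<close>

lemma chart_det_last_columns:
  "chart_det n k \<epsilon> (column_selector (n + k) k (\<lambda>j. n + j)) z = z n ^ k"
proof -
  let ?M = "rs_mat n k \<epsilon> z * column_selector (n + k) k (\<lambda>j. n + j)"
  have M: "?M \<in> carrier_mat k k"
    by (rule mult_carrier_mat[OF rs_mat_carrier column_selector_carrier])
  have index: "?M $$ (i, j) = (if i \<le> n + j \<and> n + j - i \<le> n then z (n + j - i) else 0)" if "i < k" "j < k" for i j
    using that by (subst rs_mat_mult_column_selector) (auto simp: rs_entry_F)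
  have "det ?M = prod_list (diag_mat ?M)"
    by (rule det_lower_triangular[OF _ M]) (simp add: index)
  also have "diag_mat ?M = replicate k (z n)"
    using index carrier_matD[OF M] by (intro nth_equalityI) (auto simp: diag_mat_def)
  finally show ?thesis by (simp add: chart_det_def)
qed

text \<open>Only the y_i enter, so changing x_0 and x_n has no effect. Taking the first
  \<open>k\<close> columns of H in reverse order puts y_0 on the diagonal; at the point y_0 = 1 with
  all other coordinates zero, the matrix is the identity.\<close>

lemma chart_det_H_columns:
  assumes n: "n \<ge> 1" and k: "k \<ge> 2"
  defines "\<sigma> \<equiv> \<lambda>j. n + k + (k - 1 - j)"
  shows "chart_det n k \<epsilon> (column_selector (n + k) k \<sigma>) (z(0 := a, n := b)) =
      chart_det n k \<epsilon> (column_selector (n + k) k \<sigma>) z"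
    and "chart_det n k \<epsilon> (column_selector (n + k) k \<sigma>) (\<lambda>l. if l = n + 1 then 1 else 0) = 1"
proof -
  let ?M = "\<lambda>z. rs_mat n k \<epsilon> z * column_selector (n + k) k \<sigma>"
  have M: "?M z \<in> carrier_mat k k" for z
    by (rule mult_carrier_mat[OF rs_mat_carrier column_selector_carrier])
  have index: "?M z $$ (i, j) =
      (if (i, k - 1 - j) = (0, 0) \<or> (i, k - 1 - j) = (k - 1, n + k - 1) then \<epsilon> * z (n + 2)
       else if k \<le> i + (k - 1 - j) + 1 \<and> i + (k - 1 - j) + 1 - k \<le> n
         then z (n + 1 + (i + (k - 1 - j) + 1 - k)) else 0)" if "i < k" "j < k" for z i j
  proof -
    have "?M z $$ (i, j) = rs_entry n k \<epsilon> z i (n + k + (k - 1 - j))"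
      using that by (subst rs_mat_mult_column_selector) (auto simp: \<sigma>_def)
    also have "k - 1 - j < n + k" using that by simp
    note rs_entry_H[OF that(1) this n]
    finally show ?thesis .
  qed
  have "?M (z(0 := a, n := b)) = ?M z"
  proof (rule eq_matI)
    fix i j assume "i < dim_row (?M z)" "j < dim_col (?M z)"
    then have ij: "i < k" "j < k" using carrier_matD[OF M] by auto
    have "(z(0 := a, n := b)) (n + 1 + l) = z (n + 1 + l)" "(z(0 := a, n := b)) (n + 2) = z (n + 2)" for l
      by simp_all
    then show "?M (z(0 := a, n := b)) $$ (i, j) = ?M z $$ (i, j)"
      unfolding index[OF ij] by (simp only:)
  qed (use carrier_matD[OF M] in auto)
  then show "chart_det n k \<epsilon> (column_selector (n + k) k \<sigma>) (z(0 := a, n := b)) =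
      chart_det n k \<epsilon> (column_selector (n + k) k \<sigma>) z"
    by (simp add: chart_det_def)
  have "?M (\<lambda>l. if l = n + 1 then 1 else 0) = 1\<^sub>m k"
  proof (rule eq_matI)
    fix i j assume "i < dim_row (1\<^sub>m k :: complex mat)" "j < dim_col (1\<^sub>m k :: complex mat)"
    then have ij: "i < k" "j < k" by auto
    show "?M (\<lambda>l. if l = n + 1 then 1 else 0) $$ (i, j) = 1\<^sub>m k $$ (i, j)"
      unfolding index[OF ij] using ij k by auto
  qed (use carrier_matD[OF M] in auto)
  then show "chart_det n k \<epsilon> (column_selector (n + k) k \<sigma>) (\<lambda>l. if l = n + 1 then 1 else 0) = 1"
    by (simp add: chart_det_def)
qed

section \<open>Sections of twisted structure sheaves\<close>

lemma vec_index_vec: "p \<in> carrier_vec m \<Longrightarrow> vec m (($) p) = p"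
  by auto

lemma is_form_mult: "is_form m d f \<Longrightarrow> is_form m e g \<Longrightarrow> is_form m (d + e) (\<lambda>p. f p * g p)"
  by (auto simp: is_form_iff_polyfun power_add intro: polyfun_mult)

lemma is_form_add: "is_form m d f \<Longrightarrow> is_form m d g \<Longrightarrow> is_form m d (\<lambda>p. f p + g p)"
  by (auto simp: is_form_iff_polyfun distrib_left intro: polyfun_add)

lemma is_form_const: "is_form m 0 (\<lambda>_. c)"
  by (simp add: is_form_iff_polyfun polyfun_const)

lemma is_form_zero: "is_form m d (\<lambda>_. 0)"
  by (simp add: is_form_iff_polyfun polyfun_const)

lemma is_form_coord: "i < m \<Longrightarrow> is_form m 1 (\<lambda>p. p $ i)"
  by (auto simp: is_form_iff_polyfun intro: polyfun_coord)

lemma zariski_open_cone: "zariski_open m (cone m)"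
  unfolding zariski_open_def
proof (rule exI[of _ "{\<lambda>p. p $ i |i. i < m}"], intro conjI)
  show "\<forall>f\<in>{\<lambda>p. p $ i |i. i < m}. \<exists>d. is_form m d f" using is_form_coord by blast
  show "cone m = {p \<in> cone m. \<exists>f\<in>{\<lambda>p. p $ i |i. i < m}. f p \<noteq> 0}"
  proof (intro equalityI subsetI)
    fix p assume p: "p \<in> cone m"
    have "p = 0\<^sub>v m" if "\<And>i. i < m \<Longrightarrow> p $ i = 0"
      using p that by (intro eq_vecI) (auto simp: cone_def)
    then obtain i where "i < m" "p $ i \<noteq> 0" using p by (auto simp: cone_def)
    then show "p \<in> {p \<in> cone m. \<exists>f\<in>{\<lambda>p. p $ i |i. i < m}. f p \<noteq> 0}"
      by (intro CollectI conjI p bexI[of _ "\<lambda>p. p $ i"]) auto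
  qed auto
qed

lemma cone_coord_nonzero: "vec m z \<in> cone m \<longleftrightarrow> (\<exists>l<m. z l \<noteq> 0)"
proof -
  have "z l = 0" if "vec m z = 0\<^sub>v m" "l < m" for l
    using arg_cong[OF that(1), of "\<lambda>v. v $ l"] that(2) by simp
  moreover have "vec m z = 0\<^sub>v m" if "\<And>l. l < m \<Longrightarrow> z l = 0"
    using that by (intro eq_vecI) auto
  ultimately show ?thesis unfolding cone_def by auto
qed

lemma zariski_open_subset_cone: "zariski_open m U \<Longrightarrow> U \<subseteq> cone m"
  unfolding zariski_open_def by auto

lemma zariski_open_Int:
  assumes "zariski_open m U" "zariski_open m V"
  shows "zariski_open m (U \<inter> V)"
proof -
  obtain S where S: "\<And>f. f \<in> S \<Longrightarrow> \<exists>d. is_form m d f" "U = {p \<in> cone m. \<exists>f\<in>S. f p \<noteq> 0}"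
    using assms(1) unfolding zariski_open_def by blast
  obtain T where T: "\<And>f. f \<in> T \<Longrightarrow> \<exists>d. is_form m d f" "V = {p \<in> cone m. \<exists>f\<in>T. f p \<noteq> 0}"
    using assms(2) unfolding zariski_open_def by blast
  let ?P = "{\<lambda>p. f p * g p |f g. f \<in> S \<and> g \<in> T}"
  have "\<forall>h\<in>?P. \<exists>d. is_form m d h" using S(1) T(1) is_form_mult by blast
  moreover have "U \<inter> V = {p \<in> cone m. \<exists>h\<in>?P. h p \<noteq> 0}"
  proof (intro equalityI subsetI)
    fix p assume "p \<in> U \<inter> V"
    then obtain f g where "p \<in> cone m" "f \<in> S" "f p \<noteq> 0" "g \<in> T" "g p \<noteq> 0" using S T by blast
    then show "p \<in> {p \<in> cone m. \<exists>h\<in>?P. h p \<noteq> 0}"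
      by (intro CollectI conjI bexI[of _ "\<lambda>p. f p * g p"]) auto
  qed (use S T in auto)
  ultimately show ?thesis unfolding zariski_open_def by blast
qed

lemma zariski_open_nonzero: "is_form m d g \<Longrightarrow> zariski_open m {p \<in> cone m. g p \<noteq> 0}"
  unfolding zariski_open_def by (intro exI[of _ "{g}"]) auto

lemma zariski_open_scale:
  assumes "zariski_open m U" "vec m z \<in> U" "t \<noteq> 0"
  shows "vec m (\<lambda>l. t * z l) \<in> U"
proof -
  obtain S where S: "\<And>f. f \<in> S \<Longrightarrow> \<exists>d. is_form m d f" "U = {p \<in> cone m. \<exists>f\<in>S. f p \<noteq> 0}"
    using assms(1) unfolding zariski_open_def by blast
  obtain f d where f: "f \<in> S" "f (vec m z) \<noteq> 0" "is_form m d f" using S assms(2) by blast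
  have "f (vec m (\<lambda>l. t * z l)) = t ^ d * f (vec m z)"
    using f(3) by (simp add: is_form_iff_polyfun)
  moreover have "vec m (\<lambda>l. t * z l) \<in> cone m"
    using assms(2,3) S(2) by (auto simp: cone_coord_nonzero)
  ultimately have "f (vec m (\<lambda>l. t * z l)) \<noteq> 0" "vec m (\<lambda>l. t * z l) \<in> cone m"
    using f(2) assms(3) by simp_all
  then show ?thesis using S(2) f(1) by blast
qed

lemma O_sectionsE:
  assumes "f \<in> O_sections m d U" "p \<in> U"
  obtains W P Q a b where "zariski_open m W" "p \<in> W" "W \<subseteq> U" "is_form m a P" "is_form m b Q"
    "int a = int b + d" "\<And>q. q \<in> W \<Longrightarrow> Q q \<noteq> 0" "\<And>q. q \<in> W \<Longrightarrow> f q = P q / Q q"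
  using assms unfolding O_sections_def by blast

lemma O_sectionsI:
  assumes "\<And>p. p \<in> U \<Longrightarrow> \<exists>W P Q a b. zariski_open m W \<and> p \<in> W \<and> W \<subseteq> U \<and>
     is_form m a P \<and> is_form m b Q \<and> int a = int b + d \<and> (\<forall>q\<in>W. Q q \<noteq> 0 \<and> f q = P q / Q q)"
  shows "f \<in> O_sections m d U"
  using assms unfolding O_sections_def by blast

lemma O_sections_cong:
  "f \<in> O_sections m d U \<Longrightarrow> (\<And>p. p \<in> U \<Longrightarrow> f p = g p) \<Longrightarrow> g \<in> O_sections m d U"
  by (rule O_sectionsI, erule O_sectionsE, assumption) (metis subsetD)

lemma O_sections_restrict:
  assumes f: "f \<in> O_sections m d U" and V: "zariski_open m V" "V \<subseteq> U"
  shows "f \<in> O_sections m d V"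
proof (rule O_sectionsI)
  fix p assume p: "p \<in> V"
  obtain W P Q a b where *: "zariski_open m W" "p \<in> W" "W \<subseteq> U" "is_form m a P" "is_form m b Q"
    "int a = int b + d" "\<And>q. q \<in> W \<Longrightarrow> Q q \<noteq> 0" "\<And>q. q \<in> W \<Longrightarrow> f q = P q / Q q"
    by (rule O_sectionsE[OF f]) (use p V in blast)+
  show "\<exists>W P Q a b. zariski_open m W \<and> p \<in> W \<and> W \<subseteq> V \<and>
     is_form m a P \<and> is_form m b Q \<and> int a = int b + d \<and> (\<forall>q\<in>W. Q q \<noteq> 0 \<and> f q = P q / Q q)"
    by (rule exI[of _ "W \<inter> V"], rule exI[of _ P], rule exI[of _ Q], rule exI[of _ a], rule exI[of _ b])
      (use * p V zariski_open_Int in auto)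
qed

lemma O_sections_add:
  assumes f: "f \<in> O_sections m d U" and g: "g \<in> O_sections m d U"
  shows "(\<lambda>p. f p + g p) \<in> O_sections m d U"
proof (rule O_sectionsI)
  fix p assume p: "p \<in> U"
  obtain W P Q a b where *: "zariski_open m W" "p \<in> W" "W \<subseteq> U" "is_form m a P" "is_form m b Q"
    "int a = int b + d" "\<And>q. q \<in> W \<Longrightarrow> Q q \<noteq> 0" "\<And>q. q \<in> W \<Longrightarrow> f q = P q / Q q"
    by (rule O_sectionsE[OF f p]) blast
  obtain W' P' Q' a' b' where **: "zariski_open m W'" "p \<in> W'" "W' \<subseteq> U" "is_form m a' P'" "is_form m b' Q'"
    "int a' = int b' + d" "\<And>q. q \<in> W' \<Longrightarrow> Q' q \<noteq> 0" "\<And>q. q \<in> W' \<Longrightarrow> g q = P' q / Q' q"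
    by (rule O_sectionsE[OF g p]) blast
  have "a' + b = a + b'" using *(6) **(6) by simp
  then have "is_form m (a + b') (\<lambda>q. P' q * Q q)"
    using is_form_mult[OF **(4) *(5)] by simp
  then have "is_form m (a + b') (\<lambda>q. P q * Q' q + P' q * Q q)"
    by (intro is_form_add[OF is_form_mult[OF *(4) **(5)]])
  moreover have "is_form m (b + b') (\<lambda>q. Q q * Q' q)" by (intro is_form_mult * **)
  moreover have "\<forall>q\<in>W \<inter> W'. Q q * Q' q \<noteq> 0 \<and> f q + g q = (P q * Q' q + P' q * Q q) / (Q q * Q' q)"
    by (auto simp: *(7,8) **(7,8) add_frac_eq mult.commute)
  moreover have "zariski_open m (W \<inter> W')" by (intro zariski_open_Int * **)
  moreover have "int (a + b') = int (b + b') + d" using *(6) by simp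
  ultimately show "\<exists>W P Q a b. zariski_open m W \<and> p \<in> W \<and> W \<subseteq> U \<and>
     is_form m a P \<and> is_form m b Q \<and> int a = int b + d \<and> (\<forall>q\<in>W. Q q \<noteq> 0 \<and> f q + g q = P q / Q q)"
    using *(2,3) **(2) by blast
qed

lemma O_sections_mult_form:
  assumes f: "f \<in> O_sections m d U" and g: "is_form m e g"
  shows "(\<lambda>p. g p * f p) \<in> O_sections m (d + int e) U"
proof (rule O_sectionsI)
  fix p assume p: "p \<in> U"
  obtain W P Q a b where *: "zariski_open m W" "p \<in> W" "W \<subseteq> U" "is_form m a P" "is_form m b Q"
    "int a = int b + d" "\<And>q. q \<in> W \<Longrightarrow> Q q \<noteq> 0" "\<And>q. q \<in> W \<Longrightarrow> f q = P q / Q q"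
    by (rule O_sectionsE[OF f p]) blast
  have "is_form m (e + a) (\<lambda>q. g q * P q)" by (intro is_form_mult g *)
  moreover have "\<forall>q\<in>W. Q q \<noteq> 0 \<and> g q * f q = g q * P q / Q q" by (auto simp: *(7,8))
  moreover have "int (e + a) = int b + (d + int e)" using *(6) by simp
  ultimately show "\<exists>W P Q a b. zariski_open m W \<and> p \<in> W \<and> W \<subseteq> U \<and>
     is_form m a P \<and> is_form m b Q \<and> int a = int b + (d + int e) \<and> (\<forall>q\<in>W. Q q \<noteq> 0 \<and> g q * f q = P q / Q q)"
    using *(1-3,5) by blast
qed

lemma O_sections_divide_form:
  assumes f: "f \<in> O_sections m d U" and g: "is_form m e g" and nz: "\<And>p. p \<in> U \<Longrightarrow> g p \<noteq> 0"
  shows "(\<lambda>p. f p / g p) \<in> O_sections m (d - int e) U"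
proof (rule O_sectionsI)
  fix p assume p: "p \<in> U"
  obtain W P Q a b where *: "zariski_open m W" "p \<in> W" "W \<subseteq> U" "is_form m a P" "is_form m b Q"
    "int a = int b + d" "\<And>q. q \<in> W \<Longrightarrow> Q q \<noteq> 0" "\<And>q. q \<in> W \<Longrightarrow> f q = P q / Q q"
    by (rule O_sectionsE[OF f p]) blast
  have "is_form m (b + e) (\<lambda>q. Q q * g q)" by (intro is_form_mult g *)
  moreover have "\<forall>q\<in>W. Q q * g q \<noteq> 0 \<and> f q / g q = P q / (Q q * g q)"
    using *(3) nz by (auto simp: *(7,8))
  moreover have "int a = int (b + e) + (d - int e)" using *(6) by simp
  ultimately show "\<exists>W P Q a b. zariski_open m W \<and> p \<in> W \<and> W \<subseteq> U \<and>
     is_form m a P \<and> is_form m b Q \<and> int a = int b + (d - int e) \<and> (\<forall>q\<in>W. Q q \<noteq> 0 \<and> f q / g q = P q / Q q)"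
    using *(1-4) by blast
qed

lemma O_sections_sum:
  assumes "finite A" "A \<noteq> {}" "\<And>x. x \<in> A \<Longrightarrow> f x \<in> O_sections m d U"
  shows "(\<lambda>p. \<Sum>x\<in>A. f x p) \<in> O_sections m d U"
  using assms by (induction A rule: finite_ne_induct) (auto intro: O_sections_add)

lemma O_sections_minus:
  "f \<in> O_sections m d U \<Longrightarrow> (\<lambda>p. - f p) \<in> O_sections m d U"
  using O_sections_mult_form[OF _ is_form_const[of m "-1"]] by simp

lemma O_sections_diff:
  "f \<in> O_sections m d U \<Longrightarrow> g \<in> O_sections m d U \<Longrightarrow> (\<lambda>p. f p - g p) \<in> O_sections m d U"
  using O_sections_add[OF _ O_sections_minus] by simp

lemma O_sections_zero: "zariski_open m U \<Longrightarrow> (\<lambda>_. 0) \<in> O_sections m (int d) U"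
  using is_form_zero[of m d] is_form_const[of m 1]
  by (intro O_sectionsI exI[of _ U] exI[of _ "\<lambda>_. 0"] exI[of _ "\<lambda>_. 1"] exI[of _ d] exI[of _ 0]) auto

text \<open>A section of the d-th twist scales with degree \<open>d\<close>, because the degrees of
  numerator and denominator differ by \<open>d\<close> and the local open sets are invariant under
  scaling.\<close>

lemma O_sections_scale:
  assumes f: "f \<in> O_sections m (int d) U" and z: "vec m z \<in> U" and t: "t \<noteq> 0"
  shows "f (vec m (\<lambda>l. t * z l)) = t ^ d * f (vec m z)"
proof -
  obtain W P Q a b where *: "zariski_open m W" "vec m z \<in> W" "W \<subseteq> U" "is_form m a P" "is_form m b Q"
    "int a = int b + int d" "\<And>q. q \<in> W \<Longrightarrow> Q q \<noteq> 0" "\<And>q. q \<in> W \<Longrightarrow> f q = P q / Q q"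
    by (rule O_sectionsE[OF f z]) blast
  have "a = b + d" using *(6) by simp
  moreover have "vec m (\<lambda>l. t * z l) \<in> W" by (rule zariski_open_scale[OF *(1,2) t])
  ultimately show ?thesis
    using *(2,4,5,8) t by (simp add: is_form_iff_polyfun power_add)
qed

lemma O_sections_reg:
  assumes f: "f \<in> O_sections m d U"
  shows "reg m {z. vec m z \<in> U} (\<lambda>z. f (vec m z))"
  unfolding reg_def
proof
  fix z assume "z \<in> {z. vec m z \<in> U}"
  then have z: "vec m z \<in> U" by simp
  obtain W P Q a b where *: "zariski_open m W" "vec m z \<in> W" "W \<subseteq> U" "is_form m a P" "is_form m b Q"
    "int a = int b + d" "\<And>q. q \<in> W \<Longrightarrow> Q q \<noteq> 0" "\<And>q. q \<in> W \<Longrightarrow> f q = P q / Q q"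
    by (rule O_sectionsE[OF f z]) blast
  obtain S where S: "\<And>f. f \<in> S \<Longrightarrow> \<exists>d. is_form m d f" "W = {p \<in> cone m. \<exists>f\<in>S. f p \<noteq> 0}"
    using *(1) unfolding zariski_open_def by blast
  obtain h e where h: "h \<in> S" "h (vec m z) \<noteq> 0" "is_form m e h" using S *(2) by blast
  \<comment> \<open>Numerator and denominator are both multiplied by \<open>h\<close> and by a
    coordinate: \<open>h\<close> keeps the basic open set inside \<open>W\<close>, and the
    coordinate keeps it away from the vertex, which a constant \<open>h\<close> would not
    exclude.\<close>
  obtain l where l: "l < m" "z l \<noteq> 0" using *(2) S(2) cone_coord_nonzero by blast
  have W: "vec m w \<in> W" if "h (vec m w) * w l \<noteq> 0" for w
    using that l h(1) S(2) by (auto simp: cone_coord_nonzero)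
  let ?u = "\<lambda>w. h (vec m w) * w l"
  have u: "?u \<in> polyfun m"
    using h(3) l(1) by (intro polyfun_intros) (simp_all add: is_form_iff_polyfun)
  show "\<exists>P\<in>polyfun m. \<exists>Q\<in>polyfun m. Q z \<noteq> 0 \<and>
      (\<forall>w. Q w \<noteq> 0 \<longrightarrow> w \<in> {z. vec m z \<in> U} \<and> f (vec m w) = P w / Q w)"
  proof (rule bexI[of _ "\<lambda>w. P (vec m w) * ?u w"], rule bexI[of _ "\<lambda>w. Q (vec m w) * ?u w"],
      intro conjI allI impI)
    show "Q (vec m z) * ?u z \<noteq> 0" using *(7)[OF *(2)] h(2) l(2) by simp
    fix w assume w: "Q (vec m w) * ?u w \<noteq> 0"
    then have "vec m w \<in> W" by (intro W) auto
    then show "w \<in> {z. vec m z \<in> U}" using *(3) by auto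
    show "f (vec m w) = P (vec m w) * ?u w / (Q (vec m w) * ?u w)"
      using *(8)[OF \<open>vec m w \<in> W\<close>] w by simp
  qed (use *(4,5) u in \<open>auto simp: is_form_iff_polyfun intro!: polyfun_mult[OF _ u]\<close>)
qed

lemma O_vec_sections_diff:
  "v \<in> O_vec_sections m r d U \<Longrightarrow> w \<in> O_vec_sections m r d U \<Longrightarrow>
    (\<lambda>p. v p - w p) \<in> O_vec_sections m r d U"
  unfolding O_vec_sections_def
proof (intro CollectI conjI ballI allI impI)
  fix i
  assume v: "v \<in> {v. (\<forall>p\<in>U. v p \<in> carrier_vec r) \<and> (\<forall>i<r. (\<lambda>p. v p $ i) \<in> O_sections m d U)}"
    and w: "w \<in> {v. (\<forall>p\<in>U. v p \<in> carrier_vec r) \<and> (\<forall>i<r. (\<lambda>p. v p $ i) \<in> O_sections m d U)}"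
    and i: "i < r"
  have "(\<lambda>p. v p $ i - w p $ i) \<in> O_sections m d U"
    using v w i by (intro O_sections_diff) auto
  then show "(\<lambda>p. (v p - w p) $ i) \<in> O_sections m d U"
    by (rule O_sections_cong) (use w i in auto)
qed auto

lemma O_vec_sections_cong:
  "v \<in> O_vec_sections m r d U \<Longrightarrow> (\<And>p. p \<in> U \<Longrightarrow> v p = w p) \<Longrightarrow> w \<in> O_vec_sections m r d U"
  unfolding O_vec_sections_def by (auto intro: O_sections_cong)

lemma O_vec_sections_restrict:
  "v \<in> O_vec_sections m r d U \<Longrightarrow> zariski_open m V \<Longrightarrow> V \<subseteq> U \<Longrightarrow> v \<in> O_vec_sections m r d V"
  unfolding O_vec_sections_def by (auto intro: O_sections_restrict)

lemma O_vec_sections_zero: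
  "zariski_open m U \<Longrightarrow> (\<lambda>_. 0\<^sub>v r) \<in> O_vec_sections m r (int d) U"
  unfolding O_vec_sections_def by (auto intro!: O_sections_cong[OF O_sections_zero])

section \<open>The quotient by the image\<close>

context
  fixes m k N :: nat and A :: "complex vec \<Rightarrow> complex mat"
  assumes A: "\<And>p. p \<in> carrier_vec m \<Longrightarrow> A p \<in> carrier_mat k (2 * N)"
begin

lemma JAt_carrier:
  assumes "p \<in> carrier_vec m"
  shows "sympl_J N * transpose_mat (A p) \<in> carrier_mat (2 * N) k"
  using A[OF assms] by (intro mult_carrier_mat[OF sympl_J_carrier]) simp

lemma monad_im_cong:
  assumes "v \<in> monad_im m k N A d U" "\<And>p. p \<in> U \<Longrightarrow> v p = w p"
  shows "w \<in> monad_im m k N A d U"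
  using assms O_vec_sections_cong[of v m "2 * N" d U w] unfolding monad_im_def by auto

lemma monad_im_restrict:
  assumes "v \<in> monad_im m k N A d U" "zariski_open m V" "V \<subseteq> U"
  shows "v \<in> monad_im m k N A d V"
  using assms O_vec_sections_restrict unfolding monad_im_def by blast

lemma monad_im_diff:
  assumes "v \<in> monad_im m k N A d U" "w \<in> monad_im m k N A d U" "U \<subseteq> cone m"
  shows "(\<lambda>p. v p - w p) \<in> monad_im m k N A d U"
proof -
  obtain b where b: "b \<in> O_vec_sections m k (d - 1) U"
    "\<And>p. p \<in> U \<Longrightarrow> v p = (sympl_J N * transpose_mat (A p)) *\<^sub>v b p"
    using assms(1) unfolding monad_im_def by blast
  obtain c where c: "c \<in> O_vec_sections m k (d - 1) U"
    "\<And>p. p \<in> U \<Longrightarrow> w p = (sympl_J N * transpose_mat (A p)) *\<^sub>v c p"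
    using assms(2) unfolding monad_im_def by blast
  have "v p - w p = (sympl_J N * transpose_mat (A p)) *\<^sub>v (b p - c p)" if "p \<in> U" for p
  proof -
    have "p \<in> carrier_vec m" using that assms(3) by (auto simp: cone_def)
    moreover have "b p \<in> carrier_vec k" "c p \<in> carrier_vec k"
      using b(1) c(1) that unfolding O_vec_sections_def by auto
    ultimately show ?thesis
      using b(2) c(2) that by (simp add: mult_minus_distrib_mat_vec[OF JAt_carrier])
  qed
  moreover have "(\<lambda>p. v p - w p) \<in> O_vec_sections m (2 * N) d U"
    using assms(1,2) by (intro O_vec_sections_diff) (auto simp: monad_im_def)
  moreover have "(\<lambda>p. b p - c p) \<in> O_vec_sections m k (d - 1) U"
    by (intro O_vec_sections_diff b c)
  ultimately show ?thesis
    unfolding monad_im_def by (intro CollectI conjI bexI[of _ "\<lambda>p. b p - c p"]) auto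
qed

lemma monad_im_zero:
  assumes "zariski_open m U"
  shows "(\<lambda>_. 0\<^sub>v (2 * N)) \<in> monad_im m k N A 1 U"
proof -
  have "(sympl_J N * transpose_mat (A p)) *\<^sub>v 0\<^sub>v k = 0\<^sub>v (2 * N)" if "p \<in> U" for p
    using that zariski_open_subset_cone[OF assms] JAt_carrier[of p]
    by (intro eq_vecI) (auto simp: cone_def)
  then show ?thesis
    unfolding monad_im_def
    using O_vec_sections_zero[OF assms, of "2 * N" 1] O_vec_sections_zero[OF assms, of k 0]
    by (intro CollectI conjI bexI[of _ "\<lambda>_. 0\<^sub>v k"]) auto
qed

lemma monad_ker_carrier: "v \<in> monad_ker m k N A d U \<Longrightarrow> p \<in> U \<Longrightarrow> v p \<in> carrier_vec (2 * N)"
  unfolding monad_ker_def O_vec_sections_def by auto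

lemma quotient_germ_refl:
  assumes "zariski_open m W" "p \<in> W" "v \<in> monad_ker m k N A 1 W"
  shows "(W, v) \<in> quotient_germ m (monad_ker m k N A 1) (monad_im m k N A 1) W v p"
proof -
  have "(\<lambda>q. v q - v q) \<in> monad_im m k N A 1 W"
    by (rule monad_im_cong[OF monad_im_zero[OF assms(1)]])
      (use minus_cancel_vec[OF monad_ker_carrier[OF assms(3)]] in auto)
  then show ?thesis using assms unfolding quotient_germ_def by blast
qed

text \<open>Germs are sets of local sections. On a neighbourhood where \<open>v\<close> lies in the
  image, \<open>v - w\<close> lies in the image exactly when \<open>- w\<close> does, so both germs
  have the same members.\<close>

lemma quotient_germ_eq_zero:
  assumes W: "zariski_open m W" and V: "zariski_open m V" "p \<in> V" "V \<subseteq> W"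
    and v: "v \<in> monad_ker m k N A 1 W" "v \<in> monad_im m k N A 1 V"
  shows "quotient_germ m (monad_ker m k N A 1) (monad_im m k N A 1) W v p =
    quotient_germ m (monad_ker m k N A 1) (monad_im m k N A 1) (cone m) (\<lambda>_. 0\<^sub>v (2 * N)) p"
proof -
  let ?I = "monad_im m k N A 1" and ?K = "monad_ker m k N A 1"
  have "(\<exists>V'. zariski_open m V' \<and> p \<in> V' \<and> V' \<subseteq> W \<inter> W' \<and> (\<lambda>q. v q - w q) \<in> ?I V') \<longleftrightarrow>
      (\<exists>V'. zariski_open m V' \<and> p \<in> V' \<and> V' \<subseteq> cone m \<inter> W' \<and> (\<lambda>q. 0\<^sub>v (2 * N) - w q) \<in> ?I V')"
    (is "?L \<longleftrightarrow> ?R") if w: "w \<in> ?K W'" for W' w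
  proof
    assume ?L
    then obtain V' where V': "zariski_open m V'" "p \<in> V'" "V' \<subseteq> W \<inter> W'" "(\<lambda>q. v q - w q) \<in> ?I V'" by blast
    let ?V = "V \<inter> V'"
    have open_V: "zariski_open m ?V" by (intro zariski_open_Int V V')
    then have cone: "?V \<subseteq> cone m" by (rule zariski_open_subset_cone)
    have "(\<lambda>q. (v q - w q) - v q) \<in> ?I ?V"
      by (intro monad_im_diff monad_im_restrict[OF V'(4) open_V] monad_im_restrict[OF v(2) open_V] cone) auto
    then have "(\<lambda>q. 0\<^sub>v (2 * N) - w q) \<in> ?I ?V"
    proof (rule monad_im_cong)
      fix q assume "q \<in> ?V"
      then have "v q \<in> carrier_vec (2 * N)" "w q \<in> carrier_vec (2 * N)"
        using monad_ker_carrier[OF v(1)] monad_ker_carrier[OF w] V V' by auto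
      then show "(v q - w q) - v q = 0\<^sub>v (2 * N) - w q" by (intro eq_vecI) auto
    qed
    then show ?R using open_V cone V V' by (intro exI[of _ ?V]) auto
  next
    assume ?R
    then obtain V' where V': "zariski_open m V'" "p \<in> V'" "V' \<subseteq> cone m \<inter> W'" "(\<lambda>q. 0\<^sub>v (2 * N) - w q) \<in> ?I V'" by blast
    let ?V = "V \<inter> V'"
    have open_V: "zariski_open m ?V" by (intro zariski_open_Int V V')
    then have cone: "?V \<subseteq> cone m" by (rule zariski_open_subset_cone)
    \<comment> \<open>Closure under differences is enough: \<open>w\<close> is recovered as
      \<open>0 - (0 - w)\<close>.\<close>
    have "(\<lambda>q. v q - (0\<^sub>v (2 * N) - (0\<^sub>v (2 * N) - w q))) \<in> ?I ?V"
      by (intro monad_im_diff monad_im_restrict[OF V'(4) open_V] monad_im_restrict[OF v(2) open_V]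
          monad_im_zero open_V cone) auto
    then have "(\<lambda>q. v q - w q) \<in> ?I ?V"
    proof (rule monad_im_cong)
      fix q assume "q \<in> ?V"
      then have "v q \<in> carrier_vec (2 * N)" "w q \<in> carrier_vec (2 * N)"
        using monad_ker_carrier[OF v(1)] monad_ker_carrier[OF w] V V' by auto
      then show "v q - (0\<^sub>v (2 * N) - (0\<^sub>v (2 * N) - w q)) = v q - w q" by (intro eq_vecI) auto
    qed
    then show ?L using open_V V V' by (intro exI[of _ ?V]) auto
  qed
  then show ?thesis unfolding quotient_germ_def by blast
qed

lemma zero_section_in_H0: "zero_section m k N A 1 \<in> H0_twist m k N A 1"
proof -
  have "A p *\<^sub>v 0\<^sub>v (2 * N) = 0\<^sub>v k" if "p \<in> cone m" for p
    using A[of p] that by (intro eq_vecI) (auto simp: cone_def)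
  then have "(\<lambda>_. 0\<^sub>v (2 * N)) \<in> monad_ker m k N A 1 (cone m)"
    using O_vec_sections_zero[OF zariski_open_cone, where r = "2 * N" and d = 1 and m = m] unfolding monad_ker_def by simp
  then show ?thesis
    unfolding H0_twist_def monad_cohomology_def quotient_sheaf_def zero_section_def
    using zariski_open_cone[of m] by auto
qed

end

section \<open>The RS-instanton bundles\<close>

lemma A_mat_eq_rs_mat: "p \<in> carrier_vec (2 * n + 2) \<Longrightarrow> A_mat n k \<epsilon> p = rs_mat n k \<epsilon> (($) p)"
  unfolding rs_mat_def by (simp only: vec_index_vec)

lemma A_mat_vec: "A_mat n k \<epsilon> (vec (2 * n + 2) z) = rs_mat n k \<epsilon> z"
  by (simp only: rs_mat_def)

lemma rs_mat_mult_vec_index: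
  assumes "v \<in> carrier_vec (2 * (n + k))" "i < k"
  shows "(rs_mat n k \<epsilon> z *\<^sub>v v) $ i = (\<Sum>r<2 * (n + k). rs_entry n k \<epsilon> z i r * v $ r)"
  using assms by (simp add: scalar_prod_def lessThan_atLeast0 rs_mat_index)

lemma rs_image_mult_vec_index:
  assumes "c \<in> carrier_vec k" "r < 2 * (n + k)"
  shows "((sympl_J (n + k) * transpose_mat (rs_mat n k \<epsilon> z)) *\<^sub>v c) $ r =
    (\<Sum>i<k. rs_image n k \<epsilon> z r i * c $ i)"
proof -
  let ?M = "sympl_J (n + k) * transpose_mat (rs_mat n k \<epsilon> z)"
  have M: "dim_row ?M = 2 * (n + k)" "dim_col ?M = k" by simp_all
  have "(?M *\<^sub>v c) $ r = (\<Sum>i<k. ?M $$ (r, i) * c $ i)"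
    using assms M by (simp add: scalar_prod_def lessThan_atLeast0 del: index_mult_mat)
  also have "\<dots> = (\<Sum>i<k. rs_image n k \<epsilon> z r i * c $ i)"
    using assms(2) by (intro sum.cong refl arg_cong2[where f = "(*)"] rs_image_index) auto
  finally show ?thesis .
qed

lemma rs_chart_exists:
  assumes n: "n \<ge> 2" and k: "k \<ge> 3" and small: "4 * (real n + 1) * cmod \<epsilon> < 1"
    and z: "\<exists>l<2 * n + 2. z l \<noteq> 0"
  shows "\<exists>B\<in>carrier_mat (2 * (n + k)) k. chart_det n k \<epsilon> B z \<noteq> 0"
proof (rule chart_exists)
  \<comment> \<open>The rank condition needs only \<open>n * cmod \<epsilon> < 1\<close>, which the
    stronger bound for the syzygies implies.\<close>
  have "real n * cmod \<epsilon> \<le> 4 * (real n + 1) * cmod \<epsilon>" by (intro mult_right_mono) auto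
  then have "real n * cmod \<epsilon> < 1" using small by linarith
  moreover have "n \<ge> 1" using n by simp
  ultimately show "b i = 0" if "\<And>r. r < 2 * (n + k) \<Longrightarrow> (\<Sum>i<k. b i * rs_entry n k \<epsilon> z i r) = 0" "i < k" for b i
    using rs_rows_independent[OF _ k _ z that] by blast
qed

lemma rs_is_symplectic_monad:
  assumes n: "n \<ge> 2" and k: "k \<ge> 3" and small: "4 * (real n + 1) * cmod \<epsilon> < 1"
  shows "is_symplectic_monad (2 * n + 2) k (n + k) (A_mat n k \<epsilon>)"
  unfolding is_symplectic_monad_def
proof (intro conjI ballI allI impI)
  fix p :: "complex vec" assume p: "p \<in> carrier_vec (2 * n + 2)"
  show "A_mat n k \<epsilon> p \<in> carrier_mat k (2 * (n + k))" by (rule A_mat_carrier)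
  let ?A = "rs_mat n k \<epsilon> (($) p)" and ?J = "sympl_J (n + k)"
  have AT: "transpose_mat ?A \<in> carrier_mat (2 * (n + k)) k" using rs_mat_carrier by simp
  have JA: "?J * transpose_mat ?A \<in> carrier_mat (2 * (n + k)) k"
    by (rule mult_carrier_mat[OF sympl_J_carrier AT])
  have "?A * (?J * transpose_mat ?A) = 0\<^sub>m k k"
  proof (rule eq_matI)
    fix i j assume "i < dim_row (0\<^sub>m k k :: complex mat)" "j < dim_col (0\<^sub>m k k :: complex mat)"
    then have ij: "i < k" "j < k" by auto
    have "(?A * (?J * transpose_mat ?A)) $$ (i, j) =
        (\<Sum>r<2 * (n + k). ?A $$ (i, r) * (?J * transpose_mat ?A) $$ (r, j))"
      by (rule index_mat_mult_sum[OF rs_mat_carrier JA ij])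
    also have "\<dots> = (\<Sum>r<2 * (n + k). rs_entry n k \<epsilon> (($) p) i r * rs_image n k \<epsilon> (($) p) r j)"
      using ij by (intro sum.cong refl arg_cong2[where f = "(*)"] rs_image_index rs_mat_index) auto
    also have "\<dots> = 0" using n k ij by (intro rs_entry_image) auto
    finally show "(?A * (?J * transpose_mat ?A)) $$ (i, j) = 0\<^sub>m k k $$ (i, j)" using ij by simp
  qed simp_all
  then show "A_mat n k \<epsilon> p * ?J * transpose_mat (A_mat n k \<epsilon> p) = 0\<^sub>m k k"
    unfolding A_mat_eq_rs_mat[OF p] assoc_mult_mat[OF rs_mat_carrier sympl_J_carrier AT] .
next
  fix i j assume ij: "i < k" "j < 2 * (n + k)"
  have "A_mat n k \<epsilon> (vec (2 * n + 2) z) $$ (i, j) = rs_entry n k \<epsilon> z i j" for z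
    by (simp only: rs_entry_def)
  then show "is_form (2 * n + 2) 1 (\<lambda>p. A_mat n k \<epsilon> p $$ (i, j))"
    unfolding is_form_iff_polyfun
    using rs_entry_polyfun[OF _ ij] rs_entry_hom[OF _ ij] n by simp
next
  fix p assume p: "p \<in> cone (2 * n + 2)"
  then have carr: "p \<in> carrier_vec (2 * n + 2)" by (simp add: cone_def)
  have "vec (2 * n + 2) (($) p) \<in> cone (2 * n + 2)" using p by (simp only: vec_index_vec[OF carr])
  then have nz: "\<exists>l<2 * n + 2. p $ l \<noteq> 0" by (simp only: cone_coord_nonzero)
  obtain B where "B \<in> carrier_mat (2 * (n + k)) k" "chart_det n k \<epsilon> B (($) p) \<noteq> 0"
    using rs_chart_exists[OF n k small nz] by blast
  then show "vec_space.rank k (A_mat n k \<epsilon> p) = k"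
    unfolding A_mat_eq_rs_mat[OF carr] by (rule rank_full_if_chart)
qed

text \<open>A global section of \<open>E(1)\<close>, recorded through one representative \<open>v p\<close> at each point \<open>p\<close>.\<close>
locale rs_section =
  fixes n k :: nat and \<epsilon> :: complex
    and W :: "complex vec \<Rightarrow> complex vec set" and v :: "complex vec \<Rightarrow> complex vec \<Rightarrow> complex vec"
  assumes n2: "n \<ge> 2" and k3: "k \<ge> 3" and \<epsilon>: "\<epsilon> \<noteq> 0" "4 * (real n + 1) * cmod \<epsilon> < 1"
    and W: "\<And>p. p \<in> cone (2 * n + 2) \<Longrightarrow> zariski_open (2 * n + 2) (W p) \<and> p \<in> W p"
    and v: "\<And>p. p \<in> cone (2 * n + 2) \<Longrightarrow> v p \<in> monad_ker (2 * n + 2) k (n + k) (A_mat n k \<epsilon>) 1 (W p)"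
    and compatible: "\<And>p q. p \<in> cone (2 * n + 2) \<Longrightarrow> q \<in> W p \<Longrightarrow>
      \<exists>c\<in>carrier_vec k. v p q - v q q = (sympl_J (n + k) * transpose_mat (A_mat n k \<epsilon> q)) *\<^sub>v c"
begin

abbreviation "m \<equiv> 2 * n + 2"
abbreviation "L \<equiv> rs_image n k \<epsilon>"

definition rep :: "(nat \<Rightarrow> complex) \<Rightarrow> nat \<Rightarrow> complex" where
  "rep z r = v (vec m z) (vec m z) $ r"

lemma W_cone: "p \<in> cone m \<Longrightarrow> W p \<subseteq> cone m"
  using W zariski_open_subset_cone by blast

lemma v_section: "p \<in> cone m \<Longrightarrow> r < 2 * (n + k) \<Longrightarrow> (\<lambda>q. v p q $ r) \<in> O_sections m 1 (W p)"
  and v_carrier: "p \<in> cone m \<Longrightarrow> q \<in> W p \<Longrightarrow> v p q \<in> carrier_vec (2 * (n + k))"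
  and v_ker: "p \<in> cone m \<Longrightarrow> q \<in> W p \<Longrightarrow> A_mat n k \<epsilon> q *\<^sub>v v p q = 0\<^sub>v k"
  using v[of p] unfolding monad_ker_def O_vec_sections_def by auto

lemma rep_compatible:
  assumes p: "p \<in> cone m" and z: "vec m z \<in> W p"
  shows "\<exists>c. \<forall>r<2 * (n + k). v p (vec m z) $ r = rep z r + (\<Sum>i<k. L z r i * c i)"
proof -
  let ?q = "vec m z"
  have q: "?q \<in> cone m" using W_cone[OF p] z by blast
  obtain c where c: "c \<in> carrier_vec k"
    "v p ?q - v ?q ?q = (sympl_J (n + k) * transpose_mat (rs_mat n k \<epsilon> z)) *\<^sub>v c"
    using compatible[OF p z] unfolding A_mat_vec by blast
  have carr: "v p ?q \<in> carrier_vec (2 * (n + k))" "v ?q ?q \<in> carrier_vec (2 * (n + k))"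
    using v_carrier[OF p z] v_carrier[OF q] W[OF q] by auto
  have "v p ?q $ r = rep z r + (\<Sum>i<k. L z r i * c $ i)" if r: "r < 2 * (n + k)" for r
  proof -
    have "v p ?q $ r - v ?q ?q $ r = (v p ?q - v ?q ?q) $ r" using carr r by simp
    also have "\<dots> = (\<Sum>i<k. L z r i * c $ i)"
      unfolding c(2) by (rule rs_image_mult_vec_index[OF c(1) r])
    finally show ?thesis by (simp add: rep_def algebra_simps)
  qed
  then show ?thesis by blast
qed

text \<open>The lifting locale indexes charts by all natural numbers; every index from 2 on repeats
  the third chart.\<close>

definition charts :: "nat \<Rightarrow> complex mat" where
  "charts d = column_selector (n + k) k
    (if d = 0 then (\<lambda>j. j) else if d = 1 then (\<lambda>j. n + j) else (\<lambda>j. n + k + (k - 1 - j)))"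

lemma charts_carrier: "charts d \<in> carrier_mat (2 * (n + k)) k"
  unfolding charts_def by (rule column_selector_carrier)

sublocale charted_quotient m "2 * (n + k)" k 0 n L "\<lambda>d. chart_mat n k \<epsilon> (charts d)"
  "\<lambda>d. chart_det n k \<epsilon> (charts d)" rep "\<lambda>l. if l = n + 1 then 1 else 0"
proof
  have n1: "n \<ge> 1" using n2 by simp
  note chart = chart_polyfun_hom[OF n1 charts_carrier]
  show "2 * (n + k) > 0" "k > 0" "0 < m" "n < m" "0 \<noteq> n" using n2 k3 by auto
  show "(\<lambda>z. L z r i) \<in> polyfun m" if "r < 2 * (n + k)" "i < k" for r i
    by (rule rs_image_polyfun[OF n1 that(2,1)])
  show "L (\<lambda>l. t * z l) r i = t * L z r i" if "r < 2 * (n + k)" "i < k" for z t r i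
    by (rule rs_image_hom[OF n1 that(2,1)])
  show "(\<lambda>z. chart_mat n k \<epsilon> (charts d) z i r) \<in> polyfun m"
    if "r < 2 * (n + k)" "i < k" for d r i by (rule chart(3)[OF that(2,1)])
  show "chart_mat n k \<epsilon> (charts d) (\<lambda>l. t * z l) i r = t ^ (k - 1) * chart_mat n k \<epsilon> (charts d) z i r"
    if "r < 2 * (n + k)" "i < k" for d z t r i by (rule chart(4)[OF that(2,1)])
  show "chart_det n k \<epsilon> (charts d) \<in> polyfun m" for d by (rule chart(1))
  show "chart_det n k \<epsilon> (charts d) (\<lambda>l. t * z l) = t ^ k * chart_det n k \<epsilon> (charts d) z" for d z t
    by (rule chart(2))
  show "(\<Sum>r<2 * (n + k). chart_mat n k \<epsilon> (charts d) z i r * L z r j) =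
      (if i = j then chart_det n k \<epsilon> (charts d) z else 0)" if "i < k" "j < k" for d z i j
    by (rule chart_mat_left_inverse[OF charts_carrier that])
  show "chart_det n k \<epsilon> (charts 0) z = z 0 ^ k" for z
    by (simp add: charts_def chart_det_first_columns)
  show "chart_det n k \<epsilon> (charts 1) z = z n ^ k" for z
    by (simp add: charts_def chart_det_last_columns)
  have "k \<ge> 2" using k3 by simp
  note H = chart_det_H_columns[OF n1 this, where \<epsilon> = \<epsilon>]
  show "chart_det n k \<epsilon> (charts 2) (z(0 := a, n := b)) = chart_det n k \<epsilon> (charts 2) z" for z a b
    using H(1)[where z = z and a = a and b = b] by (simp add: charts_def)
  show "chart_det n k \<epsilon> (charts 2) (\<lambda>l. if l = n + 1 then 1 else 0) \<noteq> 0"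
    using H(2) by (simp add: charts_def)
  show "rep z = rep w" if "\<And>i. i < m \<Longrightarrow> z i = w i" for z w
  proof -
    have "vec m z = vec m w" using that by (intro eq_vecI) auto
    then show ?thesis by (simp only: rep_def[abs_def])
  qed
  show "\<exists>U u. z \<in> U \<and> (\<forall>r<2 * (n + k). reg m U (\<lambda>w. u w r)) \<and>
      (\<forall>w\<in>U. \<exists>c. \<forall>r<2 * (n + k). rep w r = u w r + (\<Sum>i<k. L w r i * c i))"
    if "\<exists>l<m. z l \<noteq> 0" for z
  proof -
    let ?p = "vec m z" and ?U = "{w. vec m w \<in> W (vec m z)}"
    have p: "?p \<in> cone m" using that by (simp only: cone_coord_nonzero)
    have "\<exists>c. \<forall>r<2 * (n + k). rep w r = v ?p (vec m w) $ r + (\<Sum>i<k. L w r i * c i)" if w: "w \<in> ?U" for w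
    proof -
      obtain c where c: "\<forall>r<2 * (n + k). v ?p (vec m w) $ r = rep w r + (\<Sum>i<k. L w r i * c i)"
        using rep_compatible[OF p] w by blast
      then show ?thesis by (intro exI[of _ "\<lambda>i. - c i"]) (simp add: sum_negf)
    qed
    moreover have "\<forall>r<2 * (n + k). reg m ?U (\<lambda>w. v ?p (vec m w) $ r)"
      using O_sections_reg[OF v_section[OF p]] by blast
    moreover have "z \<in> ?U" using W[OF p] by blast
    ultimately show ?thesis by (intro exI[of _ ?U] exI[of _ "\<lambda>w r. v ?p (vec m w) $ r"] conjI ballI) 
  qed
  show "\<exists>c. \<forall>r<2 * (n + k). rep (\<lambda>l. t * z l) r = t * rep z r + (\<Sum>i<k. L (\<lambda>l. t * z l) r i * c i)"
    if "\<exists>l<m. z l \<noteq> 0" "t \<noteq> 0" for z t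
  proof -
    let ?p = "vec m z" and ?tz = "\<lambda>l. t * z l"
    have p: "?p \<in> cone m" using that(1) by (simp only: cone_coord_nonzero)
    then have "vec m ?tz \<in> W ?p" using W[OF p] that(2) by (intro zariski_open_scale) auto
    from rep_compatible[OF p this] obtain c where
      c: "\<forall>r<2 * (n + k). v ?p (vec m ?tz) $ r = rep ?tz r + (\<Sum>i<k. L ?tz r i * c i)" by blast
    have "v ?p (vec m ?tz) $ r = t * rep z r" if r: "r < 2 * (n + k)" for r
    proof -
      have "(\<lambda>q. v ?p q $ r) \<in> O_sections m (int 1) (W ?p)" using v_section[OF p r] by simp
      moreover have "?p \<in> W ?p" using W[OF p] by blast
      ultimately have "v ?p (vec m ?tz) $ r = t ^ 1 * v ?p ?p $ r"
        using \<open>t \<noteq> 0\<close> by (rule O_sections_scale)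
      then show ?thesis by (simp add: rep_def)
    qed
    then show ?thesis
      using c by (intro exI[of _ "\<lambda>i. - c i"]) (simp add: sum_negf)
  qed
qed

text \<open>The lift \<open>u\<close> satisfies A u = 0 where x_0 is nonzero, since
  \<open>rep\<close> lies in the kernel and A J A^t = 0; by density it does so everywhere. The
  syzygy theorem then makes \<open>u\<close> a constant combination of the columns. The coefficients
  \<open>c\<close> depend on \<open>z\<close>, with no regularity yet.\<close>

lemma rep_in_image: "z 0 \<noteq> 0 \<Longrightarrow> \<exists>c. \<forall>r<2 * (n + k). rep z r = (\<Sum>i<k. L z r i * c i)"
proof -
  obtain u where u: "\<And>r. r < 2 * (n + k) \<Longrightarrow> u r \<in> polyfun m"
    "\<And>r z t. r < 2 * (n + k) \<Longrightarrow> u r (\<lambda>l. t * z l) = t * u r z"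
    "\<And>z. z 0 \<noteq> 0 \<Longrightarrow> \<exists>c. \<forall>r<2 * (n + k). rep z r = u r z + (\<Sum>i<k. L z r i * c i)"
    using lift_exists by blast
  have n1: "n \<ge> 1" "k \<ge> 2" using n2 k3 by auto
  have "(\<Sum>r<2 * (n + k). rs_entry n k \<epsilon> z i r * u r z) = 0" if i: "i < k" for z i
  proof (rule polyfun_eq_on_nonzero[where g = "\<lambda>z. z 0" and f' = "\<lambda>_. 0" and w = "\<lambda>_. 1"
        and f = "\<lambda>z. \<Sum>r<2 * (n + k). rs_entry n k \<epsilon> z i r * u r z"])
    show "(\<lambda>z. \<Sum>r<2 * (n + k). rs_entry n k \<epsilon> z i r * u r z) \<in> polyfun m"
      using i n1 by (intro polyfun_intros rs_entry_polyfun u) auto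
    fix z :: "nat \<Rightarrow> complex" assume z: "z 0 \<noteq> 0"
    then have p: "vec m z \<in> cone m" by (auto simp: cone_coord_nonzero)
    obtain c where c: "\<And>r. r < 2 * (n + k) \<Longrightarrow> rep z r = u r z + (\<Sum>j<k. L z r j * c j)"
      using u(3)[of z] z by blast
    have "0 = (A_mat n k \<epsilon> (vec m z) *\<^sub>v v (vec m z) (vec m z)) $ i"
      using v_ker[OF p] W[OF p] i by simp
    also have "\<dots> = (\<Sum>r<2 * (n + k). rs_entry n k \<epsilon> z i r * rep z r)"
      unfolding A_mat_vec rep_def using v_carrier[OF p] W[OF p] i
      by (intro rs_mat_mult_vec_index) auto
    also have "\<dots> = (\<Sum>r<2 * (n + k). rs_entry n k \<epsilon> z i r * u r z) +
        (\<Sum>r<2 * (n + k). \<Sum>j<k. rs_entry n k \<epsilon> z i r * L z r j * c j)"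
      unfolding sum.distrib[symmetric]
      by (intro sum.cong refl) (simp add: c distrib_left sum_distrib_left mult.assoc)
    also have "(\<Sum>r<2 * (n + k). \<Sum>j<k. rs_entry n k \<epsilon> z i r * L z r j * c j) =
        (\<Sum>j<k. (\<Sum>r<2 * (n + k). rs_entry n k \<epsilon> z i r * L z r j) * c j)"
      by (subst sum.swap) (simp only: sum_distrib_right)
    also have "\<dots> = 0"
    proof (intro sum.neutral ballI)
      fix j assume "j \<in> {..<k}"
      then have "(\<Sum>r<2 * (n + k). rs_entry n k \<epsilon> z i r * L z r j) = 0"
        using i by (intro rs_entry_image n1) auto
      then show "(\<Sum>r<2 * (n + k). rs_entry n k \<epsilon> z i r * L z r j) * c j = 0" by (simp only: mult_zero_left)
    qed
    finally show "(\<Sum>r<2 * (n + k). rs_entry n k \<epsilon> z i r * u r z) = 0" by simp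
  qed (auto intro: polyfun_intros)
  from linear_syzygy_in_image[OF n2 k3 \<epsilon> u(1,2) this] obtain b where
    b: "\<And>r z. r < 2 * (n + k) \<Longrightarrow> u r z = (\<Sum>i<k. L z r i * b i)" by blast
  have "\<exists>c. \<forall>r<2 * (n + k). rep z r = (\<Sum>i<k. L z r i * c i)" if z: "z 0 \<noteq> 0" for z
  proof -
    obtain c where "\<forall>r<2 * (n + k). rep z r = u r z + (\<Sum>i<k. L z r i * c i)"
      using u(3)[of z] z by blast
    then show ?thesis
      by (intro exI[of _ "\<lambda>i. b i + c i"]) (simp add: b distrib_left sum.distrib)
  qed
  then show "z 0 \<noteq> 0 \<Longrightarrow> \<exists>c. \<forall>r<2 * (n + k). rep z r = (\<Sum>i<k. L z r i * c i)" .
qed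

text \<open>Pointwise membership off x_0 = 0 becomes membership of sections near every point: on a
  chart around \<open>p\<close> the coefficients are recovered from \<open>v p\<close> by a regular
  left inverse, and the resulting identity extends over x_0 = 0 by density.\<close>

lemma locally_in_image:
  assumes p: "p \<in> cone m"
  shows "\<exists>V. zariski_open m V \<and> p \<in> V \<and> V \<subseteq> W p \<and> v p \<in> monad_im m k (n + k) (A_mat n k \<epsilon>) 1 V"
proof -
  have carr: "p \<in> carrier_vec m" using p by (simp add: cone_def)
  have "vec m (($) p) \<in> cone m" using p by (simp only: vec_index_vec[OF carr])
  then have nz: "\<exists>l<m. p $ l \<noteq> 0" by (simp only: cone_coord_nonzero)
  obtain B where B: "B \<in> carrier_mat (2 * (n + k)) k" "chart_det n k \<epsilon> B (($) p) \<noteq> 0"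
    using rs_chart_exists[OF n2 k3 \<epsilon>(2) nz] by blast
  have n1: "n \<ge> 1" using n2 by simp
  note chart = chart_polyfun_hom[OF n1 B(1)]
  define g where "g q = chart_det n k \<epsilon> B (($) q)" for q
  define G where "G i r q = chart_mat n k \<epsilon> B (($) q) i r" for i r q
  have g_vec: "g (vec m z) = chart_det n k \<epsilon> B z" for z
    unfolding g_def by (rule polyfun_cong_coords[OF chart(1)]) simp
  have G_vec: "G i r (vec m z) = chart_mat n k \<epsilon> B z i r" if "i < k" "r < 2 * (n + k)" for i r z
    unfolding G_def by (rule polyfun_cong_coords[OF chart(3)[OF that]]) simp
  have g_form: "is_form m k g"
    unfolding is_form_iff_polyfun g_vec using chart(1,2) by simp
  have G_form: "is_form m (k - 1) (G i r)" if "i < k" "r < 2 * (n + k)" for i r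
    unfolding is_form_iff_polyfun G_vec[OF that] using chart(3,4)[OF that] by simp
  define V where "V = W p \<inter> {q \<in> cone m. g q \<noteq> 0}"
  have V: "zariski_open m V" "p \<in> V" "V \<subseteq> W p"
  proof -
    show "zariski_open m V"
      unfolding V_def using W[OF p] by (intro zariski_open_Int zariski_open_nonzero[OF g_form]) blast
  qed (use W[OF p] p B(2) in \<open>auto simp: V_def g_def\<close>)
  define c where "c i q = (\<Sum>r<2 * (n + k). G i r q * v p q $ r) / g q" for i q
  have c_section: "c i \<in> O_sections m 0 V" if i: "i < k" for i
  proof -
    have "(\<lambda>q. \<Sum>r<2 * (n + k). G i r q * v p q $ r) \<in> O_sections m (1 + int (k - 1)) V"
      using R i by (intro O_sections_sum O_sections_mult_form G_form O_sections_restrict[OF v_section[OF p] V(1,3)])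
        (auto simp: lessThan_empty_iff)
    \<comment> \<open>Degree count: 1 from the section, \<open>k - 1\<close> from the adjugate and
      \<open>- k\<close> from the determinant give degree 0, the twist of the source of J A^t when
      its target has twist 1.\<close>
    from O_sections_divide_form[OF this g_form] have "c i \<in> O_sections m (1 + int (k - 1) - int k) V"
      unfolding c_def[abs_def] V_def by blast
    then show ?thesis using k3 by (simp add: of_nat_diff)
  qed
  have image_form: "is_form m 1 (\<lambda>q. L (($) q) r i)" if "r < 2 * (n + k)" "i < k" for r i
  proof -
    have "L (($) (vec m z)) r i = L z r i" for z
      by (rule polyfun_cong_coords[OF rs_image_polyfun[OF n1 that(2,1)]]) simp
    then show ?thesis
      unfolding is_form_iff_polyfun using rs_image_polyfun[OF n1 that(2,1)] rs_image_hom[OF n1 that(2,1)]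
      by simp
  qed
  have image: "v p q $ r = (\<Sum>i<k. L (($) q) r i * c i q)" if q: "q \<in> V" and r: "r < 2 * (n + k)" for q r
  proof -
    have carr_q: "q \<in> carrier_vec m" using q by (auto simp: V_def cone_def)
    let ?e = "\<lambda>q. v p q $ r - (\<Sum>i<k. L (($) q) r i * c i q)"
    have "(\<lambda>q. \<Sum>i<k. L (($) q) r i * c i q) \<in> O_sections m (0 + int 1) V"
      using k3 r by (intro O_sections_sum O_sections_mult_form c_section image_form)
        (auto simp: lessThan_empty_iff)
    then have "?e \<in> O_sections m 1 V"
      by (intro O_sections_diff O_sections_restrict[OF v_section[OF p r] V(1,3)]) simp
    then have reg_e: "reg m {z. vec m z \<in> V} (\<lambda>z. ?e (vec m z))" by (rule O_sections_reg)
    have "?e (vec m z) = 0" if z: "z \<in> {z. vec m z \<in> V}" "z 0 \<noteq> 0" for z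
    proof -
      have zW: "vec m z \<in> W p" and gz: "chart_det n k \<epsilon> B z \<noteq> 0"
        using z(1) unfolding V_def g_vec[symmetric] by auto
      obtain c1 where c1: "\<And>r. r < 2 * (n + k) \<Longrightarrow> v p (vec m z) $ r = rep z r + (\<Sum>i<k. L z r i * c1 i)"
        using rep_compatible[OF p zW] by blast
      obtain c2 where c2: "\<And>r. r < 2 * (n + k) \<Longrightarrow> rep z r = (\<Sum>i<k. L z r i * c2 i)"
        using rep_in_image z(2) by blast
      let ?b = "\<lambda>i. c2 i + c1 i"
      have v_eq: "v p (vec m z) $ r = (\<Sum>j<k. L z r j * ?b j)" if "r < 2 * (n + k)" for r
        unfolding c1[OF that] c2[OF that] by (simp add: distrib_left sum.distrib)
      have "c i (vec m z) = ?b i" if i: "i < k" for i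
      proof -
        have "(\<Sum>r<2 * (n + k). G i r (vec m z) * v p (vec m z) $ r) =
            (\<Sum>r<2 * (n + k). \<Sum>j<k. chart_mat n k \<epsilon> B z i r * L z r j * ?b j)"
          by (intro sum.cong refl) (simp add: G_vec[OF i] v_eq sum_distrib_left mult.assoc del: add_2_eq_Suc')
        also have "\<dots> = (\<Sum>j<k. (\<Sum>r<2 * (n + k). chart_mat n k \<epsilon> B z i r * L z r j) * ?b j)"
          by (subst sum.swap) (simp only: sum_distrib_right)
        also have "\<dots> = (\<Sum>j<k. if i = j then chart_det n k \<epsilon> B z * ?b j else 0)"
          by (intro sum.cong refl, subst chart_mat_left_inverse[OF B(1) i]) auto
        also have "\<dots> = chart_det n k \<epsilon> B z * ?b i" using i by simp
        finally show ?thesis unfolding c_def g_vec using gz by simp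
      qed
      moreover have "L (($) (vec m z)) r i = L z r i" if "i < k" for i
        by (rule polyfun_cong_coords[OF rs_image_polyfun[OF n1 that r]]) simp
      ultimately show ?thesis using v_eq[OF r] by simp
    qed
    note zero = this
    have "?e (vec m (($) q)) = 0"
    proof (rule reg_eq_zero[OF reg_e, of "($) q" "\<lambda>z. z 0" "\<lambda>_. 1"])
      show "($) q \<in> {z. vec m z \<in> V}"
        unfolding mem_Collect_eq vec_index_vec[OF carr_q] by (rule q)
      show "(\<lambda>z. z 0) \<in> polyfun m" by (rule polyfun_coord) simp
      show "?e (vec m z) = 0" if "z \<in> {z. vec m z \<in> V}" "z 0 \<noteq> 0" for z
        by (rule zero[OF that])
    qed simp
    then show ?thesis unfolding vec_index_vec[OF carr_q] by simp
  qed
  let ?c = "\<lambda>q. vec k (\<lambda>i. c i q)"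
  have "v p \<in> O_vec_sections m (2 * (n + k)) 1 V"
    unfolding O_vec_sections_def
    using v_carrier[OF p] V O_sections_restrict[OF v_section[OF p] V(1,3)] by blast
  moreover have "?c \<in> O_vec_sections m k (1 - 1) V"
    unfolding O_vec_sections_def using c_section by simp
  moreover have "v p q = (sympl_J (n + k) * transpose_mat (A_mat n k \<epsilon> q)) *\<^sub>v ?c q" if q: "q \<in> V" for q
  proof (rule eq_vecI)
    have carr_q: "q \<in> carrier_vec m" using q by (auto simp: V_def cone_def)
    show "dim_vec (v p q) = dim_vec ((sympl_J (n + k) * transpose_mat (A_mat n k \<epsilon> q)) *\<^sub>v ?c q)"
      using v_carrier[OF p] q V(3) by auto
    fix r assume "r < dim_vec ((sympl_J (n + k) * transpose_mat (A_mat n k \<epsilon> q)) *\<^sub>v ?c q)"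
    then have r: "r < 2 * (n + k)" by simp
    show "v p q $ r = ((sympl_J (n + k) * transpose_mat (A_mat n k \<epsilon> q)) *\<^sub>v ?c q) $ r"
      unfolding image[OF q r] A_mat_eq_rs_mat[OF carr_q]
      by (subst rs_image_mult_vec_index[OF _ r]) auto
  qed
  ultimately have "v p \<in> monad_im m k (n + k) (A_mat n k \<epsilon>) 1 V"
    unfolding monad_im_def by (intro CollectI conjI bexI[of _ ?c] ballI)
  then show ?thesis using V by blast
qed

end

section \<open>Vanishing of global sections of E(1)\<close>

lemma H0_twist_subset_zero:
  assumes n: "n \<ge> 2" and k: "k \<ge> 3" and \<epsilon>: "\<epsilon> \<noteq> 0" "4 * (real n + 1) * cmod \<epsilon> < 1"
    and s: "s \<in> H0_twist (2 * n + 2) k (n + k) (A_mat n k \<epsilon>) 1"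
  shows "s = zero_section (2 * n + 2) k (n + k) (A_mat n k \<epsilon>) 1"
proof -
  let ?m = "2 * n + 2" and ?A = "A_mat n k \<epsilon>"
  let ?K = "monad_ker ?m k (n + k) ?A 1" and ?I = "monad_im ?m k (n + k) ?A 1"
  have ext: "s \<in> extensional (cone ?m)"
    and "\<forall>p\<in>cone ?m. \<exists>W v. zariski_open ?m W \<and> p \<in> W \<and> W \<subseteq> cone ?m \<and> v \<in> ?K W \<and>
      (\<forall>q\<in>W. s q = quotient_germ ?m ?K ?I W v q)"
    using s unfolding H0_twist_def monad_cohomology_def quotient_sheaf_def by auto
  then obtain W v where Wv: "\<And>p. p \<in> cone ?m \<Longrightarrow> zariski_open ?m (W p) \<and> p \<in> W p"
    "\<And>p. p \<in> cone ?m \<Longrightarrow> W p \<subseteq> cone ?m" "\<And>p. p \<in> cone ?m \<Longrightarrow> v p \<in> ?K (W p)"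
    "\<And>p q. p \<in> cone ?m \<Longrightarrow> q \<in> W p \<Longrightarrow> s q = quotient_germ ?m ?K ?I (W p) (v p) q"
    unfolding bchoice_iff by blast
  have A: "?A p \<in> carrier_mat k (2 * (n + k))" if "p \<in> carrier_vec ?m" for p by (rule A_mat_carrier)
  interpret rs_section n k \<epsilon> W v
  proof
    fix p q assume p: "p \<in> cone ?m" and q: "q \<in> W p"
    then have qc: "q \<in> cone ?m" using Wv(2) by blast
    \<comment> \<open>At \<open>q\<close> both chosen local sections represent \<open>s q\<close>.
      Membership of \<open>(W q, v q)\<close> in its own germ therefore transfers to the germ of
      \<open>v p\<close>, which says that the two differ by a section of the image.\<close>
    have "(W q, v q) \<in> quotient_germ ?m ?K ?I (W q) (v q) q"
      by (rule quotient_germ_refl[OF A]) (use Wv qc in auto)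
    also have "\<dots> = quotient_germ ?m ?K ?I (W p) (v p) q"
      using Wv(4)[OF p q] Wv(4)[OF qc, of q] Wv(1)[OF qc] by simp
    finally obtain V where "q \<in> V" "(\<lambda>x. v p x - v q x) \<in> ?I V" unfolding quotient_germ_def by blast
    then show "\<exists>c\<in>carrier_vec k. v p q - v q q = (sympl_J (n + k) * transpose_mat (?A q)) *\<^sub>v c"
      unfolding monad_im_def O_vec_sections_def by blast
  qed (use n k \<epsilon> Wv in auto)
  show ?thesis
  proof
    fix p
    show "s p = zero_section ?m k (n + k) ?A 1 p"
    proof (cases "p \<in> cone ?m")
      case True
      obtain V where V: "zariski_open ?m V" "p \<in> V" "V \<subseteq> W p" "v p \<in> ?I V"
        using locally_in_image[OF True] by blast
      have "s p = quotient_germ ?m ?K ?I (W p) (v p) p" using Wv(1,4)[OF True] by blast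
      also have "\<dots> = quotient_germ ?m ?K ?I (cone ?m) (\<lambda>_. 0\<^sub>v (2 * (n + k))) p"
        by (rule quotient_germ_eq_zero[OF A]) (use Wv True V in auto)
      finally show ?thesis using True by (simp only: zero_section_def restrict_apply if_True)
    next
      case False
      then show ?thesis using ext by (simp add: zero_section_def extensional_def)
    qed
  qed
qed

theorem proposition3p13:
  fixes n k :: nat
  assumes "n \<ge> 2" and "k \<ge> 3"
  shows "\<exists>\<delta>>0. \<forall>\<epsilon>::complex. \<epsilon> \<noteq> 0 \<and> cmod \<epsilon> < \<delta> \<longrightarrow>
           is_symplectic_monad (2*n+2) k (n+k) (A_mat n k \<epsilon>) \<and>
           H0_twist (2*n+2) k (n+k) (A_mat n k \<epsilon>) 1 =
             {zero_section (2*n+2) k (n+k) (A_mat n k \<epsilon>) 1}"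
proof (intro exI[of _ "1 / (4 * (real n + 1))"] conjI allI impI)
  show "1 / (4 * (real n + 1)) > 0" by simp
  fix \<epsilon> :: complex assume \<epsilon>: "\<epsilon> \<noteq> 0 \<and> cmod \<epsilon> < 1 / (4 * (real n + 1))"
  then have small: "4 * (real n + 1) * cmod \<epsilon> < 1" by (simp add: field_simps)
  show "is_symplectic_monad (2*n+2) k (n+k) (A_mat n k \<epsilon>)"
    by (rule rs_is_symplectic_monad[OF assms small])
  have "zero_section (2*n+2) k (n+k) (A_mat n k \<epsilon>) 1 \<in> H0_twist (2*n+2) k (n+k) (A_mat n k \<epsilon>) 1"
    by (rule zero_section_in_H0) (rule A_mat_carrier)
  then show "H0_twist (2*n+2) k (n+k) (A_mat n k \<epsilon>) 1 = {zero_section (2*n+2) k (n+k) (A_mat n k \<epsilon>) 1}"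
    using H0_twist_subset_zero[OF assms _ small] \<epsilon> by blast
qed

end
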